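(* Assume Vopěnka's principle. Let $\mathcal{K}$ be a locally presentable category. Then for every object $K$ of $\mathcal{K}$ there is a regular cardinal $\mu$ such that $K$ is $\mu$-pure injective.
   Context: For a regular cardinal $\mu$, a morphism $f:A\to B$ is $\mu$-pure if for every commutative square $f u = v g$ with $g:X\to Y$ a morphism between $\mu$-presentable objects, $u:X\to A$ and $v:Y\to B$, the morphism $u$ factors through $g$, i.e. there is $t:Y\to A$ with $t g=u$. A $\mu$-pure monomorphism is a monomorphism which is $\mu$-pure. An object $K$ is $\mu$-pure injective if it is injective with respect to all $\mu$-pure monomorphisms: for every $\mu$-pure monomorphism $h:A\to B$ and every $g:A\to K$ there is $g':B\to K$ with $g' h=g$. A category is locally presentable if it is cocomplete and, for some regular cardinal $\kappa$, has a set of $\kappa$-presentable objects such that every object is a $\kappa$-directed colimit of objects from that set. Vopěnka's principle: no locally presentable category has a large (proper class-sized) discrete full subcategory; equivalently, there is no proper class of graphs such that the only homomorphisms between its members are the identities. *)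

theory Defs
  imports Main "HOL-Library.FuncSet"
begin

unbundle cardinal_syntax

section \<open>The universe of sets\<close>

text \<open>A type of this class is a universe of sets: \<open>elts x\<close> is the collection of members of
  the set \<open>x\<close>.  The axioms are those of ZFC (choice is inherited from HOL), with separation and
  replacement for arbitrary HOL predicates and functions.  The classes over such a universe are the
  elements of the type \<open>'v set\<close>, and the sets are those classes that are of the form \<open>elts x\<close>.\<close>

class zfc =
  fixes elts :: "'a \<Rightarrow> 'a set"
  assumes extensionality: "elts x = elts y \<Longrightarrow> x = y"
    and foundation: "wf {(x, y). x \<in> elts y}"
    and separation: "Y \<subseteq> elts x \<Longrightarrow> Y \<in> range elts"
    and union: "(\<Union>y\<in>elts x. elts y) \<in> range elts"
    and power_set: "{y. elts y \<subseteq> elts x} \<in> range elts"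
    and replacement: "f ` elts x \<in> range elts"
    and infinity: "range (g :: nat \<Rightarrow> 'a) \<in> range elts"

definition small :: "'v::zfc set \<Rightarrow> bool" where
  "small A \<longleftrightarrow> A \<in> range elts"

text \<open>Cardinals are represented, as in the HOL library, by well-orders of minimal order type on
  their field; a cardinal of the universe is one whose field is a set of the universe.\<close>

definition regular_cardinal :: "'v::zfc rel \<Rightarrow> bool" where
  "regular_cardinal \<mu> \<longleftrightarrow> Cinfinite \<mu> \<and> regularCard \<mu> \<and> small (Field \<mu>)"


section \<open>Categories, functors and colimits\<close>

record ('o, 'a) cat =
  Obj :: "'o set"
  Arr :: "'a set"
  Dom :: "'a \<Rightarrow> 'o"
  Cod :: "'a \<Rightarrow> 'o"
  Idt :: "'o \<Rightarrow> 'a"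
  Cmp :: "'a \<Rightarrow> 'a \<Rightarrow> 'a"  (infixl \<open>\<cdot>\<index>\<close> 70)

definition hom :: "('o, 'a) cat \<Rightarrow> 'o \<Rightarrow> 'o \<Rightarrow> 'a set" where
  "hom C a b = {f \<in> Arr C. Dom C f = a \<and> Cod C f = b}"

locale category =
  fixes C :: "('o, 'a) cat" (structure)
  assumes Dom_in_Obj: "f \<in> Arr C \<Longrightarrow> Dom C f \<in> Obj C"
    and Cod_in_Obj: "f \<in> Arr C \<Longrightarrow> Cod C f \<in> Obj C"
    and Idt_in_hom: "a \<in> Obj C \<Longrightarrow> Idt C a \<in> hom C a a"
    and Cmp_in_hom: "f \<in> hom C a b \<Longrightarrow> g \<in> hom C b c \<Longrightarrow> g \<cdot> f \<in> hom C a c"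
    and Cmp_Idt: "f \<in> hom C a b \<Longrightarrow> f \<cdot> Idt C a = f"
    and Idt_Cmp: "f \<in> hom C a b \<Longrightarrow> Idt C b \<cdot> f = f"
    and Cmp_assoc: "f \<in> hom C a b \<Longrightarrow> g \<in> hom C b c \<Longrightarrow> h \<in> hom C c d \<Longrightarrow>
      h \<cdot> (g \<cdot> f) = (h \<cdot> g) \<cdot> f"

text \<open>A possibly large category over the universe is a value of type \<open>('v, 'v) cat\<close>: its objects
  and its arrows form classes of elements of the universe, and its hom-classes are sets.\<close>

definition locally_small :: "('o, 'v::zfc) cat \<Rightarrow> bool" where
  "locally_small C \<longleftrightarrow> (\<forall>a\<in>Obj C. \<forall>b\<in>Obj C. small (hom C a b))"

definition small_category :: "('v::zfc, 'v) cat \<Rightarrow> bool" where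
  "small_category J \<longleftrightarrow> category J \<and> small (Obj J) \<and> small (Arr J)"

record ('o, 'a, 'p, 'b) func =
  FObj :: "'o \<Rightarrow> 'p"
  FArr :: "'a \<Rightarrow> 'b"

definition is_functor :: "('o, 'a) cat \<Rightarrow> ('p, 'b) cat \<Rightarrow> ('o, 'a, 'p, 'b) func \<Rightarrow> bool" where
  "is_functor J C F \<longleftrightarrow>
    (\<forall>i\<in>Obj J. FObj F i \<in> Obj C) \<and>
    (\<forall>j\<in>Arr J. FArr F j \<in> hom C (FObj F (Dom J j)) (FObj F (Cod J j))) \<and>
    (\<forall>i\<in>Obj J. FArr F (Idt J i) = Idt C (FObj F i)) \<and>
    (\<forall>j\<in>Arr J. \<forall>k\<in>Arr J. Dom J k = Cod J j \<longrightarrow>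
      FArr F (k \<cdot>\<^bsub>J\<^esub> j) = FArr F k \<cdot>\<^bsub>C\<^esub> FArr F j)"

definition func_comp ::
  "('p, 'b, 'q, 'c) func \<Rightarrow> ('o, 'a, 'p, 'b) func \<Rightarrow> ('o, 'a, 'q, 'c) func" where
  "func_comp G F = \<lparr>FObj = FObj G \<circ> FObj F, FArr = FArr G \<circ> FArr F\<rparr>"

definition is_cocone ::
  "('o, 'a) cat \<Rightarrow> ('p, 'b) cat \<Rightarrow> ('o, 'a, 'p, 'b) func \<Rightarrow> 'p \<Rightarrow> ('o \<Rightarrow> 'b) \<Rightarrow> bool" where
  "is_cocone J C F L c \<longleftrightarrow>
    L \<in> Obj C \<and> (\<forall>i\<in>Obj J. c i \<in> hom C (FObj F i) L) \<and>
    (\<forall>j\<in>Arr J. c (Cod J j) \<cdot>\<^bsub>C\<^esub> FArr F j = c (Dom J j))"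

definition is_colimit ::
  "('o, 'a) cat \<Rightarrow> ('p, 'b) cat \<Rightarrow> ('o, 'a, 'p, 'b) func \<Rightarrow> 'p \<Rightarrow> ('o \<Rightarrow> 'b) \<Rightarrow> bool" where
  "is_colimit J C F L c \<longleftrightarrow>
    is_cocone J C F L c \<and>
    (\<forall>M d. is_cocone J C F M d \<longrightarrow>
      (\<exists>!u. u \<in> hom C L M \<and> (\<forall>i\<in>Obj J. u \<cdot>\<^bsub>C\<^esub> c i = d i)))"

definition cocomplete :: "('v::zfc, 'v) cat \<Rightarrow> bool" where
  "cocomplete C \<longleftrightarrow>
    (\<forall>(J :: ('v, 'v) cat) F. small_category J \<longrightarrow> is_functor J C F \<longrightarrow>
      (\<exists>L c. is_colimit J C F L c))"


section \<open>Directed colimits and presentable objects\<close>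

definition directed_poset :: "'v::zfc rel \<Rightarrow> 'v set \<Rightarrow> 'v rel \<Rightarrow> bool" where
  "directed_poset \<mu> I r \<longleftrightarrow>
    small I \<and> partial_order_on I r \<and>
    (\<forall>A. A \<subseteq> I \<longrightarrow> |A| <o \<mu> \<longrightarrow> (\<exists>u\<in>I. \<forall>a\<in>A. (a, u) \<in> r))"

definition poset_cat :: "'i set \<Rightarrow> 'i rel \<Rightarrow> ('i, 'i \<times> 'i) cat" where
  "poset_cat I r =
    \<lparr>Obj = I, Arr = r, Dom = fst, Cod = snd, Idt = (\<lambda>i. (i, i)),
     Cmp = (\<lambda>k j. (fst j, snd k))\<rparr>"

text \<open>The category of sets.  A morphism carries its domain and codomain, and its underlying
  function is extensional, i.e. equal to \<open>undefined\<close> outside the domain.\<close>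

definition SET :: "('v::zfc set, 'v set \<times> ('v \<Rightarrow> 'v) \<times> 'v set) cat" where
  "SET =
    \<lparr>Obj = {A. small A},
     Arr = {(A, f, B). small A \<and> small B \<and> f \<in> A \<rightarrow>\<^sub>E B},
     Dom = (\<lambda>(A, f, B). A),
     Cod = (\<lambda>(A, f, B). B),
     Idt = (\<lambda>A. (A, \<lambda>x\<in>A. x, A)),
     Cmp = (\<lambda>(B', g, D) (A, f, B). (A, compose A g f, D))\<rparr>"

definition hom_functor ::
  "('o, 'v::zfc) cat \<Rightarrow> 'o \<Rightarrow> ('o, 'v, 'v set, 'v set \<times> ('v \<Rightarrow> 'v) \<times> 'v set) func" where
  "hom_functor C A =
    \<lparr>FObj = (\<lambda>X. hom C A X),
     FArr = (\<lambda>f. (hom C A (Dom C f), \<lambda>g\<in>hom C A (Dom C f). f \<cdot>\<^bsub>C\<^esub> g, hom C A (Cod C f)))\<rparr>"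

definition presentable :: "('v::zfc, 'v) cat \<Rightarrow> 'v rel \<Rightarrow> 'v \<Rightarrow> bool" where
  "presentable C \<mu> A \<longleftrightarrow>
    A \<in> Obj C \<and>
    (\<forall>I r F L c.
      directed_poset \<mu> I r \<longrightarrow> is_functor (poset_cat I r) C F \<longrightarrow>
      is_colimit (poset_cat I r) C F L c \<longrightarrow>
      is_colimit (poset_cat I r) SET (func_comp (hom_functor C A) F)
        (FObj (hom_functor C A) L) (\<lambda>i. FArr (hom_functor C A) (c i)))"

definition locally_presentable :: "('v::zfc, 'v) cat \<Rightarrow> bool" where
  "locally_presentable C \<longleftrightarrow>
    category C \<and> locally_small C \<and> cocomplete C \<and>
    (\<exists>\<kappa>. regular_cardinal \<kappa> \<and>
      (\<exists>S. S \<subseteq> Obj C \<and> small S \<and> (\<forall>A\<in>S. presentable C \<kappa> A) \<and>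
        (\<forall>X\<in>Obj C. \<exists>I r F c.
          directed_poset \<kappa> I r \<and> is_functor (poset_cat I r) C F \<and>
          (\<forall>i\<in>I. FObj F i \<in> S) \<and> is_colimit (poset_cat I r) C F X c)))"


section \<open>Purity and pure injectivity\<close>

definition monomorphism :: "('o, 'a) cat \<Rightarrow> 'o \<Rightarrow> 'o \<Rightarrow> 'a \<Rightarrow> bool" where
  "monomorphism C A B f \<longleftrightarrow>
    f \<in> hom C A B \<and>
    (\<forall>X\<in>Obj C. \<forall>g\<in>hom C X A. \<forall>h\<in>hom C X A. f \<cdot>\<^bsub>C\<^esub> g = f \<cdot>\<^bsub>C\<^esub> h \<longrightarrow> g = h)"

definition pure :: "('v::zfc, 'v) cat \<Rightarrow> 'v rel \<Rightarrow> 'v \<Rightarrow> 'v \<Rightarrow> 'v \<Rightarrow> bool" where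
  "pure C \<mu> A B f \<longleftrightarrow>
    f \<in> hom C A B \<and>
    (\<forall>X Y. presentable C \<mu> X \<longrightarrow> presentable C \<mu> Y \<longrightarrow>
      (\<forall>g\<in>hom C X Y. \<forall>u\<in>hom C X A. \<forall>v\<in>hom C Y B.
        f \<cdot>\<^bsub>C\<^esub> u = v \<cdot>\<^bsub>C\<^esub> g \<longrightarrow> (\<exists>t\<in>hom C Y A. t \<cdot>\<^bsub>C\<^esub> g = u)))"

definition pure_injective :: "('v::zfc, 'v) cat \<Rightarrow> 'v rel \<Rightarrow> 'v \<Rightarrow> bool" where
  "pure_injective C \<mu> K \<longleftrightarrow>
    K \<in> Obj C \<and>
    (\<forall>A\<in>Obj C. \<forall>B\<in>Obj C. \<forall>h. pure C \<mu> A B h \<and> monomorphism C A B h \<longrightarrow>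
      (\<forall>g\<in>hom C A K. \<exists>g'\<in>hom C B K. g' \<cdot>\<^bsub>C\<^esub> h = g))"


section \<open>Vopenka's principle\<close>

definition full_subcategory :: "('o, 'a) cat \<Rightarrow> 'o set \<Rightarrow> ('o, 'a) cat" where
  "full_subcategory C D = C\<lparr>Obj := D, Arr := {f \<in> Arr C. Dom C f \<in> D \<and> Cod C f \<in> D}\<rparr>"

definition discrete :: "('o, 'a) cat \<Rightarrow> bool" where
  "discrete C \<longleftrightarrow> (\<forall>f\<in>Arr C. f = Idt C (Dom C f))"

text \<open>A class of objects is large if it is not a set of the universe.\<close>

definition vopenka_principle :: "'v::zfc itself \<Rightarrow> bool" where
  "vopenka_principle _ \<longleftrightarrow>
    (\<forall>(C :: ('v, 'v) cat) D. locally_presentable C \<longrightarrow> D \<subseteq> Obj C \<longrightarrow>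
      discrete (full_subcategory C D) \<longrightarrow> small D)"

end

theory Submission
  imports Defs
begin

text \<open>Suppose that \<open>K\<close> is \<open>\<mu>\<close>-pure injective for no regular cardinal \<open>\<mu>\<close>.  Then every \<open>\<mu>\<close> has a bad
  span: a \<open>\<mu>\<close>-pure monomorphism \<open>h: A \<rightarrow> B\<close> and a morphism \<open>g: A \<rightarrow> K\<close> that does not extend along \<open>h\<close>.
  Let \<open>h': A' \<rightarrow> B'\<close> and \<open>g': A' \<rightarrow> K\<close> be the bad span of another cardinal \<open>\<mu>'\<close>.  A morphism from the
  first span to the second is a pair \<open>a: A \<rightarrow> A'\<close>, \<open>b: B \<rightarrow> B'\<close> with \<open>h' a = b h\<close> and \<open>g' a = g\<close>.  If \<open>A\<close>
  and \<open>B\<close> are \<open>\<mu>'\<close>-presentable, there is none: purity of \<open>h'\<close> yields \<open>t: B \<rightarrow> A'\<close> with \<open>t h = a\<close>, and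
  \<open>g' t\<close> would extend \<open>g\<close> (\<open>pure_extension\<close>).  Every object is presentable for all sufficiently large
  regular cardinals (\<open>ex_presentability_bound\<close>), so in a sufficiently sparse class of cardinals no
  bad span admits a morphism to a later one.

  Vopenka's principle speaks of classes without non-identity morphisms, so morphisms to earlier spans
  and endomorphisms have to be excluded as well.  For this purpose each span is enriched by an
  uncountable regular cardinal, regarded as a strict order together with a chosen cofinal sequence
  below each nonzero element of countable cofinality.  Strictly monotone maps never lead to a smaller
  cardinal, and those that respect the chosen sequences are the identity (\<open>ladder_rigid\<close>).  An
  injective labelling of the elements of the span by elements of the cardinal makes the whole
  structure rigid (\<open>span_graph_rigid\<close>).

  The enriched spans are coded as graphs with edges labelled by a fixed set.  An object \<open>X\<close> is
  represented by the sets of morphisms \<open>s \<rightarrow> X\<close> with \<open>s\<close> in a small dense set of objects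
  (\<open>locally_presentable_dense\<close>); density turns graph homomorphisms back into morphisms of spans
  (\<open>span_graph_hom_span\<close>).  Labelled graphs form a locally finitely presentable category
  (\<open>locally_presentable_Gra\<close>), so Vopenka's principle applies and the codes of a sparse class of
  cardinals form a set.  Then a further cardinal lies beyond all of them, which is absurd if the class
  is maximal among the sparse ones.\<close>

section \<open>Sets of the universe\<close>

lemma small_elts: "small (elts x)"
  by (simp add: small_def)

lemma small_subset: "small B \<Longrightarrow> A \<subseteq> B \<Longrightarrow> small A"
  unfolding small_def by (metis imageE separation)

lemma small_image: "small A \<Longrightarrow> small (f ` A)"
  for A :: "'v::zfc set" and f :: "'v \<Rightarrow> 'v"
  unfolding small_def by (metis imageE replacement)

lemma small_range_nat: "small (range (g :: nat \<Rightarrow> 'v::zfc))"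
  unfolding small_def by (rule infinity)

text \<open>Infinity is given for arbitrary sequences, so together with separation it makes every countable
  class a set.\<close>

lemma small_countable:
  fixes A :: "'v::zfc set"
  assumes "|A| \<le>o natLeq"
  shows "small A"
proof (cases "A = {}")
  case True
  then show ?thesis
    by (meson empty_subsetI small_range_nat small_subset)
next
  case False
  have "|A| \<le>o |UNIV :: nat set|"
    using assms card_of_nat ordLeq_ordIso_trans ordIso_symmetric by blast
  then obtain g :: "nat \<Rightarrow> 'v" where "A \<subseteq> range g"
    using False by (metis card_of_ordLeq2 subset_refl)
  then show ?thesis
    by (rule small_subset[OF small_range_nat])
qed

lemma small_finite: "finite A \<Longrightarrow> small A"
  by (meson finite_iff_ordLess_natLeq ordLess_imp_ordLeq small_countable)

definition set_code :: "'v::zfc set \<Rightarrow> 'v" where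
  "set_code A = inv elts A"

lemma elts_set_code [simp]: "small A \<Longrightarrow> elts (set_code A) = A"
  unfolding set_code_def small_def by (metis f_inv_into_f)

lemma set_code_elts [simp]: "set_code (elts x) = x"
  by (metis elts_set_code extensionality small_elts)

lemma small_UN:
  fixes A :: "'v::zfc set" and F :: "'v \<Rightarrow> 'v set"
  assumes "small A" and "\<And>a. a \<in> A \<Longrightarrow> small (F a)"
  shows "small (\<Union>a\<in>A. F a)"
proof -
  obtain x where x: "elts x = (\<lambda>a. set_code (F a)) ` A"
    using small_image[OF assms(1)] unfolding small_def by (metis imageE)
  have "(\<Union>y\<in>elts x. elts y) = (\<Union>a\<in>A. F a)"
    using assms(2) by (auto simp: x)
  then show ?thesis
    using union[of x] by (simp add: small_def)
qed

lemma small_Pow: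
  assumes "small A"
  shows "small {y. elts y \<subseteq> A}"
  using assms power_set unfolding small_def by (metis imageE)

text \<open>Russell's paradox.  The consequence below is what makes pairing possible: a finite class is a
  set, so the universe is infinite.\<close>

lemma not_small_UNIV: "\<not> small (UNIV :: 'v::zfc set)"
proof
  assume "small (UNIV :: 'v set)"
  then have "small {x :: 'v. x \<notin> elts x}"
    by (rule small_subset) simp
  then obtain y :: 'v where "elts y = {x. x \<notin> elts x}"
    unfolding small_def by (metis imageE)
  then show False
    by blast
qed

lemma infinite_universe: "infinite (UNIV :: 'v::zfc set)"
  using not_small_UNIV small_finite by blast

subsection \<open>Pairs and tags\<close>

text \<open>The infinite universe is in bijection with its square.  A bijection, unlike Kuratowski pairs,
  makes every element a pair, so that codes of graphs and morphisms below need no well-formedness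
  conditions.\<close>

definition pair_code :: "'v::zfc \<times> 'v \<Rightarrow> 'v" where
  "pair_code = (SOME p. bij p)"

lemma bij_pair_code: "bij (pair_code :: 'v::zfc \<times> 'v \<Rightarrow> 'v)"
proof -
  have "|(UNIV :: 'v set) \<times> (UNIV :: 'v set)| =o |UNIV :: 'v set|"
    by (rule card_of_Times_same_infinite[OF infinite_universe])
  then have "\<exists>p :: 'v \<times> 'v \<Rightarrow> 'v. bij p"
    by (simp add: card_of_ordIso[symmetric])
  then show ?thesis
    unfolding pair_code_def by (rule someI_ex)
qed

definition pack :: "'v::zfc \<Rightarrow> 'v \<Rightarrow> 'v" where
  "pack x y = pair_code (x, y)"

definition pfst :: "'v::zfc \<Rightarrow> 'v" where
  "pfst z = fst (inv pair_code z)"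

definition psnd :: "'v::zfc \<Rightarrow> 'v" where
  "psnd z = snd (inv pair_code z)"

lemma pfst_pack [simp]: "pfst (pack x y) = x"
  and psnd_pack [simp]: "psnd (pack x y) = y"
  and pack_pfst_psnd [simp]: "pack (pfst z) (psnd z) = z"
  by (simp_all add: pfst_def psnd_def pack_def bij_pair_code bij_is_inj bij_is_surj surj_f_inv_f)

lemma pack_eq_iff [simp]: "pack x y = pack x' y' \<longleftrightarrow> x = x' \<and> y = y'"
  by (metis pfst_pack psnd_pack)

lemma small_pack_image:
  fixes A :: "'v::zfc set" and F :: "'v \<Rightarrow> 'v set"
  assumes "small A" and "\<And>a. a \<in> A \<Longrightarrow> small (F a)"
  shows "small {pack a b | a b. a \<in> A \<and> b \<in> F a}"
proof -
  have "{pack a b | a b. a \<in> A \<and> b \<in> F a} = (\<Union>a\<in>A. pack a ` F a)"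
    by auto
  then show ?thesis
    by (simp add: assms small_UN small_image)
qed

lemma card_of_pack: "|(\<lambda>(x, y). pack x y) ` R| =o |R|"
  by (rule ordIso_symmetric, rule card_of_ordIsoI[where f = "\<lambda>(x, y). pack x y"])
    (auto simp: bij_betw_def inj_on_def)

definition tag :: "nat \<Rightarrow> 'v::zfc" where
  "tag = (SOME g. inj g)"

lemma tag_eq_iff [simp]: "(tag m :: 'v::zfc) = tag n \<longleftrightarrow> m = n"
proof -
  have "\<exists>g :: nat \<Rightarrow> 'v. inj g"
    using infinite_countable_subset[OF infinite_universe] by blast
  then have "inj (tag :: nat \<Rightarrow> 'v)"
    unfolding tag_def by (rule someI_ex)
  then show ?thesis
    by (simp add: inj_eq)
qed

lemma small_Un:
  fixes A B :: "'v::zfc set"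
  assumes "small A" and "small B"
  shows "small (A \<union> B)"
proof -
  have "small (\<Union>a\<in>{tag 0 :: 'v, tag 1}. if a = tag 0 then A else B)"
    by (rule small_UN) (auto intro: assms small_finite)
  moreover have "(\<Union>a\<in>{tag 0 :: 'v, tag 1}. if a = tag 0 then A else B) = A \<union> B"
    by auto
  ultimately show ?thesis
    by simp
qed

subsection \<open>Regular cardinals\<close>

lemma card_of_range_tag: "|range (tag :: nat \<Rightarrow> 'v::zfc)| =o natLeq"
proof -
  have "|range (tag :: nat \<Rightarrow> 'v)| =o |UNIV :: nat set|"
    by (rule ordIso_symmetric, rule card_of_ordIsoI[where f = tag]) (auto simp: bij_betw_def inj_on_def)
  then show ?thesis
    using card_of_nat ordIso_transitive by blast
qed

lemma regular_cardinal_countable: "regular_cardinal |range (tag :: nat \<Rightarrow> 'v::zfc)|"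
proof -
  have "natLeq =o |range (tag :: nat \<Rightarrow> 'v)|"
    by (rule ordIso_symmetric[OF card_of_range_tag])
  then show ?thesis
    unfolding regular_cardinal_def
    using regularCard_ordIso natLeq_Cinfinite regularCard_natLeq Cinfinite_cong small_range_nat
    by (metis Field_card_of)
qed

text \<open>The successor cardinal of an infinite set is regular; it lives on sets of sets, and the power
  set axiom brings it back into the universe.\<close>

lemma ex_regular_cardinal:
  fixes Z :: "'v::zfc set"
  assumes "small Z"
  obtains \<mu> :: "'v rel" where "regular_cardinal \<mu>" and "|Z| <o \<mu>" and "natLeq <o \<mu>"
proof -
  define W where "W = Z \<union> range (tag :: nat \<Rightarrow> 'v)"
  have W: "small W"
    unfolding W_def by (rule small_Un[OF assms small_range_nat])
  have natW: "natLeq \<le>o |W|"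
    by (metis W_def card_of_mono1 card_of_range_tag inf_sup_ord(4) ordIso_ordLeq_trans
        ordIso_symmetric)
  then have CW: "Cinfinite |W|"
    by (metis card_of_Card_order cinfinite_mono natLeq_cinfinite)
  let ?s = "cardSuc |W|"
  have Cs: "Cinfinite ?s" and rs: "regularCard ?s"
    by (rule Cinfinite_cardSuc[OF CW], rule regularCard_cardSuc[OF CW])
  have "?s \<le>o |Pow W|"
    by (metis cardSuc_ordLess_ordLeq card_of_Card_order card_of_Pow)
  moreover have "|Pow W| =o |{y. elts y \<subseteq> W}|"
  proof (rule card_of_ordIsoI[where f = set_code])
    show "bij_betw set_code (Pow W) {y. elts y \<subseteq> W}"
    proof (rule bij_betw_byWitness[where f' = elts])
      show "\<forall>A\<in>Pow W. elts (set_code A) = A"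
        using small_subset[OF W] by simp
      then show "set_code ` Pow W \<subseteq> {y. elts y \<subseteq> W}"
        by auto
    qed auto
  qed
  ultimately have "?s \<le>o |{y. elts y \<subseteq> W}|"
    by (rule ordLeq_ordIso_trans)
  then have "|Field ?s| \<le>o |{y. elts y \<subseteq> W}|"
    using Cs card_of_Field_ordIso ordIso_ordLeq_trans by blast
  then obtain T where T: "T \<subseteq> {y. elts y \<subseteq> W}" "|Field ?s| =o |T|"
    by (metis internalize_card_of_ordLeq2)
  have sT: "?s =o |T|"
    using Cs T(2) card_of_Field_ordIso ordIso_symmetric ordIso_transitive by blast
  have WT: "|W| <o |T|"
    using sT cardSuc_greater card_of_Card_order ordLess_ordIso_trans by blast
  show thesis
  proof
    have "small T"
      using small_Pow[OF W] T(1) by (rule small_subset)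
    then show "regular_cardinal |T|"
      unfolding regular_cardinal_def
      using regularCard_ordIso[OF sT Cs rs] Cinfinite_cong[OF sT Cs]
      by (simp add: Field_card_of)
    have "|Z| \<le>o |W|"
      unfolding W_def by (rule card_of_mono1) simp
    then show "|Z| <o |T|"
      using WT by (rule ordLeq_ordLess_trans)
    show "natLeq <o |T|"
      using natW WT by (rule ordLeq_ordLess_trans)
  qed
qed

lemma regular_cardinal_Card_order: "regular_cardinal \<mu> \<Longrightarrow> Card_order \<mu>"
  by (simp add: regular_cardinal_def)

lemma regular_cardinal_Field: "regular_cardinal \<mu> \<Longrightarrow> |Field \<mu>| =o \<mu>"
  by (simp add: card_of_Field_ordIso regular_cardinal_def)


section \<open>Colimits and presentable objects\<close>

context category
begin

lemma homD: "f \<in> hom C a b \<Longrightarrow> f \<in> Arr C \<and> Dom C f = a \<and> Cod C f = b \<and> a \<in> Obj C \<and> b \<in> Obj C"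
  using Dom_in_Obj Cod_in_Obj by (auto simp: hom_def)

end

lemma functor_objD: "is_functor J C F \<Longrightarrow> i \<in> Obj J \<Longrightarrow> FObj F i \<in> Obj C"
  by (simp add: is_functor_def)

lemma functor_arrD:
  "is_functor J C F \<Longrightarrow> j \<in> Arr J \<Longrightarrow> FArr F j \<in> hom C (FObj F (Dom J j)) (FObj F (Cod J j))"
  by (simp add: is_functor_def)

lemma cocone_objD: "is_cocone J C F L c \<Longrightarrow> L \<in> Obj C"
  and cocone_legD: "is_cocone J C F L c \<Longrightarrow> i \<in> Obj J \<Longrightarrow> c i \<in> hom C (FObj F i) L"
  and cocone_compD: "is_cocone J C F L c \<Longrightarrow> j \<in> Arr J \<Longrightarrow>
    c (Cod J j) \<cdot>\<^bsub>C\<^esub> FArr F j = c (Dom J j)"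
  by (simp_all add: is_cocone_def)

lemma colimit_coconeD: "is_colimit J C F L c \<Longrightarrow> is_cocone J C F L c"
  by (simp add: is_colimit_def)

lemma colimit_induced:
  assumes "is_colimit J C F L c" and "is_cocone J C F M d"
  obtains u where "u \<in> hom C L M" and "\<And>i. i \<in> Obj J \<Longrightarrow> u \<cdot>\<^bsub>C\<^esub> c i = d i"
  using assms unfolding is_colimit_def by blast

lemma (in category) cocone_postcomp:
  assumes J: "category J" and F: "is_functor J C F"
    and c: "is_cocone J C F L c" and u: "u \<in> hom C L M"
  shows "is_cocone J C F M (\<lambda>i. u \<cdot> c i)"
  unfolding is_cocone_def
proof (intro conjI ballI)
  show "M \<in> Obj C"
    using homD[OF u] by simp
  show "u \<cdot> c i \<in> hom C (FObj F i) M" if "i \<in> Obj J" for i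
    using cocone_legD[OF c that] u by (rule Cmp_in_hom)
  show "u \<cdot> c (Cod J j) \<cdot> FArr F j = u \<cdot> c (Dom J j)" if j: "j \<in> Arr J" for j
    using Cmp_assoc[OF functor_arrD[OF F j] cocone_legD[OF c category.Cod_in_Obj[OF J j]] u]
      cocone_compD[OF c j] by simp
qed

text \<open>Uniqueness of the induced morphism, applied to the cocone that both morphisms induce.\<close>

lemma (in category) colimit_jointly_epic:
  assumes J: "category J" and F: "is_functor J C F" and c: "is_colimit J C F L c"
    and u: "u \<in> hom C L M" and v: "v \<in> hom C L M"
    and eq: "\<And>i. i \<in> Obj J \<Longrightarrow> u \<cdot> c i = v \<cdot> c i"
  shows "u = v"
proof -
  have "is_cocone J C F M (\<lambda>i. u \<cdot> c i)"
    by (rule cocone_postcomp[OF J F colimit_coconeD[OF c] u])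
  then have "\<exists>!w. w \<in> hom C L M \<and> (\<forall>i\<in>Obj J. w \<cdot> c i = u \<cdot> c i)"
    using c unfolding is_colimit_def by blast
  then show ?thesis
    using u v eq by (metis (no_types, lifting))
qed


subsection \<open>Diagrams indexed by posets\<close>

lemma poset_cat_sel [simp]:
  "Obj (poset_cat I r) = I" "Arr (poset_cat I r) = r"
  "Dom (poset_cat I r) = fst" "Cod (poset_cat I r) = snd"
  "Idt (poset_cat I r) i = (i, i)" "k \<cdot>\<^bsub>poset_cat I r\<^esub> j = (fst j, snd k)"
  by (simp_all add: poset_cat_def)

lemma directed_posetD:
  assumes "directed_poset \<mu> I r"
  shows "small I" "(i, j) \<in> r \<Longrightarrow> i \<in> I \<and> j \<in> I" "i \<in> I \<Longrightarrow> (i, i) \<in> r"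
    "(i, j) \<in> r \<Longrightarrow> (j, k) \<in> r \<Longrightarrow> (i, k) \<in> r"
    "A \<subseteq> I \<Longrightarrow> |A| <o \<mu> \<Longrightarrow> \<exists>u\<in>I. \<forall>a\<in>A. (a, u) \<in> r"
proof -
  have r: "partial_order_on I r"
    using assms by (simp add: directed_poset_def)
  then show "(i, j) \<in> r \<Longrightarrow> i \<in> I \<and> j \<in> I" "i \<in> I \<Longrightarrow> (i, i) \<in> r"
    by (auto simp: order_on_defs refl_on_def)
  show "(i, j) \<in> r \<Longrightarrow> (j, k) \<in> r \<Longrightarrow> (i, k) \<in> r"
    using r by (auto simp: order_on_defs trans_def)
qed (use assms in \<open>auto simp: directed_poset_def\<close>)

lemma category_poset_cat: "partial_order_on I r \<Longrightarrow> category (poset_cat I r)"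
  by unfold_locales (auto simp: hom_def order_on_defs refl_on_def elim: transE)

lemma directed_category: "directed_poset \<mu> I r \<Longrightarrow> category (poset_cat I r)"
  by (simp add: category_poset_cat directed_poset_def)

lemma directed_poset_antimono:
  assumes "\<kappa> \<le>o \<mu>" and "directed_poset \<mu> I r"
  shows "directed_poset \<kappa> I r"
  using assms ordLess_ordLeq_trans unfolding directed_poset_def by blast

lemma finite_less_regular:
  assumes "regular_cardinal \<mu>" and "finite A"
  shows "|A| <o \<mu>"
proof (rule finite_ordLess_infinite)
  show "Well_order \<mu>" "infinite (Field \<mu>)"
    using assms(1) by (simp_all add: regular_cardinal_def cinfinite_def card_order_on_def)
qed (use assms(2) in \<open>simp_all add: card_of_well_order_on Field_card_of\<close>)

lemma directed_bound_above:
  assumes \<mu>: "regular_cardinal \<mu>" and d: "directed_poset \<mu> I r"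
    and A: "A \<subseteq> I" "|A| <o \<mu>" and i: "i \<in> I"
  obtains u where "u \<in> I" "(i, u) \<in> r" "\<And>a. a \<in> A \<Longrightarrow> (a, u) \<in> r"
proof -
  have C: "Cinfinite \<mu>"
    using \<mu> by (simp add: regular_cardinal_def)
  have "|{i}| <o \<mu>"
    by (rule finite_less_regular[OF \<mu>]) simp
  then have "|A \<union> {i}| <o \<mu>"
    using A(2) C Un_Cinfinite_bound_strict by blast
  moreover have "A \<union> {i} \<subseteq> I"
    using A(1) i by simp
  ultimately obtain u where "u \<in> I" "\<forall>a\<in>A \<union> {i}. (a, u) \<in> r"
    using directed_posetD(5)[OF d] by blast
  then show thesis
    using that by blast
qed

lemma directed_bound_pair:
  assumes \<mu>: "regular_cardinal \<mu>" and d: "directed_poset \<mu> I r" and "i \<in> I" "j \<in> I"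
  obtains u where "u \<in> I" "(i, u) \<in> r" "(j, u) \<in> r"
proof -
  have "|{j}| <o \<mu>"
    by (rule finite_less_regular[OF \<mu>]) simp
  then show thesis
    using directed_bound_above[OF \<mu> d _ _ \<open>i \<in> I\<close>, of "{j}"] \<open>j \<in> I\<close> that by auto
qed

lemma poset_functor_comp:
  assumes "is_functor (poset_cat I r) C F" "directed_poset \<mu> I r" "(i, j) \<in> r" "(j, k) \<in> r"
  shows "FArr F (j, k) \<cdot>\<^bsub>C\<^esub> FArr F (i, j) = FArr F (i, k)"
  using assms unfolding is_functor_def by (metis fst_conv poset_cat_sel snd_conv)

lemma poset_functor_arr:
  "is_functor (poset_cat I r) C F \<Longrightarrow> (i, j) \<in> r \<Longrightarrow> FArr F (i, j) \<in> hom C (FObj F i) (FObj F j)"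
  using functor_arrD by fastforce

lemma poset_cocone_comp:
  "is_cocone (poset_cat I r) C F L c \<Longrightarrow> (i, j) \<in> r \<Longrightarrow> c j \<cdot>\<^bsub>C\<^esub> FArr F (i, j) = c i"
  using cocone_compD by fastforce

lemma poset_cocone_leg:
  "is_cocone (poset_cat I r) C F L c \<Longrightarrow> i \<in> I \<Longrightarrow> c i \<in> hom C (FObj F i) L"
  using cocone_legD by fastforce


subsection \<open>Presentability in terms of factorizations\<close>

lemma hom_functor_sel:
  "FObj (func_comp (hom_functor C A) F) i = hom C A (FObj F i)"
  "FObj (hom_functor C A) L = hom C A L"
  by (simp_all add: func_comp_def hom_functor_def)

lemma hom_functor_arr:
  "f \<in> hom C X Y \<Longrightarrow> FArr (hom_functor C A) f =
    (hom C A X, \<lambda>g\<in>hom C A X. f \<cdot>\<^bsub>C\<^esub> g, hom C A Y)"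
  by (simp add: hom_functor_def hom_def)

lemma func_comp_arr: "FArr (func_comp G F) j = FArr G (FArr F j)"
  by (simp add: func_comp_def)

lemma SET_sel [simp]:
  "Obj SET = {A. small A}" "(B', g, D) \<cdot>\<^bsub>SET\<^esub> (A, f, B) = (A, compose A g f, D)"
  by (simp_all add: SET_def)

lemma hom_SET: "x \<in> hom SET A B \<longleftrightarrow> small A \<and> small B \<and> (\<exists>f\<in>A \<rightarrow>\<^sub>E B. x = (A, f, B))"
  by (auto simp: hom_def SET_def)

lemma in_hom_SET: "small A \<Longrightarrow> small B \<Longrightarrow> f \<in> A \<rightarrow>\<^sub>E B \<Longrightarrow> (A, f, B) \<in> hom SET A B"
  by (simp add: hom_SET)

locale locally_small_category = category C
  for C :: "('v::zfc, 'v) cat" (structure) +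
  assumes ls: "locally_small C"

text \<open>The setting for reading presentability of \<open>A\<close> elementwise, as statements about the morphisms from
  \<open>A\<close> to the stages of a directed diagram and to the vertex of a cocone.\<close>

locale presentable_diagram = locally_small_category C
  for C :: "('v::zfc, 'v) cat" (structure) +
  fixes A :: 'v and \<mu> :: "'v rel" and I :: "'v set" and r :: "'v rel"
    and F :: "('v, 'v \<times> 'v, 'v, 'v) func" and L :: 'v and c :: "'v \<Rightarrow> 'v"
  assumes A: "A \<in> Obj C" and reg: "regular_cardinal \<mu>"
    and dir: "directed_poset \<mu> I r"
    and F: "is_functor (poset_cat I r) C F" and c: "is_cocone (poset_cat I r) C F L c"
begin

lemma Fobj: "i \<in> I \<Longrightarrow> FObj F i \<in> Obj C"
  using functor_objD[OF F] by simp

lemma Fhom: "(i, j) \<in> r \<Longrightarrow> FArr F (i, j) \<in> hom C (FObj F i) (FObj F j)"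
  by (rule poset_functor_arr[OF F])

lemma leg: "i \<in> I \<Longrightarrow> c i \<in> hom C (FObj F i) L"
  by (rule poset_cocone_leg[OF c])

lemma leg_comp:
  assumes "(i, j) \<in> r" and "f \<in> hom C A (FObj F i)"
  shows "c j \<cdot> (FArr F (i, j) \<cdot> f) = c i \<cdot> f"
  using Cmp_assoc[OF assms(2) Fhom[OF assms(1)] leg[of j]] poset_cocone_comp[OF c assms(1)]
    directed_posetD(2)[OF dir assms(1)] by simp

lemma F_comp:
  assumes "(i, j) \<in> r" "(j, k) \<in> r" and "f \<in> hom C A (FObj F i)"
  shows "FArr F (j, k) \<cdot> (FArr F (i, j) \<cdot> f) = FArr F (i, k) \<cdot> f"
  using Cmp_assoc[OF assms(3) Fhom[OF assms(1)] Fhom[OF assms(2)]]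
    poset_functor_comp[OF F dir assms(1,2)] by simp

lemma F_step: "(i, j) \<in> r \<Longrightarrow> f \<in> hom C A (FObj F i) \<Longrightarrow> FArr F (i, j) \<cdot> f \<in> hom C A (FObj F j)"
  using Fhom Cmp_in_hom by blast

lemma small_hom: "X \<in> Obj C \<Longrightarrow> small (hom C A X)"
  using ls A by (simp add: locally_small_def)

lemma L: "L \<in> Obj C"
  using c by (rule cocone_objD)

text \<open>Morphisms of sets are triples; the next facts translate cocones and factorizations of such
  triples into statements about the underlying families of functions.\<close>

lemma hom_cocone_iff:
  assumes M: "small M"
  shows "is_cocone (poset_cat I r) SET (func_comp (hom_functor C A) F) M
      (\<lambda>i. (hom C A (FObj F i), restrict (\<delta> i) (hom C A (FObj F i)), M)) \<longleftrightarrow>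
    (\<forall>i\<in>I. \<forall>f\<in>hom C A (FObj F i). \<delta> i f \<in> M) \<and>
    (\<forall>(i, j)\<in>r. \<forall>f\<in>hom C A (FObj F i). \<delta> j (FArr F (i, j) \<cdot> f) = \<delta> i f)"
    (is "is_cocone ?J SET ?HF M ?d \<longleftrightarrow> ?vals \<and> ?nat")
proof -
  have legs: "?d i \<in> hom SET (FObj ?HF i) M \<longleftrightarrow> (\<forall>f\<in>hom C A (FObj F i). \<delta> i f \<in> M)"
    if "i \<in> I" for i
    using small_hom[OF Fobj[OF that]] M
    by (auto simp: hom_functor_sel hom_SET PiE_iff)
  have nat: "?d j \<cdot>\<^bsub>SET\<^esub> FArr ?HF (i, j) = ?d i \<longleftrightarrow>
      (\<forall>f\<in>hom C A (FObj F i). \<delta> j (FArr F (i, j) \<cdot> f) = \<delta> i f)" if ij: "(i, j) \<in> r" for i j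
    using F_step[OF ij]
    by (auto simp: func_comp_arr hom_functor_arr[OF Fhom[OF ij]] compose_def restrict_def fun_eq_iff)
  have "(\<forall>j\<in>r. ?d (snd j) \<cdot>\<^bsub>SET\<^esub> FArr ?HF j = ?d (fst j)) \<longleftrightarrow> ?nat"
    using nat by (fastforce simp del: SET_sel)
  then show ?thesis
    unfolding is_cocone_def using legs M by (simp del: SET_sel(2))
qed

lemma hom_leg: "i \<in> I \<Longrightarrow> FArr (hom_functor C A) (c i) =
    (hom C A (FObj F i), restrict (\<lambda>f. c i \<cdot> f) (hom C A (FObj F i)), hom C A L)"
  by (rule hom_functor_arr[OF leg])

lemma hom_factor_iff:
  assumes "i \<in> I"
  shows "(hom C A L, restrict u (hom C A L), M) \<cdot>\<^bsub>SET\<^esub> FArr (hom_functor C A) (c i) =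
      (hom C A (FObj F i), restrict \<delta> (hom C A (FObj F i)), M) \<longleftrightarrow>
    (\<forall>f\<in>hom C A (FObj F i). u (c i \<cdot> f) = \<delta> f)"
  using leg[OF assms] Cmp_in_hom
  by (auto simp: hom_leg[OF assms] compose_def restrict_def fun_eq_iff)

text \<open>A predicate is a map into a two-element set, so a colimit of sets classifies compatible families
  of predicates.  Existence and uniqueness of the classified predicate give the two elementwise
  properties of presentable objects below without an explicit construction of directed colimits of
  sets.\<close>

lemma colimit_predicate:
  fixes Q :: "'v \<Rightarrow> 'v \<Rightarrow> bool"
  assumes lim: "is_colimit (poset_cat I r) SET (func_comp (hom_functor C A) F)
      (FObj (hom_functor C A) L) (\<lambda>i. FArr (hom_functor C A) (c i))"
    and Q: "\<And>i j f. (i, j) \<in> r \<Longrightarrow> f \<in> hom C A (FObj F i) \<Longrightarrow> Q j (FArr F (i, j) \<cdot> f) = Q i f"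
  shows "\<exists>q. (\<forall>i\<in>I. \<forall>f\<in>hom C A (FObj F i). q (c i \<cdot> f) = Q i f) \<and>
    (\<forall>q'. (\<forall>i\<in>I. \<forall>f\<in>hom C A (FObj F i). q' (c i \<cdot> f) = Q i f) \<longrightarrow> (\<forall>f\<in>hom C A L. q' f = q f))"
proof -
  define b :: "bool \<Rightarrow> 'v" where "b t = tag (if t then 1 else 0)" for t
  have b: "b s = b t \<longleftrightarrow> s = t" for s t
    by (simp add: b_def)
  let ?M = "range b"
  have M: "small ?M"
    by (rule small_finite) simp
  let ?d = "\<lambda>i. (hom C A (FObj F i), restrict (\<lambda>f. b (Q i f)) (hom C A (FObj F i)), ?M)"
  have "is_cocone (poset_cat I r) SET (func_comp (hom_functor C A) F) ?M ?d"
    unfolding hom_cocone_iff[OF M] using Q by auto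
  then have ex1: "\<exists>!u. u \<in> hom SET (hom C A L) ?M \<and>
      (\<forall>i\<in>I. u \<cdot>\<^bsub>SET\<^esub> FArr (hom_functor C A) (c i) = ?d i)"
    using lim unfolding is_colimit_def by (simp add: hom_functor_sel del: SET_sel)
  let ?u = "\<lambda>q. (hom C A L, restrict (\<lambda>f. b (q f)) (hom C A L), ?M)"
  have u_in: "?u q \<in> hom SET (hom C A L) ?M" for q
    using small_hom[OF L] M by (auto intro!: in_hom_SET)
  have u_fac: "(\<forall>i\<in>I. ?u q \<cdot>\<^bsub>SET\<^esub> FArr (hom_functor C A) (c i) = ?d i) \<longleftrightarrow>
      (\<forall>i\<in>I. \<forall>f\<in>hom C A (FObj F i). q (c i \<cdot> f) = Q i f)" for q
    using hom_factor_iff[of _ "\<lambda>f. b (q f)" ?M "\<lambda>f. b (Q _ f)"] by (simp add: b del: SET_sel)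
  obtain u where u: "u \<in> hom SET (hom C A L) ?M"
      "\<forall>i\<in>I. u \<cdot>\<^bsub>SET\<^esub> FArr (hom_functor C A) (c i) = ?d i"
    using ex1 by blast
  obtain w where w: "w \<in> hom C A L \<rightarrow>\<^sub>E ?M" "u = (hom C A L, w, ?M)"
    using u(1) by (auto simp: hom_SET)
  define q where "q f \<longleftrightarrow> w f = b True" for f
  have "w = restrict (\<lambda>f. b (q f)) (hom C A L)"
  proof
    fix f
    show "w f = restrict (\<lambda>f. b (q f)) (hom C A L) f"
    proof (cases "f \<in> hom C A L")
      case True
      then obtain t where "w f = b t"
        using w(1) by (auto simp: PiE_iff)
      then show ?thesis
        using True by (cases t) (auto simp: q_def b)
    qed (use w(1) in \<open>auto simp: PiE_iff extensional_def\<close>)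
  qed
  then have u_eq: "u = ?u q"
    using w(2) by simp
  show ?thesis
  proof (intro exI conjI ballI allI impI)
    show "q (c i \<cdot> f) = Q i f" if "i \<in> I" "f \<in> hom C A (FObj F i)" for i f
      using u(2) that unfolding u_eq u_fac by blast
    show "q' f = q f" if q': "\<forall>i\<in>I. \<forall>f\<in>hom C A (FObj F i). q' (c i \<cdot> f) = Q i f"
      and f: "f \<in> hom C A L" for q' f
    proof -
      have "\<forall>i\<in>I. ?u q' \<cdot>\<^bsub>SET\<^esub> FArr (hom_functor C A) (c i) = ?d i"
        unfolding u_fac using q' by blast
      then have "?u q' = u"
        using ex1 u u_in by blast
      then have "restrict (\<lambda>f. b (q' f)) (hom C A L) f = restrict (\<lambda>f. b (q f)) (hom C A L) f"
        unfolding u_eq by simp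
      then show ?thesis
        using f b by simp
    qed
  qed
qed

end

text \<open>The predicate of lying in the image of some leg restricts to the true predicate on every stage,
  hence is true.\<close>

lemma (in locally_small_category) presentable_factor:
  assumes reg: "regular_cardinal \<mu>" and pres: "presentable C \<mu> A"
    and dir: "directed_poset \<mu> I r" and F: "is_functor (poset_cat I r) C F"
    and colim: "is_colimit (poset_cat I r) C F L c" and f: "f \<in> hom C A L"
  obtains i g where "i \<in> I" "g \<in> hom C A (FObj F i)" "c i \<cdot> g = f"
proof -
  interpret presentable_diagram C A \<mu> I r F L c
    using reg pres dir F colimit_coconeD[OF colim]
    by unfold_locales (auto simp: presentable_def)
  have lim: "is_colimit (poset_cat I r) SET (func_comp (hom_functor C A) F)
      (FObj (hom_functor C A) L) (\<lambda>i. FArr (hom_functor C A) (c i))"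
    using pres dir F colim unfolding presentable_def by blast
  define im where "im h \<longleftrightarrow> (\<exists>i\<in>I. \<exists>g\<in>hom C A (FObj F i). c i \<cdot> g = h)" for h
  obtain q where q: "(\<forall>i\<in>I. \<forall>f\<in>hom C A (FObj F i). q (c i \<cdot> f) = True) \<and>
    (\<forall>q'. (\<forall>i\<in>I. \<forall>f\<in>hom C A (FObj F i). q' (c i \<cdot> f) = True) \<longrightarrow> (\<forall>f\<in>hom C A L. q' f = q f))"
    by (rule exE[OF colimit_predicate[OF lim, of "\<lambda>_ _. True", OF refl]])
  have "True = q f"
    using q[THEN conjunct2, THEN spec, of "\<lambda>_. True"] f by simp
  moreover have "im f = q f"
    using q[THEN conjunct2, THEN spec, of im] f im_def by auto
  ultimately show thesis
    using that unfolding im_def by blast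
qed

text \<open>Becoming equal to \<open>f\<close> further up is a compatible family of predicates because the diagram is
  directed; the predicate that it induces on the colimit cannot separate \<open>f\<close> from \<open>g\<close>.\<close>

lemma (in locally_small_category) presentable_merge:
  assumes reg: "regular_cardinal \<mu>" and pres: "presentable C \<mu> A"
    and dir: "directed_poset \<mu> I r" and F: "is_functor (poset_cat I r) C F"
    and colim: "is_colimit (poset_cat I r) C F L c"
    and i: "i \<in> I" and f: "f \<in> hom C A (FObj F i)" and g: "g \<in> hom C A (FObj F i)"
    and eq: "c i \<cdot> f = c i \<cdot> g"
  obtains j where "(i, j) \<in> r" "FArr F (i, j) \<cdot> f = FArr F (i, j) \<cdot> g"
proof -
  interpret presentable_diagram C A \<mu> I r F L c
    using reg pres dir F colimit_coconeD[OF colim]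
    by unfold_locales (auto simp: presentable_def)
  have lim: "is_colimit (poset_cat I r) SET (func_comp (hom_functor C A) F)
      (FObj (hom_functor C A) L) (\<lambda>i. FArr (hom_functor C A) (c i))"
    using pres dir F colim unfolding presentable_def by blast
  \<comment> \<open>The morphisms that become equal to \<open>f\<close> further up in the diagram.\<close>
  define Q where "Q k h \<longleftrightarrow> (\<exists>u. (i, u) \<in> r \<and> (k, u) \<in> r \<and> FArr F (i, u) \<cdot> f = FArr F (k, u) \<cdot> h)"
    for k h
  have "Q l (FArr F (k, l) \<cdot> h) = Q k h" if kl: "(k, l) \<in> r" and h: "h \<in> hom C A (FObj F k)" for k l h
  proof
    assume "Q l (FArr F (k, l) \<cdot> h)"
    then show "Q k h"
      unfolding Q_def using F_comp[OF kl _ h] directed_posetD(4)[OF dir kl] by auto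
  next
    assume "Q k h"
    then obtain u where u: "(i, u) \<in> r" "(k, u) \<in> r" "FArr F (i, u) \<cdot> f = FArr F (k, u) \<cdot> h"
      unfolding Q_def by blast
    obtain v where v: "(u, v) \<in> r" "(l, v) \<in> r"
      using directed_bound_pair[OF reg dir, of u l] u(2) kl directed_posetD(2)[OF dir] by metis
    have "FArr F (i, v) \<cdot> f = FArr F (u, v) \<cdot> (FArr F (i, u) \<cdot> f)"
      using F_comp[OF u(1) v(1) f] by simp
    also have "\<dots> = FArr F (k, v) \<cdot> h"
      using F_comp[OF u(2) v(1) h] u(3) by simp
    also have "\<dots> = FArr F (l, v) \<cdot> (FArr F (k, l) \<cdot> h)"
      using F_comp[OF kl v(2) h] by simp
    finally show "Q l (FArr F (k, l) \<cdot> h)"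
      unfolding Q_def using v directed_posetD(4)[OF dir u(1) v(1)] by blast
  qed
  then obtain q where q: "(\<forall>i\<in>I. \<forall>f\<in>hom C A (FObj F i). q (c i \<cdot> f) = Q i f) \<and>
    (\<forall>q'. (\<forall>i\<in>I. \<forall>f\<in>hom C A (FObj F i). q' (c i \<cdot> f) = Q i f) \<longrightarrow> (\<forall>f\<in>hom C A L. q' f = q f))"
    by (rule exE[OF colimit_predicate[OF lim]])
  then have "Q i f = Q i g"
    using i f g eq q[THEN conjunct1] by metis
  moreover have "Q i f"
    unfolding Q_def using directed_posetD(3)[OF dir i] by blast
  ultimately obtain u where u: "(i, u) \<in> r" "FArr F (i, u) \<cdot> f = FArr F (i, u) \<cdot> g"
    unfolding Q_def by blast
  then show thesis
    by (rule that)
qed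

text \<open>Conversely, existence of factorizations makes the canonical map from the directed colimit of
  morphism sets surjective, and merging makes it injective.\<close>

lemma (in locally_small_category) presentableI:
  assumes reg: "regular_cardinal \<mu>" and A: "A \<in> Obj C"
    and factor: "\<And>I r F L c f. directed_poset \<mu> I r \<Longrightarrow> is_functor (poset_cat I r) C F \<Longrightarrow>
      is_colimit (poset_cat I r) C F L c \<Longrightarrow> f \<in> hom C A L \<Longrightarrow>
      \<exists>i\<in>I. \<exists>g\<in>hom C A (FObj F i). c i \<cdot> g = f"
    and merge: "\<And>I r F L c i f g. directed_poset \<mu> I r \<Longrightarrow> is_functor (poset_cat I r) C F \<Longrightarrow>
      is_colimit (poset_cat I r) C F L c \<Longrightarrow> i \<in> I \<Longrightarrow> f \<in> hom C A (FObj F i) \<Longrightarrow>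
      g \<in> hom C A (FObj F i) \<Longrightarrow> c i \<cdot> f = c i \<cdot> g \<Longrightarrow>
      \<exists>j. (i, j) \<in> r \<and> FArr F (i, j) \<cdot> f = FArr F (i, j) \<cdot> g"
  shows "presentable C \<mu> A"
  unfolding presentable_def
proof (intro conjI allI impI)
  fix I r F L c
  assume dir: "directed_poset \<mu> I r" and F: "is_functor (poset_cat I r) C F"
    and lim: "is_colimit (poset_cat I r) C F L c"
  interpret presentable_diagram C A \<mu> I r F L c
    using reg A dir F colimit_coconeD[OF lim] by unfold_locales
  let ?J = "poset_cat I r" and ?HF = "func_comp (hom_functor C A) F"
  show "is_colimit ?J SET ?HF (FObj (hom_functor C A) L) (\<lambda>i. FArr (hom_functor C A) (c i))"
    unfolding is_colimit_def
  proof (intro conjI allI impI)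
    have cocone_cong: "is_cocone ?J SET ?HF M d = is_cocone ?J SET ?HF M d'"
      if "\<And>i. i \<in> I \<Longrightarrow> d i = d' i" for M d d'
      unfolding is_cocone_def using that directed_posetD(2)[OF dir] by auto
    have "is_cocone ?J SET ?HF (hom C A L)
        (\<lambda>i. (hom C A (FObj F i), restrict (\<lambda>f. c i \<cdot> f) (hom C A (FObj F i)), hom C A L))"
      unfolding hom_cocone_iff[OF small_hom[OF L]]
      using leg leg_comp Cmp_in_hom by blast
    then show "is_cocone ?J SET ?HF (FObj (hom_functor C A) L) (\<lambda>i. FArr (hom_functor C A) (c i))"
      by (subst cocone_cong[OF hom_leg]) (simp_all add: hom_functor_sel)
    fix M d
    assume d: "is_cocone ?J SET ?HF M d"
    have M: "small M"
      using d by (simp add: is_cocone_def)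
    define \<delta> where "\<delta> i = fst (snd (d i))" for i
    have d_eq: "d i = (hom C A (FObj F i), restrict (\<delta> i) (hom C A (FObj F i)), M)" if "i \<in> I" for i
      using cocone_legD[OF d, of i] that
      by (auto simp: hom_SET hom_functor_sel \<delta>_def PiE_restrict)
    have \<delta>: "(\<forall>i\<in>I. \<forall>f\<in>hom C A (FObj F i). \<delta> i f \<in> M) \<and>
        (\<forall>(i, j)\<in>r. \<forall>f\<in>hom C A (FObj F i). \<delta> j (FArr F (i, j) \<cdot> f) = \<delta> i f)"
      unfolding hom_cocone_iff[OF M, symmetric]
      by (rule iffD1[OF cocone_cong d]) (rule d_eq)
    have \<delta>_step: "\<delta> j (FArr F (i, j) \<cdot> f) = \<delta> i f"
      if "(i, j) \<in> r" "f \<in> hom C A (FObj F i)" for i j f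
      using \<delta> that by blast
    have wd: "\<delta> i f = \<delta> j g"
      if ij: "i \<in> I" "j \<in> I" and f: "f \<in> hom C A (FObj F i)" and g: "g \<in> hom C A (FObj F j)"
        and eq: "c i \<cdot> f = c j \<cdot> g" for i j f g
    proof -
      obtain k where k: "k \<in> I" "(i, k) \<in> r" "(j, k) \<in> r"
        using directed_bound_pair[OF reg dir ij] by blast
      have "c k \<cdot> (FArr F (i, k) \<cdot> f) = c k \<cdot> (FArr F (j, k) \<cdot> g)"
        using leg_comp[OF k(2) f] leg_comp[OF k(3) g] eq by simp
      then obtain l where l: "(k, l) \<in> r"
          "FArr F (k, l) \<cdot> (FArr F (i, k) \<cdot> f) = FArr F (k, l) \<cdot> (FArr F (j, k) \<cdot> g)"
        using merge[OF dir F lim k(1) F_step[OF k(2) f] F_step[OF k(3) g]] by blast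
      have "\<delta> i f = \<delta> l (FArr F (k, l) \<cdot> (FArr F (i, k) \<cdot> f))"
        using \<delta>_step[OF k(2) f] \<delta>_step[OF l(1) F_step[OF k(2) f]] by simp
      also have "\<dots> = \<delta> j g"
        using \<delta>_step[OF k(3) g] \<delta>_step[OF l(1) F_step[OF k(3) g]] l(2) by simp
      finally show ?thesis .
    qed
    define w where "w f = (SOME x. \<exists>i\<in>I. \<exists>g\<in>hom C A (FObj F i). c i \<cdot> g = f \<and> x = \<delta> i g)" for f
    have w: "w (c i \<cdot> g) = \<delta> i g" if "i \<in> I" "g \<in> hom C A (FObj F i)" for i g
      unfolding w_def by (rule some_equality) (use that wd in blast)+
    have wM: "w f \<in> M" if "f \<in> hom C A L" for f
      using factor[OF dir F lim that] w \<delta>[THEN conjunct1] by auto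
    have fac: "(hom C A L, restrict w' (hom C A L), M) \<cdot>\<^bsub>SET\<^esub> FArr (hom_functor C A) (c i) = d i \<longleftrightarrow>
        (\<forall>f\<in>hom C A (FObj F i). w' (c i \<cdot> f) = \<delta> i f)" if "i \<in> I" for i w'
      using hom_factor_iff[OF that] d_eq[OF that] by simp
    show "\<exists>!u. u \<in> hom SET (FObj (hom_functor C A) L) M \<and>
        (\<forall>i\<in>Obj ?J. u \<cdot>\<^bsub>SET\<^esub> FArr (hom_functor C A) (c i) = d i)"
    proof (rule ex1I[of _ "(hom C A L, restrict w (hom C A L), M)"])
      show "(hom C A L, restrict w (hom C A L), M) \<in> hom SET (FObj (hom_functor C A) L) M \<and>
          (\<forall>i\<in>Obj ?J. (hom C A L, restrict w (hom C A L), M) \<cdot>\<^bsub>SET\<^esub>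
            FArr (hom_functor C A) (c i) = d i)"
        using small_hom[OF L] M wM w fac
        by (auto simp: hom_functor_sel hom_SET simp del: SET_sel)
    next
      fix u
      assume u: "u \<in> hom SET (FObj (hom_functor C A) L) M \<and>
          (\<forall>i\<in>Obj ?J. u \<cdot>\<^bsub>SET\<^esub> FArr (hom_functor C A) (c i) = d i)"
      then obtain w' where w': "w' \<in> hom C A L \<rightarrow>\<^sub>E M" "u = (hom C A L, w', M)"
        by (auto simp: hom_functor_sel hom_SET simp del: SET_sel)
      have rw': "restrict w' (hom C A L) = w'"
        using w'(1) by (rule PiE_restrict)
      have agree: "w' (c i \<cdot> g) = \<delta> i g" if "i \<in> I" "g \<in> hom C A (FObj F i)" for i g
        using u fac[of i w'] that unfolding rw' w'(2) by simp
      have "restrict w' (hom C A L) = restrict w (hom C A L)"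
        by (rule restrict_ext) (use factor[OF dir F lim] w agree in force)
      then show "u = (hom C A L, restrict w (hom C A L), M)"
        using w'(2) rw' by simp
    qed
  qed
qed (rule A)


section \<open>The category of labelled graphs\<close>

text \<open>A graph is a pair of a set of vertices and a set of labelled edges \<open>(l, x, y)\<close>, both coded in
  the universe; every element of the universe codes such a pair, and \<open>is_graph L\<close> only demands that
  edges have labels in \<open>L\<close> and endpoints among the vertices.  A morphism carries its domain, its
  codomain and the graph of its vertex map.\<close>

definition verts :: "'v::zfc \<Rightarrow> 'v set" where
  "verts G = elts (pfst G)"

definition edges :: "'v::zfc \<Rightarrow> ('v \<times> 'v \<times> 'v) set" where
  "edges G = {(l, x, y). pack l (pack x y) \<in> elts (psnd G)}"

definition graph :: "'v::zfc set \<Rightarrow> ('v \<times> 'v \<times> 'v) set \<Rightarrow> 'v" where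
  "graph V E = pack (set_code V) (set_code ((\<lambda>(l, x, y). pack l (pack x y)) ` E))"

definition is_graph :: "'v::zfc set \<Rightarrow> 'v \<Rightarrow> bool" where
  "is_graph L G \<longleftrightarrow> edges G \<subseteq> L \<times> verts G \<times> verts G"

definition graph_hom :: "'v::zfc \<Rightarrow> 'v \<Rightarrow> ('v \<Rightarrow> 'v) \<Rightarrow> bool" where
  "graph_hom G H f \<longleftrightarrow> (\<forall>x\<in>verts G. f x \<in> verts H) \<and>
    (\<forall>l x y. (l, x, y) \<in> edges G \<longrightarrow> (l, f x, f y) \<in> edges H)"

definition mor :: "'v::zfc \<Rightarrow> 'v \<Rightarrow> ('v \<Rightarrow> 'v) \<Rightarrow> 'v" where
  "mor G H f = pack G (pack H (set_code ((\<lambda>x. pack x (f x)) ` verts G)))"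

definition app :: "'v::zfc \<Rightarrow> 'v \<Rightarrow> 'v" where
  "app m x = (THE y. pack x y \<in> elts (psnd (psnd m)))"

definition Gra :: "'v::zfc set \<Rightarrow> ('v, 'v) cat" where
  "Gra L = \<lparr>Obj = {G. is_graph L G},
     Arr = {mor G H f | G H f. is_graph L G \<and> is_graph L H \<and> graph_hom G H f},
     Dom = pfst, Cod = (\<lambda>m. pfst (psnd m)), Idt = (\<lambda>G. mor G G (\<lambda>x. x)),
     Cmp = (\<lambda>n m. mor (pfst m) (pfst (psnd n)) (\<lambda>x. app n (app m x)))\<rparr>"

lemma small_verts: "small (verts G)"
  by (simp add: verts_def small_elts)

lemma graph_eqI:
  assumes "verts G = verts H" and "edges G = edges H"
  shows "G = H"
proof -
  have "pfst G = pfst H"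
    using assms(1) extensionality unfolding verts_def by blast
  moreover have "elts (psnd G) = elts (psnd H)"
  proof (rule set_eqI)
    fix e
    have "(pfst e, pfst (psnd e), psnd (psnd e)) \<in> edges G \<longleftrightarrow>
        (pfst e, pfst (psnd e), psnd (psnd e)) \<in> edges H"
      using assms(2) by simp
    then show "e \<in> elts (psnd G) \<longleftrightarrow> e \<in> elts (psnd H)"
      by (simp add: edges_def)
  qed
  then have "psnd G = psnd H"
    by (rule extensionality)
  ultimately show ?thesis
    by (metis pack_pfst_psnd)
qed

lemma verts_graph: "small V \<Longrightarrow> verts (graph V E) = V"
  by (simp add: verts_def graph_def)

lemma edges_graph:
  assumes "small V" "small L" and E: "E \<subseteq> L \<times> V \<times> V"
  shows "edges (graph V E) = E"
proof -
  let ?c = "\<lambda>(l, x, y). pack l (pack x y)"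
  have "small {pack l p | l p. l \<in> L \<and> p \<in> {pack x y | x y. x \<in> V \<and> y \<in> V}}"
    using assms(1,2) by (intro small_pack_image)
  moreover have "?c ` E \<subseteq> {pack l p | l p. l \<in> L \<and> p \<in> {pack x y | x y. x \<in> V \<and> y \<in> V}}"
    using E by auto
  ultimately have "small (?c ` E)"
    by (rule small_subset)
  then show ?thesis
    by (force simp: edges_def graph_def)
qed

lemma edge_in: "is_graph L G \<Longrightarrow> (l, x, y) \<in> edges G \<Longrightarrow> l \<in> L \<and> x \<in> verts G \<and> y \<in> verts G"
  by (auto simp: is_graph_def)

lemma mor_dom_cod [simp]: "pfst (mor G H f) = G" "pfst (psnd (mor G H f)) = H"
  by (simp_all add: mor_def)

lemma app_mor [simp]: "x \<in> verts G \<Longrightarrow> app (mor G H f) x = f x"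
  using small_image[OF small_verts[of G], of "\<lambda>x. pack x (f x)"]
  by (auto simp: app_def mor_def)

lemma mor_cong: "(\<And>x. x \<in> verts G \<Longrightarrow> f x = g x) \<Longrightarrow> mor G H f = mor G H g"
  by (simp add: mor_def cong: image_cong)

lemma graph_hom_cong:
  assumes "is_graph L G" and "\<And>x. x \<in> verts G \<Longrightarrow> f x = g x"
  shows "graph_hom G H f = graph_hom G H g"
  using assms(2) edge_in[OF assms(1)] by (auto simp: graph_hom_def; metis)

lemma Gra_sel [simp]:
  "Obj (Gra L) = {G. is_graph L G}" "Idt (Gra L) G = mor G G (\<lambda>x. x)"
  "Dom (Gra L) = pfst" "Cod (Gra L) = (\<lambda>m. pfst (psnd m))"
  by (simp_all add: Gra_def)

text \<open>The vertex map \<open>app m\<close> is a normal form: it is unspecified outside the vertices of the domain,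
  but \<open>mor\<close> ignores its values there.\<close>

lemma hom_Gra: "m \<in> hom (Gra L) G H \<longleftrightarrow>
  is_graph L G \<and> is_graph L H \<and> graph_hom G H (app m) \<and> m = mor G H (app m)"
proof
  assume "m \<in> hom (Gra L) G H"
  then obtain f where f: "is_graph L G" "is_graph L H" "graph_hom G H f" "m = mor G H f"
    by (auto simp: hom_def Gra_def)
  moreover have "graph_hom G H (app m)"
    using f graph_hom_cong[OF f(1), of "app m" f H] by simp
  moreover have "mor G H (app m) = mor G H f"
    by (rule mor_cong) (simp add: f(4))
  ultimately show "is_graph L G \<and> is_graph L H \<and> graph_hom G H (app m) \<and> m = mor G H (app m)"
    by simp
next
  assume m: "is_graph L G \<and> is_graph L H \<and> graph_hom G H (app m) \<and> m = mor G H (app m)"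
  then have "pfst m = G" "pfst (psnd m) = H"
    by (metis mor_dom_cod)+
  then show "m \<in> hom (Gra L) G H"
    using m by (auto simp: hom_def Gra_def)
qed

lemma mor_in_hom:
  assumes "is_graph L G" "is_graph L H" "graph_hom G H f"
  shows "mor G H f \<in> hom (Gra L) G H"
  using assms by (auto simp: hom_def Gra_def)

lemma hom_GraD:
  assumes "m \<in> hom (Gra L) G H"
  shows "is_graph L G" "is_graph L H" "x \<in> verts G \<Longrightarrow> app m x \<in> verts H"
    "(l, x, y) \<in> edges G \<Longrightarrow> (l, app m x, app m y) \<in> edges H"
  using assms by (auto simp: hom_Gra graph_hom_def)

lemma hom_Gra_eqI:
  assumes "m \<in> hom (Gra L) G H" "n \<in> hom (Gra L) G H" "\<And>x. x \<in> verts G \<Longrightarrow> app m x = app n x"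
  shows "m = n"
  using assms mor_cong[of G "app m" "app n" H] by (metis hom_Gra)

lemma Cmp_Gra:
  assumes "m \<in> hom (Gra L) G H" "n \<in> hom (Gra L) H K"
  shows "n \<cdot>\<^bsub>Gra L\<^esub> m = mor G K (\<lambda>x. app n (app m x))"
  using assms by (simp add: hom_def) (simp add: Gra_def)

lemma app_Cmp:
  assumes "m \<in> hom (Gra L) G H" "n \<in> hom (Gra L) H K" "x \<in> verts G"
  shows "app (n \<cdot>\<^bsub>Gra L\<^esub> m) x = app n (app m x)"
  using assms by (simp add: Cmp_Gra)

lemma Cmp_in_hom_Gra:
  assumes "m \<in> hom (Gra L) G H" "n \<in> hom (Gra L) H K"
  shows "n \<cdot>\<^bsub>Gra L\<^esub> m \<in> hom (Gra L) G K"
  unfolding Cmp_Gra[OF assms]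
  using hom_GraD[OF assms(1)] hom_GraD[OF assms(2)]
  by (intro mor_in_hom) (auto simp: graph_hom_def)

lemma Cmp_Gra_eqI:
  assumes "m \<in> hom (Gra L) G H" "n \<in> hom (Gra L) H K" "k \<in> hom (Gra L) G K"
    "\<And>x. x \<in> verts G \<Longrightarrow> app n (app m x) = app k x"
  shows "n \<cdot>\<^bsub>Gra L\<^esub> m = k"
  by (rule hom_Gra_eqI[OF Cmp_in_hom_Gra[OF assms(1,2)] assms(3)])
    (simp add: app_Cmp[OF assms(1,2)] assms(4))

lemma category_Gra: "category (Gra L)"
proof
  show idt: "Idt (Gra L) G \<in> hom (Gra L) G G" if "G \<in> Obj (Gra L)" for G
    using that by (auto intro: mor_in_hom simp: graph_hom_def)
  show "m \<cdot>\<^bsub>Gra L\<^esub> Idt (Gra L) G = m" if "m \<in> hom (Gra L) G H" for m G H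
    by (rule Cmp_Gra_eqI[OF idt that that]) (use that in \<open>auto simp: hom_Gra\<close>)
  show "Idt (Gra L) H \<cdot>\<^bsub>Gra L\<^esub> m = m" if "m \<in> hom (Gra L) G H" for m G H
    by (rule Cmp_Gra_eqI[OF that idt that]) (use that in \<open>auto simp: hom_Gra graph_hom_def\<close>)
  show "k \<cdot>\<^bsub>Gra L\<^esub> (n \<cdot>\<^bsub>Gra L\<^esub> m) = (k \<cdot>\<^bsub>Gra L\<^esub> n) \<cdot>\<^bsub>Gra L\<^esub> m"
    if m: "m \<in> hom (Gra L) a b" and n: "n \<in> hom (Gra L) b c" and k: "k \<in> hom (Gra L) c d"
    for m n k a b c d
    by (rule Cmp_Gra_eqI[OF Cmp_in_hom_Gra[OF m n] k Cmp_in_hom_Gra[OF m Cmp_in_hom_Gra[OF n k]]])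
      (simp add: app_Cmp[OF m n] app_Cmp[OF m Cmp_in_hom_Gra[OF n k]] app_Cmp[OF n k]
        hom_GraD(3)[OF m])
  show "n \<cdot>\<^bsub>Gra L\<^esub> m \<in> hom (Gra L) a c" if "m \<in> hom (Gra L) a b" "n \<in> hom (Gra L) b c" for m n a b c
    using that by (rule Cmp_in_hom_Gra)
qed (auto simp: Gra_def)

lemma locally_small_Gra: "locally_small (Gra (L :: 'v::zfc set))"
  unfolding locally_small_def
proof (intro ballI)
  fix G H :: 'v
  let ?P = "{pack x y | x y. x \<in> verts G \<and> y \<in> verts H}"
  have "small {pack G (pack H p) | p. elts p \<subseteq> ?P}"
  proof -
    have "small ((\<lambda>p. pack G (pack H p)) ` {p. elts p \<subseteq> ?P})"
      by (intro small_image small_Pow small_pack_image small_verts)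
    then show ?thesis
      by (simp add: setcompr_eq_image)
  qed
  moreover have "hom (Gra L) G H \<subseteq> {pack G (pack H p) | p. elts p \<subseteq> ?P}"
  proof
    fix m
    assume m: "m \<in> hom (Gra L) G H"
    then have "m = mor G H (app m)"
      by (simp add: hom_Gra)
    moreover have "elts (set_code ((\<lambda>x. pack x (app m x)) ` verts G)) \<subseteq> ?P"
      using hom_GraD(3)[OF m] by (auto simp: small_image small_verts)
    ultimately show "m \<in> {pack G (pack H p) | p. elts p \<subseteq> ?P}"
      unfolding mor_def by blast
  qed
  ultimately show "small (hom (Gra L) G H)"
    by (rule small_subset)
qed

locale label_set =
  fixes L :: "'v::zfc set"
  assumes small_labels: "small L"
begin

sublocale Gra: locally_small_category "Gra L"
  by (intro locally_small_category.intro category_Gra)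
    (simp add: locally_small_category_axioms_def locally_small_Gra)

lemma is_graph_graph:
  "small V \<Longrightarrow> E \<subseteq> L \<times> V \<times> V \<Longrightarrow> is_graph L (graph V E)"
  by (simp add: is_graph_def verts_graph edges_graph[OF _ small_labels])

lemma leg_app:
  assumes "is_cocone J (Gra L) F M d" "category J" "is_functor J (Gra L) F" "j \<in> Arr J"
    and "x \<in> verts (FObj F (Dom J j))"
  shows "app (d (Cod J j)) (app (FArr F j) x) = app (d (Dom J j)) x"
  using app_Cmp[OF functor_arrD[OF assms(3,4)]
      cocone_legD[OF assms(1) category.Cod_in_Obj[OF assms(2,4)]] assms(5)]
    cocone_compD[OF assms(1,4)] by simp

subsection \<open>Cocompleteness\<close>

text \<open>The quotient of the disjoint union of all vertex sets is taken by the relation of being identified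
  by every cocone.  This is the relation generated by the diagram, but in this impredicative form the
  cocone and the induced morphisms come for free; equivalence classes are replaced by chosen
  representatives, which are elements of the universe again.\<close>

lemma cocomplete_Gra: "cocomplete (Gra L)"
  unfolding cocomplete_def
proof (intro allI impI)
  fix J :: "('v, 'v) cat" and F :: "('v, 'v, 'v, 'v) func"
  assume sJ: "small_category J" and F: "is_functor J (Gra L) F"
  have J: "category J"
    using sJ by (simp add: small_category_def)
  define rel where "rel i x j y \<longleftrightarrow>
    (\<forall>M d. is_cocone J (Gra L) F M d \<longrightarrow> app (d i) x = app (d j) y)" for i x j y
  define pt where "pt z \<longleftrightarrow> pfst z \<in> Obj J \<and> psnd z \<in> verts (FObj F (pfst z))" for z
  define rep where "rep i x = (SOME z. pt z \<and> rel i x (pfst z) (psnd z))" for i x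
  have rep: "pt (rep i x) \<and> rel i x (pfst (rep i x)) (psnd (rep i x))"
    if "i \<in> Obj J" "x \<in> verts (FObj F i)" for i x
    unfolding rep_def by (rule someI[of _ "pack i x"]) (simp add: pt_def rel_def that)
  have rep_eq: "rep i x = rep j y" if "rel i x j y" for i x j y
  proof -
    have "rel i x k z = rel j y k z" for k z
      using that unfolding rel_def by metis
    then show ?thesis
      by (simp add: rep_def)
  qed
  define V where "V = (\<Union>i\<in>Obj J. rep i ` verts (FObj F i))"
  define E where "E = {(l, rep i x, rep i y) | l x y i. i \<in> Obj J \<and> (l, x, y) \<in> edges (FObj F i)}"
  define Q where "Q = graph V E"
  have V: "small V"
    using sJ unfolding V_def small_category_def by (intro small_UN small_image small_verts) auto
  have Fi: "is_graph L (FObj F i)" if "i \<in> Obj J" for i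
    using functor_objD[OF F that] by simp
  have E: "E \<subseteq> L \<times> V \<times> V"
    unfolding E_def V_def using edge_in[OF Fi] by blast
  have Q: "is_graph L Q" and VQ: "verts Q = V" and EQ: "edges Q = E"
    using V E small_labels by (simp_all add: Q_def is_graph_graph verts_graph edges_graph)
  define c where "c i = mor (FObj F i) Q (rep i)" for i
  have c: "c i \<in> hom (Gra L) (FObj F i) Q" if "i \<in> Obj J" for i
    unfolding c_def using that
    by (intro mor_in_hom Fi Q) (auto simp: graph_hom_def VQ EQ V_def E_def)
  have "is_colimit J (Gra L) F Q c"
    unfolding is_colimit_def
  proof (intro conjI allI impI)
    show "is_cocone J (Gra L) F Q c"
      unfolding is_cocone_def
    proof (intro conjI ballI)
      show "c (Cod J j) \<cdot>\<^bsub>Gra L\<^esub> FArr F j = c (Dom J j)" if j: "j \<in> Arr J" for j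
      proof (rule Cmp_Gra_eqI[OF functor_arrD[OF F j] c c])
        fix x
        assume x: "x \<in> verts (FObj F (Dom J j))"
        have "rel (Cod J j) (app (FArr F j) x) (Dom J j) x"
          unfolding rel_def using leg_app[OF _ J F j x] by blast
        then show "app (c (Cod J j)) (app (FArr F j) x) = app (c (Dom J j)) x"
          using x hom_GraD(3)[OF functor_arrD[OF F j]] rep_eq by (simp add: c_def)
      qed (use j category.Cod_in_Obj[OF J] category.Dom_in_Obj[OF J] in auto)
    qed (use Q c in auto)
    fix M d
    assume d: "is_cocone J (Gra L) F M d"
    have dh: "d i \<in> hom (Gra L) (FObj F i) M" if "i \<in> Obj J" for i
      using cocone_legD[OF d that] .
    define u where "u z = app (d (pfst z)) (psnd z)" for z
    have u_rep: "u (rep i x) = app (d i) x" if "i \<in> Obj J" "x \<in> verts (FObj F i)" for i x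
      using rep[OF that] d unfolding u_def rel_def by simp
    have M: "is_graph L M"
      using cocone_objD[OF d] by simp
    have "graph_hom Q M u"
      unfolding graph_hom_def VQ EQ
    proof (intro conjI ballI allI impI)
      show "u z \<in> verts M" if "z \<in> V" for z
        using that u_rep hom_GraD(3)[OF dh] by (auto simp: V_def)
      show "(l, u a, u b) \<in> edges M" if lab: "(l, a, b) \<in> E" for l a b
      proof -
        obtain x y i where i: "i \<in> Obj J" "(l, x, y) \<in> edges (FObj F i)" "a = rep i x" "b = rep i y"
          using lab by (auto simp: E_def)
        then show ?thesis
          using u_rep hom_GraD(4)[OF dh[OF i(1)] i(2)] edge_in[OF Fi[OF i(1)] i(2)] by simp
      qed
    qed
    then have u: "mor Q M u \<in> hom (Gra L) Q M"
      by (rule mor_in_hom[OF Q M])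
    have repV: "rep i x \<in> verts Q" if "i \<in> Obj J" "x \<in> verts (FObj F i)" for i x
      using that by (auto simp: VQ V_def)
    show "\<exists>!w. w \<in> hom (Gra L) Q M \<and> (\<forall>i\<in>Obj J. w \<cdot>\<^bsub>Gra L\<^esub> c i = d i)"
    proof (rule ex1I[of _ "mor Q M u"], intro conjI ballI)
      show "mor Q M u \<cdot>\<^bsub>Gra L\<^esub> c i = d i" if i: "i \<in> Obj J" for i
        by (rule Cmp_Gra_eqI[OF c[OF i] u dh[OF i]]) (simp add: c_def i repV u_rep)
    next
      fix w
      assume w: "w \<in> hom (Gra L) Q M \<and> (\<forall>i\<in>Obj J. w \<cdot>\<^bsub>Gra L\<^esub> c i = d i)"
      show "w = mor Q M u"
      proof (rule hom_Gra_eqI[OF _ u])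
        fix z
        assume z: "z \<in> verts Q"
        then obtain i x where ix: "i \<in> Obj J" "x \<in> verts (FObj F i)" "z = rep i x"
          by (auto simp: VQ V_def)
        have "app (c i) x = z"
          using ix by (simp add: c_def)
        then have "app w z = app (w \<cdot>\<^bsub>Gra L\<^esub> c i) x"
          using app_Cmp[OF c[OF ix(1)] conjunct1[OF w] ix(2)] by simp
        also have "\<dots> = app (mor Q M u) z"
          using w ix u_rep z by simp
        finally show "app w z = app (mor Q M u) z" .
      qed (use w in simp)
    qed (rule u)
  qed
  then show "\<exists>L' c. is_colimit J (Gra L) F L' c"
    by blast
qed


subsection \<open>Finite graphs are finitely presentable\<close>

text \<open>The image of a colimiting cocone is a subgraph through which the cocone factors, so the
  inclusion of this subgraph has a section.\<close>

lemma colimit_onto: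
  assumes J: "category J" and F: "is_functor J (Gra L) F" and lim: "is_colimit J (Gra L) F Q c"
  shows colimit_vertex: "z \<in> verts Q \<Longrightarrow> \<exists>i\<in>Obj J. \<exists>x\<in>verts (FObj F i). app (c i) x = z"
    and colimit_edge: "(l, z, w) \<in> edges Q \<Longrightarrow>
      \<exists>i\<in>Obj J. \<exists>x y. (l, x, y) \<in> edges (FObj F i) \<and> app (c i) x = z \<and> app (c i) y = w"
proof -
  define V where "V = {z. \<exists>i\<in>Obj J. \<exists>x\<in>verts (FObj F i). app (c i) x = z}"
  define E where "E = {(l, z, w). \<exists>i\<in>Obj J. \<exists>x y.
    (l, x, y) \<in> edges (FObj F i) \<and> app (c i) x = z \<and> app (c i) y = w}"
  have coc: "is_cocone J (Gra L) F Q c"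
    by (rule colimit_coconeD[OF lim])
  have Q: "is_graph L Q"
    using cocone_objD[OF coc] by simp
  have c: "c i \<in> hom (Gra L) (FObj F i) Q" if "i \<in> Obj J" for i
    by (rule cocone_legD[OF coc that])
  have V: "V \<subseteq> verts Q"
    using hom_GraD(3)[OF c] by (auto simp: V_def)
  have sV: "small V"
    by (rule small_subset[OF small_verts V])
  have E: "E \<subseteq> L \<times> V \<times> V"
    using edge_in[OF hom_GraD(1)[OF c]] by (fastforce simp: V_def E_def)
  define M where "M = graph V E"
  have M: "is_graph L M" and VM: "verts M = V" and EM: "edges M = E"
    using sV E small_labels by (simp_all add: M_def is_graph_graph verts_graph edges_graph)
  define d where "d i = mor (FObj F i) M (app (c i))" for i
  have d: "d i \<in> hom (Gra L) (FObj F i) M" if "i \<in> Obj J" for i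
    unfolding d_def using that hom_GraD(1)[OF c]
    by (intro mor_in_hom M) (auto simp: graph_hom_def VM EM V_def E_def)
  have "is_cocone J (Gra L) F M d"
    unfolding is_cocone_def
  proof (intro conjI ballI)
    show "d (Cod J j) \<cdot>\<^bsub>Gra L\<^esub> FArr F j = d (Dom J j)" if j: "j \<in> Arr J" for j
      by (rule Cmp_Gra_eqI[OF functor_arrD[OF F j] d d])
        (use j category.Cod_in_Obj[OF J j] category.Dom_in_Obj[OF J j] leg_app[OF coc J F j]
          hom_GraD(3)[OF functor_arrD[OF F j]] in \<open>auto simp: d_def\<close>)
  qed (use M d in auto)
  then obtain u where u: "u \<in> hom (Gra L) Q M" "\<And>i. i \<in> Obj J \<Longrightarrow> u \<cdot>\<^bsub>Gra L\<^esub> c i = d i"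
    using colimit_induced[OF lim] by blast
  let ?e = "mor M Q (\<lambda>x. x)"
  have EQ: "E \<subseteq> edges Q"
    using hom_GraD(4)[OF c] by (auto simp: E_def)
  have e: "?e \<in> hom (Gra L) M Q"
    using V EQ by (intro mor_in_hom M Q) (auto simp: graph_hom_def VM EM)
  have "?e \<cdot>\<^bsub>Gra L\<^esub> u = Idt (Gra L) Q"
  proof (rule Gra.colimit_jointly_epic[OF J F lim])
    show "Idt (Gra L) Q \<in> hom (Gra L) Q Q"
      using Q by (intro Gra.Idt_in_hom) simp
    fix i
    assume i: "i \<in> Obj J"
    have "?e \<cdot>\<^bsub>Gra L\<^esub> u \<cdot>\<^bsub>Gra L\<^esub> c i = ?e \<cdot>\<^bsub>Gra L\<^esub> d i"
      using Gra.Cmp_assoc[OF c[OF i] u(1) e] u(2)[OF i] by simp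
    also have "\<dots> = c i"
      by (rule Cmp_Gra_eqI[OF d[OF i] e c[OF i]])
        (use hom_GraD(3)[OF d[OF i]] in \<open>auto simp: d_def\<close>)
    finally show "?e \<cdot>\<^bsub>Gra L\<^esub> u \<cdot>\<^bsub>Gra L\<^esub> c i = Idt (Gra L) Q \<cdot>\<^bsub>Gra L\<^esub> c i"
      using Gra.Idt_Cmp[OF c[OF i]] by simp
  qed (rule Cmp_in_hom_Gra[OF u(1) e])
  then have "app (?e \<cdot>\<^bsub>Gra L\<^esub> u) z = z" if "z \<in> verts Q" for z
    using that by simp
  then have fix_u: "app u z = z" if "z \<in> verts Q" for z
    using that app_Cmp[OF u(1) e that] hom_GraD(3)[OF u(1) that] by simp
  show "z \<in> verts Q \<Longrightarrow> \<exists>i\<in>Obj J. \<exists>x\<in>verts (FObj F i). app (c i) x = z"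
    using hom_GraD(3)[OF u(1), of z] fix_u[of z] by (simp add: VM V_def)
  show "(l, z, w) \<in> edges Q \<Longrightarrow>
      \<exists>i\<in>Obj J. \<exists>x y. (l, x, y) \<in> edges (FObj F i) \<and> app (c i) x = z \<and> app (c i) y = w"
    using hom_GraD(4)[OF u(1), of l z w] fix_u edge_in[OF Q, of l z w] by (simp add: EM E_def)
qed

text \<open>Two vertices of a stage that are never identified further up are separated by a cocone into the
  codiscrete graph on two vertices, hence also by the colimit.\<close>

lemma colimit_identifies:
  assumes reg: "regular_cardinal \<mu>" and dir: "directed_poset \<mu> I r"
    and F: "is_functor (poset_cat I r) (Gra L) F" and lim: "is_colimit (poset_cat I r) (Gra L) F Q c"
    and i: "i \<in> I" and x: "x \<in> verts (FObj F i)" and y: "y \<in> verts (FObj F i)"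
    and eq: "app (c i) x = app (c i) y"
  shows "\<exists>j. (i, j) \<in> r \<and> app (FArr F (i, j)) x = app (FArr F (i, j)) y"
proof -
  note J = directed_category[OF dir]
  have Fh: "FArr F (i, j) \<in> hom (Gra L) (FObj F i) (FObj F j)" if "(i, j) \<in> r" for i j
    by (rule poset_functor_arr[OF F that])
  have F_app: "app (FArr F (j, k)) (app (FArr F (i, j)) x) = app (FArr F (i, k)) x"
    if "(i, j) \<in> r" "(j, k) \<in> r" "x \<in> verts (FObj F i)" for i j k x
    using app_Cmp[OF Fh[OF that(1)] Fh[OF that(2)] that(3)] poset_functor_comp[OF F dir that(1,2)]
    by simp
  \<comment> \<open>The codiscrete graph on two vertices: maps into it are predicates on vertices.\<close>
  define b :: "bool \<Rightarrow> 'v" where "b t = tag (if t then 1 else 0)" for t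
  have b: "b s = b t \<longleftrightarrow> s = t" for s t
    by (simp add: b_def)
  define M where "M = graph (range b) (L \<times> range b \<times> range b)"
  have sb: "small (range b)"
    by (rule small_finite) simp
  have M: "is_graph L M" and VM: "verts M = range b" and EM: "edges M = L \<times> range b \<times> range b"
    using sb small_labels by (simp_all add: M_def is_graph_graph verts_graph edges_graph)
  have into_M: "mor G M (\<lambda>v. b (P v)) \<in> hom (Gra L) G M" if "is_graph L G" for G P
    using that by (intro mor_in_hom M) (auto simp: graph_hom_def VM EM is_graph_def)
  \<comment> \<open>The vertices that become equal to \<open>x\<close> further up in the diagram.\<close>
  define P where "P k z \<longleftrightarrow> (\<exists>u. (i, u) \<in> r \<and> (k, u) \<in> r \<and> app (FArr F (i, u)) x = app (FArr F (k, u)) z)"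
    for k z
  have P: "P l (app (FArr F (k, l)) z) = P k z" if kl: "(k, l) \<in> r" and z: "z \<in> verts (FObj F k)"
    for k l z
  proof
    assume "P l (app (FArr F (k, l)) z)"
    then show "P k z"
      unfolding P_def using F_app[OF kl _ z] directed_posetD(4)[OF dir kl] by auto
  next
    assume "P k z"
    then obtain u where u: "(i, u) \<in> r" "(k, u) \<in> r" "app (FArr F (i, u)) x = app (FArr F (k, u)) z"
      unfolding P_def by blast
    obtain v where v: "(u, v) \<in> r" "(l, v) \<in> r"
      using directed_bound_pair[OF reg dir, of u l] u(2) kl directed_posetD(2)[OF dir] by metis
    have "app (FArr F (i, v)) x = app (FArr F (l, v)) (app (FArr F (k, l)) z)"
      using F_app[OF u(1) v(1) x] F_app[OF u(2) v(1) z] F_app[OF kl v(2) z] u(3) by simp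
    then show "P l (app (FArr F (k, l)) z)"
      unfolding P_def using v directed_posetD(4)[OF dir u(1) v(1)] by blast
  qed
  define d where "d k = mor (FObj F k) M (\<lambda>z. b (P k z))" for k
  have d: "d k \<in> hom (Gra L) (FObj F k) M" if "k \<in> I" for k
    unfolding d_def by (rule into_M) (use functor_objD[OF F, of k] that in simp)
  have "is_cocone (poset_cat I r) (Gra L) F M d"
    unfolding is_cocone_def
  proof (intro conjI ballI)
    fix e
    assume e': "e \<in> Arr (poset_cat I r)"
    then obtain k l where e: "e = (k, l)" "(k, l) \<in> r"
      by (cases e) auto
    have kl: "k \<in> I" "l \<in> I"
      using directed_posetD(2)[OF dir e(2)] by auto
    have "d l \<cdot>\<^bsub>Gra L\<^esub> FArr F (k, l) = d k"
      by (rule Cmp_Gra_eqI[OF Fh[OF e(2)] d[OF kl(2)] d[OF kl(1)]])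
        (use hom_GraD(3)[OF Fh[OF e(2)]] P[OF e(2)] in \<open>auto simp: d_def\<close>)
    then show "d (Cod (poset_cat I r) e) \<cdot>\<^bsub>Gra L\<^esub> FArr F e = d (Dom (poset_cat I r) e)"
      by (simp add: e)
  qed (use M d in auto)
  then obtain u where u: "u \<in> hom (Gra L) Q M"
      "\<And>k. k \<in> Obj (poset_cat I r) \<Longrightarrow> u \<cdot>\<^bsub>Gra L\<^esub> c k = d k"
    using colimit_induced[OF lim] by blast
  have ui: "u \<cdot>\<^bsub>Gra L\<^esub> c i = d i"
    using u(2) i by simp
  have ci: "c i \<in> hom (Gra L) (FObj F i) Q"
    by (rule poset_cocone_leg[OF colimit_coconeD[OF lim] i])
  have "app (d i) x = app (d i) y"
    using app_Cmp[OF ci u(1) x] app_Cmp[OF ci u(1) y] eq ui by simp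
  then have "P i x = P i y"
    using x y b by (simp add: d_def)
  moreover have "P i x"
    unfolding P_def using directed_posetD(3)[OF dir i] by blast
  ultimately obtain j where "(i, j) \<in> r" "app (FArr F (i, j)) x = app (FArr F (i, j)) y"
    unfolding P_def by blast
  then show ?thesis
    by blast
qed

abbreviation omega :: "'v rel" where
  "omega \<equiv> |range (tag :: nat \<Rightarrow> 'v)|"

lemma less_omega_iff: "|A| <o omega \<longleftrightarrow> finite A"
  by (metis card_of_range_tag finite_iff_ordLess_natLeq ordIso_symmetric ordLess_ordIso_trans)

text \<open>A map from a finite graph to a directed colimit involves finitely many vertices and edges; each
  lifts to some stage, and finitely many identifications make the lifts fit together.\<close>

lemma presentable_finite_graph:
  assumes G: "is_graph L G" and fv: "finite (verts G)" and fe: "finite (edges G)"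
  shows "presentable (Gra L) omega G"
proof (rule Gra.presentableI[OF regular_cardinal_countable])
  show "G \<in> Obj (Gra L)"
    using G by simp
next
  fix I r F Q c f
  assume dir: "directed_poset omega I r" and F: "is_functor (poset_cat I r) (Gra L) F"
    and lim: "is_colimit (poset_cat I r) (Gra L) F Q c" and f: "f \<in> hom (Gra L) G Q"
  note reg = regular_cardinal_countable[where 'v = 'v]
  note J = directed_category[OF dir]
  note coc = colimit_coconeD[OF lim]
  have c: "c i \<in> hom (Gra L) (FObj F i) Q" if "i \<in> I" for i
    by (rule poset_cocone_leg[OF coc that])
  have Fh: "FArr F (i, j) \<in> hom (Gra L) (FObj F i) (FObj F j)" if "(i, j) \<in> r" for i j
    by (rule poset_functor_arr[OF F that])
  have rI: "i \<in> I \<and> j \<in> I" if "(i, j) \<in> r" for i j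
    by (rule directed_posetD(2)[OF dir that])
  have c_app: "app (c j) (app (FArr F (i, j)) x) = app (c i) x"
    if "(i, j) \<in> r" "x \<in> verts (FObj F i)" for i j x
    using app_Cmp[OF Fh[OF that(1)] c[OF conjunct2[OF rI[OF that(1)]]] that(2)]
      poset_cocone_comp[OF coc that(1)] by simp
  have F_app: "app (FArr F (j, k)) (app (FArr F (i, j)) x) = app (FArr F (i, k)) x"
    if "(i, j) \<in> r" "(j, k) \<in> r" "x \<in> verts (FObj F i)" for i j k x
    using app_Cmp[OF Fh[OF that(1)] Fh[OF that(2)] that(3)] poset_functor_comp[OF F dir that(1,2)]
    by simp
  have fin: "|A| <o omega" if "finite A" for A :: "'v set"
    using that by (simp add: less_omega_iff)
  \<comment> \<open>The finitely many vertices of \<open>G\<close> lift to one stage \<open>i\<close> of the diagram.\<close>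
  have "\<exists>i\<in>I. \<exists>y\<in>verts (FObj F i). app (c i) y = app f x" if "x \<in> verts G" for x
    using colimit_vertex[OF J F lim hom_GraD(3)[OF f that]] by simp
  then obtain iv y where iv: "\<And>x. x \<in> verts G \<Longrightarrow> iv x \<in> I"
      and y: "\<And>x. x \<in> verts G \<Longrightarrow> y x \<in> verts (FObj F (iv x)) \<and> app (c (iv x)) (y x) = app f x"
    by metis
  obtain i where i: "i \<in> I" "\<And>x. x \<in> verts G \<Longrightarrow> (iv x, i) \<in> r"
    using directed_posetD(5)[OF dir _ fin[OF finite_imageI[OF fv, of iv]]] iv by blast
  define g where "g x = app (FArr F (iv x, i)) (y x)" for x
  have g: "g x \<in> verts (FObj F i)" "app (c i) (g x) = app f x" if "x \<in> verts G" for x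
    using y[OF that] i(2)[OF that] c_app hom_GraD(3)[OF Fh] by (simp_all add: g_def)
  \<comment> \<open>Each edge of \<open>G\<close> is preserved from some later stage on.\<close>
  have "\<exists>j. (i, j) \<in> r \<and> (l, app (FArr F (i, j)) (g x), app (FArr F (i, j)) (g x')) \<in> edges (FObj F j)"
    if e: "(l, x, x') \<in> edges G" for l x x'
  proof -
    have xx: "x \<in> verts G" "x' \<in> verts G"
      using edge_in[OF G e] by auto
    obtain k z z' where k: "k \<in> I" "(l, z, z') \<in> edges (FObj F k)"
        "app (c k) z = app f x" "app (c k) z' = app f x'"
      using colimit_edge[OF J F lim hom_GraD(4)[OF f e]] by auto
    have zz: "z \<in> verts (FObj F k)" "z' \<in> verts (FObj F k)"
      using edge_in[OF hom_GraD(1)[OF c[OF k(1)]] k(2)] by auto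
    have merge: "\<exists>m. (n, m) \<in> r \<and> app (FArr F (i, m)) (g v) = app (FArr F (k, m)) w"
      if v: "v \<in> verts G" and w: "w \<in> verts (FObj F k)" "app (c k) w = app f v"
        and n: "(i, n) \<in> r" "(k, n) \<in> r" for v w n
    proof -
      have "app (c n) (app (FArr F (i, n)) (g v)) = app (c n) (app (FArr F (k, n)) w)"
        using c_app[OF n(1) g(1)[OF v]] c_app[OF n(2) w(1)] g(2)[OF v] w(2) by simp
      then obtain m where m: "(n, m) \<in> r"
          "app (FArr F (n, m)) (app (FArr F (i, n)) (g v)) = app (FArr F (n, m)) (app (FArr F (k, n)) w)"
        using colimit_identifies[OF reg dir F lim _ hom_GraD(3)[OF Fh[OF n(1)] g(1)[OF v]]
            hom_GraD(3)[OF Fh[OF n(2)] w(1)]] rI[OF n(1)] by blast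
      then show ?thesis
        using F_app[OF n(1) m(1) g(1)[OF v]] F_app[OF n(2) m(1) w(1)] by auto
    qed
    obtain n where n: "(i, n) \<in> r" "(k, n) \<in> r"
      using directed_bound_pair[OF reg dir i(1) k(1)] by blast
    obtain m where m: "(n, m) \<in> r" "app (FArr F (i, m)) (g x) = app (FArr F (k, m)) z"
      using merge[OF xx(1) zz(1) k(3) n] by blast
    have im: "(i, m) \<in> r" "(k, m) \<in> r"
      using n m(1) directed_posetD(4)[OF dir] by blast+
    obtain p where p: "(m, p) \<in> r" "app (FArr F (i, p)) (g x') = app (FArr F (k, p)) z'"
      using merge[OF xx(2) zz(2) k(4) im] by blast
    have ip: "(i, p) \<in> r" "(k, p) \<in> r"
      using im p(1) directed_posetD(4)[OF dir] by blast+
    have "app (FArr F (i, p)) (g x) = app (FArr F (k, p)) z"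
      using F_app[OF im(1) p(1) g(1)[OF xx(1)]] F_app[OF im(2) p(1) zz(1)] m(2) by simp
    then show ?thesis
      using p(2) ip hom_GraD(4)[OF Fh[OF ip(2)] k(2)] by auto
  qed
  then have "\<forall>e\<in>edges G. \<exists>j. (i, j) \<in> r \<and> (fst e, app (FArr F (i, j)) (g (fst (snd e))),
      app (FArr F (i, j)) (g (snd (snd e)))) \<in> edges (FObj F j)"
    by auto
  then obtain je where je: "\<And>e. e \<in> edges G \<Longrightarrow> (i, je e) \<in> r"
      "\<And>e. e \<in> edges G \<Longrightarrow> (fst e, app (FArr F (i, je e)) (g (fst (snd e))),
        app (FArr F (i, je e)) (g (snd (snd e)))) \<in> edges (FObj F (je e))"
    by metis
  obtain j where j: "(i, j) \<in> r" "\<And>e. e \<in> edges G \<Longrightarrow> (je e, j) \<in> r"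
    using directed_bound_above[OF reg dir _ fin[OF finite_imageI[OF fe, of je]] i(1)] je(1) rI
    by (smt (verit, best) image_iff subsetI)
  have "graph_hom G (FObj F j) (\<lambda>x. app (FArr F (i, j)) (g x))"
    unfolding graph_hom_def
  proof (intro conjI ballI allI impI)
    show "app (FArr F (i, j)) (g x) \<in> verts (FObj F j)" if "x \<in> verts G" for x
      by (rule hom_GraD(3)[OF Fh[OF j(1)] g(1)[OF that]])
    show "(l, app (FArr F (i, j)) (g x), app (FArr F (i, j)) (g x')) \<in> edges (FObj F j)"
      if e: "(l, x, x') \<in> edges G" for l x x'
      using hom_GraD(4)[OF Fh[OF j(2)[OF e]] je(2)[OF e, simplified]] edge_in[OF G e]
        F_app[OF je(1)[OF e] j(2)[OF e]] g(1) by simp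
  qed
  then have h: "mor G (FObj F j) (\<lambda>x. app (FArr F (i, j)) (g x)) \<in> hom (Gra L) G (FObj F j)"
    by (rule mor_in_hom[OF G hom_GraD(2)[OF Fh[OF j(1)]]])
  have jI: "j \<in> I"
    using rI[OF j(1)] by simp
  have "c j \<cdot>\<^bsub>Gra L\<^esub> mor G (FObj F j) (\<lambda>x. app (FArr F (i, j)) (g x)) = f"
    by (rule Cmp_Gra_eqI[OF h c[OF jI] f]) (simp add: c_app[OF j(1) g(1)] g(2))
  then show "\<exists>i\<in>I. \<exists>h\<in>hom (Gra L) G (FObj F i). c i \<cdot>\<^bsub>Gra L\<^esub> h = f"
    using h jI by blast
next
  fix I r F Q c i f g
  assume dir: "directed_poset omega I r" and F: "is_functor (poset_cat I r) (Gra L) F"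
    and lim: "is_colimit (poset_cat I r) (Gra L) F Q c" and i: "i \<in> I"
    and f: "f \<in> hom (Gra L) G (FObj F i)" and g: "g \<in> hom (Gra L) G (FObj F i)"
    and eq: "c i \<cdot>\<^bsub>Gra L\<^esub> f = c i \<cdot>\<^bsub>Gra L\<^esub> g"
  note reg = regular_cardinal_countable[where 'v = 'v]
  note coc = colimit_coconeD[OF lim]
  have ci: "c i \<in> hom (Gra L) (FObj F i) Q"
    by (rule poset_cocone_leg[OF coc i])
  have Fh: "FArr F (i, j) \<in> hom (Gra L) (FObj F i) (FObj F j)" if "(i, j) \<in> r" for i j
    by (rule poset_functor_arr[OF F that])
  have F_app: "app (FArr F (j, k)) (app (FArr F (i, j)) x) = app (FArr F (i, k)) x"
    if "(i, j) \<in> r" "(j, k) \<in> r" "x \<in> verts (FObj F i)" for i j k x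
    using app_Cmp[OF Fh[OF that(1)] Fh[OF that(2)] that(3)] poset_functor_comp[OF F dir that(1,2)]
    by simp
  have "\<exists>j. (i, j) \<in> r \<and> app (FArr F (i, j)) (app f x) = app (FArr F (i, j)) (app g x)"
    if x: "x \<in> verts G" for x
  proof (rule colimit_identifies[OF reg dir F lim i])
    show "app (c i) (app f x) = app (c i) (app g x)"
      using app_Cmp[OF f ci x] app_Cmp[OF g ci x] eq by simp
  qed (rule hom_GraD(3)[OF f x] hom_GraD(3)[OF g x])+
  then obtain jv where jv: "\<And>x. x \<in> verts G \<Longrightarrow> (i, jv x) \<in> r"
      "\<And>x. x \<in> verts G \<Longrightarrow> app (FArr F (i, jv x)) (app f x) = app (FArr F (i, jv x)) (app g x)"
    by metis
  have sub: "jv ` verts G \<subseteq> I"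
    using jv(1) directed_posetD(2)[OF dir] by blast
  have "|jv ` verts G| <o omega"
    using fv by (simp add: less_omega_iff)
  then obtain j where j: "(i, j) \<in> r" "\<And>k. k \<in> jv ` verts G \<Longrightarrow> (k, j) \<in> r"
    using directed_bound_above[OF reg dir sub _ i] by blast
  have "FArr F (i, j) \<cdot>\<^bsub>Gra L\<^esub> f = FArr F (i, j) \<cdot>\<^bsub>Gra L\<^esub> g"
  proof (rule hom_Gra_eqI[OF Cmp_in_hom_Gra[OF f Fh[OF j(1)]] Cmp_in_hom_Gra[OF g Fh[OF j(1)]]])
    fix x
    assume x: "x \<in> verts G"
    have k: "(i, jv x) \<in> r" "(jv x, j) \<in> r"
      using jv(1)[OF x] j(2) x by auto
    have "app (FArr F (i, j)) (app f x) = app (FArr F (i, j)) (app g x)"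
      using F_app[OF k hom_GraD(3)[OF f x]] F_app[OF k hom_GraD(3)[OF g x]] jv(2)[OF x] by simp
    then show "app (FArr F (i, j) \<cdot>\<^bsub>Gra L\<^esub> f) x = app (FArr F (i, j) \<cdot>\<^bsub>Gra L\<^esub> g) x"
      using app_Cmp[OF f Fh[OF j(1)] x] app_Cmp[OF g Fh[OF j(1)] x] by simp
  qed
  then show "\<exists>j. (i, j) \<in> r \<and> FArr F (i, j) \<cdot>\<^bsub>Gra L\<^esub> f = FArr F (i, j) \<cdot>\<^bsub>Gra L\<^esub> g"
    using j(1) by blast
qed


subsection \<open>Local presentability\<close>

text \<open>A graph is the directed union of its finite subgraphs.  The generating set has to be a set, so
  each finite subgraph is replaced by an isomorphic copy whose vertices are natural numbers.\<close>

lemma locally_presentable_Gra: "locally_presentable (Gra L)"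
proof -
  define S where "S = {G. is_graph L G \<and> finite (verts G) \<and> finite (edges G) \<and> verts G \<subseteq> range tag}"
  have small_graphs: "small {G. verts G \<subseteq> V \<and> is_graph L G}" if V: "small V" for V
  proof -
    let ?E = "{pack l p | l p. l \<in> L \<and> p \<in> {pack x y | x y. x \<in> V \<and> y \<in> V}}"
    have "small {pack a b | a b. a \<in> {a. elts a \<subseteq> V} \<and> b \<in> {b. elts b \<subseteq> ?E}}"
      using V small_labels by (intro small_pack_image small_Pow)
    moreover have "{G. verts G \<subseteq> V \<and> is_graph L G} \<subseteq>
        {pack a b | a b. a \<in> {a. elts a \<subseteq> V} \<and> b \<in> {b. elts b \<subseteq> ?E}}"
    proof safe
      fix G
      assume G: "verts G \<subseteq> V" "is_graph L G"
      have "elts (psnd G) \<subseteq> ?E"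
      proof
        fix e
        assume "e \<in> elts (psnd G)"
        then have "(pfst e, pfst (psnd e), psnd (psnd e)) \<in> edges G"
          by (simp add: edges_def)
        then have "pfst e \<in> L" "pfst (psnd e) \<in> V" "psnd (psnd e) \<in> V"
          using edge_in[OF G(2)] G(1) by auto
        moreover have "e = pack (pfst e) (pack (pfst (psnd e)) (psnd (psnd e)))"
          by simp
        ultimately show "e \<in> ?E"
          by blast
      qed
      moreover have "G = pack (pfst G) (psnd G)" "elts (pfst G) \<subseteq> V"
        using G(1) by (simp_all add: verts_def)
      ultimately show "\<exists>a b. G = pack a b \<and> a \<in> {a. elts a \<subseteq> V} \<and> b \<in> {b. elts b \<subseteq> ?E}"
        by blast
    qed
    ultimately show ?thesis
      by (rule small_subset)
  qed
  have "\<exists>I r F c. directed_poset omega I r \<and> is_functor (poset_cat I r) (Gra L) F \<and>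
      (\<forall>i\<in>I. FObj F i \<in> S) \<and> is_colimit (poset_cat I r) (Gra L) F X c"
    if X: "is_graph L X" for X
  proof -
    define I where "I = {Y. is_graph L Y \<and> finite (verts Y) \<and> finite (edges Y) \<and>
      verts Y \<subseteq> verts X \<and> edges Y \<subseteq> edges X}"
    define r where "r = {(Y, Z). Y \<in> I \<and> Z \<in> I \<and> verts Y \<subseteq> verts Z \<and> edges Y \<subseteq> edges Z}"
    have po: "partial_order_on I r"
      by (auto simp: order_on_defs refl_on_def trans_def antisym_def r_def intro: graph_eqI)
    have dir: "directed_poset omega I r"
      unfolding directed_poset_def
    proof (intro conjI allI impI po)
      show "small I"
        by (rule small_subset[OF small_graphs[OF small_verts[of X]]]) (auto simp: I_def)
      fix A
      assume A: "A \<subseteq> I" "|A| <o omega"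
      let ?V = "\<Union>Y\<in>A. verts Y" and ?E = "\<Union>Y\<in>A. edges Y"
      have fin: "finite ?V" "finite ?E"
        using A by (auto simp: less_omega_iff I_def)
      have E: "?E \<subseteq> L \<times> ?V \<times> ?V"
        using A(1) by (fastforce simp: I_def is_graph_def)
      have U: "verts (graph ?V ?E) = ?V" "edges (graph ?V ?E) = ?E" "is_graph L (graph ?V ?E)"
        using small_finite[OF fin(1)] E small_labels
        by (simp_all add: verts_graph edges_graph is_graph_graph)
      have "graph ?V ?E \<in> I"
        using A(1) fin U by (auto simp: I_def)
      then show "\<exists>u\<in>I. \<forall>a\<in>A. (a, u) \<in> r"
        using A(1) U by (intro bexI[of _ "graph ?V ?E"]) (auto simp: r_def)
    qed
    have "\<exists>\<beta> :: 'v \<Rightarrow> 'v. inj_on \<beta> (verts Y) \<and> \<beta> ` verts Y \<subseteq> range tag" if "Y \<in> I" for Y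
    proof -
      have "|verts Y| \<le>o omega"
        using that less_omega_iff ordLess_imp_ordLeq by (auto simp: I_def)
      then show ?thesis
        by (simp add: card_of_ordLeq)
    qed
    then obtain \<beta> :: "'v \<Rightarrow> 'v \<Rightarrow> 'v" where \<beta>: "\<And>Y. Y \<in> I \<Longrightarrow> inj_on (\<beta> Y) (verts Y)"
        "\<And>Y. Y \<in> I \<Longrightarrow> \<beta> Y ` verts Y \<subseteq> range tag"
      by metis
    define \<gamma> where "\<gamma> Y = inv_into (verts Y) (\<beta> Y)" for Y
    have \<gamma>\<beta>: "\<gamma> Y (\<beta> Y x) = x" if "Y \<in> I" "x \<in> verts Y" for Y x
      using \<beta>(1) that by (simp add: \<gamma>_def)
    define std where "std Y = graph (\<beta> Y ` verts Y) ((\<lambda>(l, x, y). (l, \<beta> Y x, \<beta> Y y)) ` edges Y)" for Y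
    have IY: "is_graph L Y" "verts Y \<subseteq> verts X" "edges Y \<subseteq> edges X" "finite (verts Y)" "finite (edges Y)"
      if "Y \<in> I" for Y
      using that by (auto simp: I_def)
    have std: "verts (std Y) = \<beta> Y ` verts Y"
        "edges (std Y) = (\<lambda>(l, x, y). (l, \<beta> Y x, \<beta> Y y)) ` edges Y" "is_graph L (std Y)" if "Y \<in> I" for Y
    proof -
      have "small (\<beta> Y ` verts Y)"
        by (intro small_image small_verts)
      moreover have "(\<lambda>(l, x, y). (l, \<beta> Y x, \<beta> Y y)) ` edges Y \<subseteq> L \<times> \<beta> Y ` verts Y \<times> \<beta> Y ` verts Y"
        using edge_in[OF IY(1)[OF that]] by auto
      ultimately show "verts (std Y) = \<beta> Y ` verts Y"
          "edges (std Y) = (\<lambda>(l, x, y). (l, \<beta> Y x, \<beta> Y y)) ` edges Y" "is_graph L (std Y)"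
        using small_labels by (simp_all add: std_def verts_graph edges_graph is_graph_graph)
    qed
    \<comment> \<open>A map on the vertices of \<open>Y\<close> is transported along the renaming.\<close>
    have transport: "mor (std Y) M (\<lambda>v. f (\<gamma> Y v)) \<in> hom (Gra L) (std Y) M"
      if "Y \<in> I" "is_graph L M" "graph_hom Y M f" for Y M f
    proof (rule mor_in_hom[OF std(3)[OF that(1)] that(2)])
      show "graph_hom (std Y) M (\<lambda>v. f (\<gamma> Y v))"
        using that(3) \<gamma>\<beta>[OF that(1)] edge_in[OF IY(1)[OF that(1)]]
        unfolding graph_hom_def std(1,2)[OF that(1)] by fastforce
    qed
    define F where "F = \<lparr>FObj = std, FArr = (\<lambda>(Y, Z). mor (std Y) (std Z) (\<lambda>v. \<beta> Z (\<gamma> Y v)))\<rparr>"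
    have F_sel: "FObj F Y = std Y" "FArr F (Y, Z) = mor (std Y) (std Z) (\<lambda>v. \<beta> Z (\<gamma> Y v))" for Y Z
      by (simp_all add: F_def)
    have Fh: "FArr F (Y, Z) \<in> hom (Gra L) (std Y) (std Z)" if "(Y, Z) \<in> r" for Y Z
      unfolding F_sel
    proof (rule transport)
      have YZ: "Z \<in> I" "verts Y \<subseteq> verts Z" "edges Y \<subseteq> edges Z"
        using that by (auto simp: r_def)
      have "(l, \<beta> Z x, \<beta> Z y) \<in> (\<lambda>(l, x, y). (l, \<beta> Z x, \<beta> Z y)) ` edges Z"
        if "(l, x, y) \<in> edges Y" for l x y
        using image_eqI[of _ "\<lambda>(l, x, y). (l, \<beta> Z x, \<beta> Z y)" "(l, x, y)" "edges Z"] that YZ(3) by auto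
      then show "graph_hom Y (std Z) (\<beta> Z)"
        unfolding graph_hom_def std(1,2)[OF YZ(1)] using YZ(2) by blast
    qed (use that std(3) in \<open>auto simp: r_def\<close>)
    have F_app: "app (FArr F (Y, Z)) (\<beta> Y x) = \<beta> Z x" if "Y \<in> I" "x \<in> verts Y" for Y Z x
      using that std(1) \<gamma>\<beta> by (simp add: F_sel)
    have F: "is_functor (poset_cat I r) (Gra L) F"
      unfolding is_functor_def
    proof (intro conjI ballI impI)
      fix Y
      assume "Y \<in> Obj (poset_cat I r)"
      then have Y: "Y \<in> I"
        by simp
      show "FObj F Y \<in> Obj (Gra L)"
        using std(3)[OF Y] by (simp add: F_sel)
      have "FArr F (Y, Y) = mor (std Y) (std Y) (\<lambda>v. v)"
        unfolding F_sel by (rule mor_cong) (use Y std(1) \<gamma>\<beta> in auto)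
      then show "FArr F (Idt (poset_cat I r) Y) = Idt (Gra L) (FObj F Y)"
        by (simp add: F_sel)
    next
      fix a
      assume "a \<in> Arr (poset_cat I r)"
      then show "FArr F a \<in> hom (Gra L) (FObj F (Dom (poset_cat I r) a)) (FObj F (Cod (poset_cat I r) a))"
        using Fh by (cases a) (simp add: F_sel(1))
    next
      fix a b
      assume ab: "a \<in> Arr (poset_cat I r)" "b \<in> Arr (poset_cat I r)"
        "Dom (poset_cat I r) b = Cod (poset_cat I r) a"
      obtain Y Z W where YZW: "a = (Y, Z)" "b = (Z, W)" "(Y, Z) \<in> r" "(Z, W) \<in> r"
        using ab by (cases a; cases b) auto
      have YW: "(Y, W) \<in> r" and Y: "Y \<in> I" and Z: "Z \<in> I" and sub: "verts Y \<subseteq> verts Z"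
        using YZW by (auto simp: r_def)
      have "FArr F (Z, W) \<cdot>\<^bsub>Gra L\<^esub> FArr F (Y, Z) = FArr F (Y, W)"
        by (rule Cmp_Gra_eqI[OF Fh[OF YZW(3)] Fh[OF YZW(4)] Fh[OF YW]])
          (use Y Z sub std(1)[OF Y] F_app in auto)
      then show "FArr F (b \<cdot>\<^bsub>poset_cat I r\<^esub> a) = FArr F b \<cdot>\<^bsub>Gra L\<^esub> FArr F a"
        by (simp add: YZW)
    qed
    define c where "c Y = mor (std Y) X (\<gamma> Y)" for Y
    have c: "c Y \<in> hom (Gra L) (std Y) X" if "Y \<in> I" for Y
      using transport[OF that X, of "\<lambda>x. x"] IY[OF that] by (auto simp: c_def graph_hom_def)
    have c_app: "app (c Y) (\<beta> Y x) = x" if "Y \<in> I" "x \<in> verts Y" for Y x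
      using that std(1) \<gamma>\<beta> by (simp add: c_def)
    have coc: "is_cocone (poset_cat I r) (Gra L) F X c"
      unfolding is_cocone_def
    proof (intro conjI ballI)
      fix a
      assume "a \<in> Arr (poset_cat I r)"
      then obtain Y Z where YZ: "a = (Y, Z)" "(Y, Z) \<in> r"
        by (cases a) auto
      have Y: "Y \<in> I" and Z: "Z \<in> I" and sub: "verts Y \<subseteq> verts Z"
        using YZ by (auto simp: r_def)
      have "c Z \<cdot>\<^bsub>Gra L\<^esub> FArr F (Y, Z) = c Y"
        by (rule Cmp_Gra_eqI[OF Fh[OF YZ(2)] c[OF Z] c[OF Y]])
          (use Y Z sub std(1)[OF Y] F_app c_app in auto)
      then show "c (Cod (poset_cat I r) a) \<cdot>\<^bsub>Gra L\<^esub> FArr F a = c (Dom (poset_cat I r) a)"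
        by (simp add: YZ)
    qed (use X c in \<open>auto simp: F_sel\<close>)
    \<comment> \<open>Finite subgraphs that contain a given finite part of \<open>X\<close>.\<close>
    have cover: "\<exists>Y\<in>I. V \<subseteq> verts Y \<and> E \<subseteq> edges Y"
      if "finite V" "finite E" "V \<subseteq> verts X" "E \<subseteq> edges X" "E \<subseteq> L \<times> V \<times> V" for V E
    proof (intro bexI conjI)
      have Y: "verts (graph V E) = V" "edges (graph V E) = E" "is_graph L (graph V E)"
        using small_finite[OF that(1)] that(5) small_labels
        by (simp_all add: verts_graph edges_graph is_graph_graph)
      then show "graph V E \<in> I" "V \<subseteq> verts (graph V E)" "E \<subseteq> edges (graph V E)"
        using that by (simp_all add: I_def)
    qed
    have "is_colimit (poset_cat I r) (Gra L) F X c"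
      unfolding is_colimit_def
    proof (intro conjI allI impI coc)
      fix M d
      assume dc: "is_cocone (poset_cat I r) (Gra L) F M d"
      have d: "d Y \<in> hom (Gra L) (std Y) M" if "Y \<in> I" for Y
        using poset_cocone_leg[OF dc that] by (simp add: F_sel)
      have d_app: "app (d Z) (\<beta> Z x) = app (d Y) (\<beta> Y x)" if "(Y, Z) \<in> r" "x \<in> verts Y" for Y Z x
      proof -
        have YZ: "Y \<in> I" "Z \<in> I"
          using that(1) by (auto simp: r_def)
        have "\<beta> Y x \<in> verts (std Y)"
          using std(1)[OF YZ(1)] that(2) by simp
        then show ?thesis
          using app_Cmp[OF Fh[OF that(1)] d[OF YZ(2)]] poset_cocone_comp[OF dc that(1)]
            F_app[OF YZ(1) that(2)] by simp
      qed
      define pt where "pt x = graph {x} {}" for x :: 'v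
      have pt: "verts (pt x) = {x}" "edges (pt x) = {}" for x
        by (simp_all add: pt_def verts_graph small_finite) (subst edges_graph[OF _ small_labels], auto intro: small_finite)
      have ptI: "pt x \<in> I" if "x \<in> verts X" for x
        using that pt[of x] by (simp add: I_def is_graph_def)
      define u where "u x = app (d (pt x)) (\<beta> (pt x) x)" for x
      have u_eq: "u x = app (d Y) (\<beta> Y x)" if "Y \<in> I" "x \<in> verts Y" for Y x
      proof -
        have "(pt x, Y) \<in> r"
          using that ptI[of x] IY(2)[OF that(1)] pt by (auto simp: r_def)
        then show ?thesis
          using d_app[of "pt x" Y x] pt by (simp add: u_def)
      qed
      have M: "is_graph L M"
        using cocone_objD[OF dc] by simp
      have "graph_hom X M u"
        unfolding graph_hom_def
      proof (intro conjI ballI allI impI)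
        show "u x \<in> verts M" if "x \<in> verts X" for x
          using hom_GraD(3)[OF d[OF ptI[OF that]]] std(1)[OF ptI[OF that]] pt by (simp add: u_def)
        show "(l, u x, u y) \<in> edges M" if e: "(l, x, y) \<in> edges X" for l x y
        proof -
          obtain Y where Y: "Y \<in> I" "x \<in> verts Y" "y \<in> verts Y" "(l, x, y) \<in> edges Y"
            using cover[of "{x, y}" "{(l, x, y)}"] e edge_in[OF X e] by auto
          have "(l, \<beta> Y x, \<beta> Y y) \<in> edges (std Y)"
            using Y(4) std(2)[OF Y(1)] by force
          then show ?thesis
            using hom_GraD(4)[OF d[OF Y(1)]] u_eq Y by simp
        qed
      qed
      then have u: "mor X M u \<in> hom (Gra L) X M"
        by (rule mor_in_hom[OF X M])
      show "\<exists>!w. w \<in> hom (Gra L) X M \<and> (\<forall>Y\<in>Obj (poset_cat I r). w \<cdot>\<^bsub>Gra L\<^esub> c Y = d Y)"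
      proof (rule ex1I[of _ "mor X M u"], intro conjI ballI u)
        fix Y
        assume "Y \<in> Obj (poset_cat I r)"
        then have Y: "Y \<in> I"
          by simp
        show "mor X M u \<cdot>\<^bsub>Gra L\<^esub> c Y = d Y"
          by (rule Cmp_Gra_eqI[OF c[OF Y] u d[OF Y]])
            (use Y std(1)[OF Y] c_app u_eq IY(2)[OF Y] in auto)
      next
        fix w
        assume w: "w \<in> hom (Gra L) X M \<and> (\<forall>Y\<in>Obj (poset_cat I r). w \<cdot>\<^bsub>Gra L\<^esub> c Y = d Y)"
        show "w = mor X M u"
        proof (rule hom_Gra_eqI[OF conjunct1[OF w] u])
          fix x
          assume x: "x \<in> verts X"
          have "\<beta> (pt x) x \<in> verts (std (pt x))"
            using std(1)[OF ptI[OF x]] pt by simp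
          then have "app w (app (c (pt x)) (\<beta> (pt x) x)) = app (d (pt x)) (\<beta> (pt x) x)"
            using app_Cmp[OF c[OF ptI[OF x]] conjunct1[OF w]] w ptI[OF x] by simp
          then show "app w x = app (mor X M u) x"
            using c_app[OF ptI[OF x]] pt x by (simp add: u_def)
        qed
      qed
    qed
    moreover have "\<forall>Y\<in>I. FObj F Y \<in> S"
      using std IY(4,5) \<beta>(2) by (simp add: S_def F_sel)
    ultimately show ?thesis
      using dir F by blast
  qed
  moreover have "small S"
    by (rule small_subset[OF small_graphs[OF small_range_nat[of tag]]]) (auto simp: S_def)
  moreover have "\<forall>G\<in>S. presentable (Gra L) omega G"
    using presentable_finite_graph by (simp add: S_def)
  moreover have "S \<subseteq> Obj (Gra L)"
    by (auto simp: S_def)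
  ultimately show ?thesis
    unfolding locally_presentable_def
    using category_Gra locally_small_Gra cocomplete_Gra regular_cardinal_countable[where 'v = 'v]
    by (intro conjI exI[of _ omega] exI[of _ S]) simp_all
qed

end


section \<open>Rigid well-orders\<close>

text \<open>A ladder of \<open>\<delta>\<close> is a sequence below \<open>\<delta>\<close> that is cofinal in it.  It need not be increasing; the
  elements that have one are the nonzero elements of countable cofinality, successors included.\<close>

definition less_in :: "'v rel \<Rightarrow> 'v \<Rightarrow> 'v \<Rightarrow> bool" where
  "less_in \<nu> \<xi> \<zeta> \<longleftrightarrow> (\<xi>, \<zeta>) \<in> \<nu> \<and> \<xi> \<noteq> \<zeta>"

definition is_ladder :: "'v rel \<Rightarrow> 'v \<Rightarrow> (nat \<Rightarrow> 'v) \<Rightarrow> bool" where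
  "is_ladder \<nu> \<delta> s \<longleftrightarrow> (\<forall>n. less_in \<nu> (s n) \<delta>) \<and> (\<forall>\<xi>. less_in \<nu> \<xi> \<delta> \<longrightarrow> (\<exists>n. (\<xi>, s n) \<in> \<nu>))"

definition has_ladder :: "'v rel \<Rightarrow> 'v \<Rightarrow> bool" where
  "has_ladder \<nu> \<delta> \<longleftrightarrow> \<delta> \<in> Field \<nu> \<and> (\<exists>s. is_ladder \<nu> \<delta> s)"

definition ladder :: "'v rel \<Rightarrow> 'v \<Rightarrow> nat \<Rightarrow> 'v" where
  "ladder \<nu> \<delta> = (SOME s. is_ladder \<nu> \<delta> s)"

lemma is_ladder_ladder: "has_ladder \<nu> \<delta> \<Longrightarrow> is_ladder \<nu> \<delta> (ladder \<nu> \<delta>)"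
  unfolding has_ladder_def ladder_def by (metis someI_ex)

lemma less_in_Field: "less_in \<nu> \<xi> \<zeta> \<Longrightarrow> \<xi> \<in> Field \<nu> \<and> \<zeta> \<in> Field \<nu>"
  by (auto simp: less_in_def Field_def)

lemma well_order_least:
  assumes "Well_order \<nu>" and "\<zeta> \<in> Field \<nu>" and "P \<zeta>"
  obtains \<xi> where "\<xi> \<in> Field \<nu>" "P \<xi>" "\<And>\<eta>. less_in \<nu> \<eta> \<xi> \<Longrightarrow> \<not> P \<eta>"
proof -
  have wf: "wf (\<nu> - Id)"
    using assms(1) by (simp add: well_order_on_def)
  obtain \<xi> where \<xi>: "\<xi> \<in> {\<xi> \<in> Field \<nu>. P \<xi>}"
      "\<And>\<eta>. (\<eta>, \<xi>) \<in> \<nu> - Id \<Longrightarrow> \<eta> \<notin> {\<xi> \<in> Field \<nu>. P \<xi>}"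
    using wfE_min[OF wf, of \<zeta> "{\<xi> \<in> Field \<nu>. P \<xi>}"] assms(2,3) by blast
  show thesis
  proof
    show "\<not> P \<eta>" if "less_in \<nu> \<eta> \<xi>" for \<eta>
      using \<xi>(2)[of \<eta>] that less_in_Field[OF that] by (simp add: less_in_def)
  qed (use \<xi>(1) in simp_all)
qed

lemma well_order_cases:
  assumes "Well_order \<nu>" and "\<xi> \<in> Field \<nu>" "\<zeta> \<in> Field \<nu>"
  shows "less_in \<nu> \<xi> \<zeta> \<or> (\<zeta>, \<xi>) \<in> \<nu>"
  using assms wo_rel.TOTALS[of \<nu>] by (auto simp: wo_rel_def less_in_def)

lemma well_order_trans:
  assumes "Well_order \<nu>"
  shows "(\<xi>, \<zeta>) \<in> \<nu> \<Longrightarrow> (\<zeta>, \<eta>) \<in> \<nu> \<Longrightarrow> (\<xi>, \<eta>) \<in> \<nu>"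
    and "(\<xi>, \<zeta>) \<in> \<nu> \<Longrightarrow> less_in \<nu> \<zeta> \<eta> \<Longrightarrow> less_in \<nu> \<xi> \<eta>"
    and "less_in \<nu> \<xi> \<zeta> \<Longrightarrow> (\<zeta>, \<eta>) \<in> \<nu> \<Longrightarrow> less_in \<nu> \<xi> \<eta>"
    and "less_in \<nu> \<xi> \<zeta> \<Longrightarrow> (\<zeta>, \<xi>) \<notin> \<nu>"
  using assms by (auto simp: order_on_defs less_in_def elim: transE antisymD dest: antisymD)

text \<open>At a least point that is moved downwards, monotonicity would produce a smaller one.\<close>

lemma strict_mono_inflating:
  assumes \<nu>: "Well_order \<nu>" and f: "\<And>\<xi>. \<xi> \<in> Field \<nu> \<Longrightarrow> f \<xi> \<in> Field \<nu>"
    and mono: "\<And>\<xi> \<zeta>. less_in \<nu> \<xi> \<zeta> \<Longrightarrow> less_in \<nu> (f \<xi>) (f \<zeta>)" and \<xi>: "\<xi> \<in> Field \<nu>"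
  shows "(\<xi>, f \<xi>) \<in> \<nu>"
proof (rule ccontr)
  assume "(\<xi>, f \<xi>) \<notin> \<nu>"
  then have "less_in \<nu> (f \<xi>) \<xi>"
    using well_order_cases[OF \<nu> f[OF \<xi>] \<xi>] by blast
  then obtain \<zeta> where "less_in \<nu> (f \<zeta>) \<zeta>" "\<And>\<eta>. less_in \<nu> \<eta> \<zeta> \<Longrightarrow> \<not> less_in \<nu> (f \<eta>) \<eta>"
    using well_order_least[OF \<nu> \<xi>, of "\<lambda>\<xi>. less_in \<nu> (f \<xi>) \<xi>"] by blast
  then show False
    using mono by blast
qed

text \<open>A non-identical strictly monotone self-map \<open>f\<close> has a point \<open>\<kappa>\<close> with \<open>\<kappa> < f \<kappa>\<close>.  The supremum
  \<open>\<delta>\<close> of the iterates \<open>f\<^sup>n \<kappa>\<close> exists since the regular cardinal is uncountable.  Comparing the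
  chosen ladders of \<open>\<delta>\<close> and \<open>f \<delta>\<close> shows that \<open>f\<close> fixes \<open>\<delta>\<close>, hence all points of its ladder;
  but \<open>f\<close> fixes nothing between \<open>\<kappa>\<close> and \<open>\<delta>\<close>.\<close>

lemma ladder_rigid:
  assumes \<nu>: "Card_order \<nu>" "regularCard \<nu>" and unc: "natLeq <o \<nu>"
    and f: "\<And>\<xi>. \<xi> \<in> Field \<nu> \<Longrightarrow> f \<xi> \<in> Field \<nu>"
    and mono: "\<And>\<xi> \<zeta>. less_in \<nu> \<xi> \<zeta> \<Longrightarrow> less_in \<nu> (f \<xi>) (f \<zeta>)"
    and lad: "\<And>\<delta>. has_ladder \<nu> \<delta> \<Longrightarrow>
      has_ladder \<nu> (f \<delta>) \<and> (\<forall>n. f (ladder \<nu> \<delta> n) = ladder \<nu> (f \<delta>) n)"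
    and \<kappa>: "\<kappa> \<in> Field \<nu>"
  shows "f \<kappa> = \<kappa>"
proof (rule ccontr)
  assume "f \<kappa> \<noteq> \<kappa>"
  have wo: "Well_order \<nu>"
    using \<nu>(1) by (simp add: card_order_on_def)
  have infl: "(\<xi>, f \<xi>) \<in> \<nu>" if "\<xi> \<in> Field \<nu>" for \<xi>
    by (rule strict_mono_inflating[OF wo _ _ that]) (fact f, fact mono)
  note tr = well_order_trans[OF wo]
  have mono': "(f \<xi>, f \<zeta>) \<in> \<nu>" if "(\<xi>, \<zeta>) \<in> \<nu>" for \<xi> \<zeta>
  proof (cases "\<xi> = \<zeta>")
    case True
    then have "f \<xi> \<in> Field \<nu>"
      using that f by (auto simp: Field_def)
    then show ?thesis
      using True wo by (auto simp: order_on_defs refl_on_def)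
  next
    case False
    then show ?thesis
      using mono[of \<xi> \<zeta>] that by (simp add: less_in_def)
  qed
  define k where "k n = (f ^^ n) \<kappa>" for n
  have k_simps: "k 0 = \<kappa>" "k (Suc n) = f (k n)" for n
    by (simp_all add: k_def)
  have k_less: "less_in \<nu> (k n) (k (Suc n))" for n
    by (induction n) (use infl[OF \<kappa>] \<open>f \<kappa> \<noteq> \<kappa>\<close> mono in \<open>auto simp: k_simps less_in_def\<close>)
  have kF: "k n \<in> Field \<nu>" for n
    using less_in_Field[OF k_less] by blast
  have "|range k| \<le>o |UNIV :: nat set|"
    by (rule card_of_image)
  then have "|range k| <o \<nu>"
    using unc card_of_nat ordLeq_ordIso_trans ordLeq_ordLess_trans by blast
  then have "\<not> cofinal (range k) \<nu>"
    using \<nu>(2) kF not_ordLess_ordIso unfolding regularCard_def by blast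
  then obtain a where a: "a \<in> Field \<nu>" "\<forall>n. (k n, a) \<in> \<nu>"
    using well_order_cases[OF wo _ kF] unfolding cofinal_def less_in_def by (metis rangeI)
  obtain \<delta> where \<delta>: "\<delta> \<in> Field \<nu>" "\<forall>n. (k n, \<delta>) \<in> \<nu>"
      and least: "\<And>\<eta>. less_in \<nu> \<eta> \<delta> \<Longrightarrow> \<not> (\<forall>n. (k n, \<eta>) \<in> \<nu>)"
    using well_order_least[OF wo a(1), of "\<lambda>\<zeta>. \<forall>n. (k n, \<zeta>) \<in> \<nu>"] a(2) by blast
  have k_\<delta>: "less_in \<nu> (k n) \<delta>" for n
    using tr(3)[OF k_less] \<delta>(2) by blast
  have below: "\<exists>n. less_in \<nu> \<xi> (k n)" if "less_in \<nu> \<xi> \<delta>" for \<xi>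
    using least[OF that] well_order_cases[OF wo _ kF] less_in_Field[OF that] by blast
  have "is_ladder \<nu> \<delta> k"
    using k_\<delta> below by (auto simp: is_ladder_def less_in_def)
  then have hl: "has_ladder \<nu> \<delta>"
    using \<delta>(1) by (auto simp: has_ladder_def)
  have l: "is_ladder \<nu> \<delta> (ladder \<nu> \<delta>)" "is_ladder \<nu> (f \<delta>) (ladder \<nu> (f \<delta>))"
    by (rule is_ladder_ladder[OF hl], rule is_ladder_ladder[OF conjunct1[OF lad[OF hl]]])
  have lf: "f (ladder \<nu> \<delta> n) = ladder \<nu> (f \<delta>) n" for n
    using lad[OF hl] by blast
  have "less_in \<nu> (ladder \<nu> (f \<delta>) n) \<delta>" for n
  proof -
    obtain m where "less_in \<nu> (ladder \<nu> \<delta> n) (k m)"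
      using l(1) below unfolding is_ladder_def by blast
    then have "less_in \<nu> (f (ladder \<nu> \<delta> n)) (k (Suc m))"
      unfolding k_simps by (rule mono)
    then show ?thesis
      using tr(3) \<delta>(2) lf by metis
  qed
  then have "\<not> less_in \<nu> \<delta> (f \<delta>)"
    using l(2) tr(4) unfolding is_ladder_def by blast
  then have f_\<delta>: "f \<delta> = \<delta>"
    using infl[OF \<delta>(1)] unfolding less_in_def by metis
  obtain n where n: "(\<kappa>, ladder \<nu> \<delta> n) \<in> \<nu>"
    using l(1) k_\<delta>[of 0] unfolding is_ladder_def k_simps by blast
  let ?\<xi> = "ladder \<nu> \<delta> n"
  have fix_\<xi>: "f ?\<xi> = ?\<xi>"
    using lf f_\<delta> by simp
  have "(k m, ?\<xi>) \<in> \<nu>" for m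
  proof (induction m)
    case (Suc m)
    then show ?case
      using mono'[OF Suc] fix_\<xi> by (simp add: k_simps)
  qed (use n in \<open>simp add: k_simps\<close>)
  moreover have "less_in \<nu> ?\<xi> \<delta>"
    using l(1) by (simp add: is_ladder_def)
  ultimately show False
    using least by blast
qed


section \<open>Presentability of arbitrary objects\<close>

lemma presentable_mono:
  assumes "\<kappa> \<le>o \<mu>" and "presentable C \<kappa> X"
  shows "presentable C \<mu> X"
  using assms directed_poset_antimono unfolding presentable_def by blast

text \<open>A morphism out of the colimit is a compatible family, and factoring such a family through a
  stage of a directed diagram imposes one condition for each object and each arrow of the indexing
  category; fewer than \<open>\<mu>\<close> conditions can be met at a common stage.\<close>

lemma (in locally_small_category) presentable_colimit:
  assumes reg: "regular_cardinal \<mu>" and J: "category J"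
    and O: "|Obj J| <o \<mu>" and R: "|Arr J| <o \<mu>"
    and F: "is_functor J C F" and c: "is_colimit J C F X c"
    and pres: "\<And>i. i \<in> Obj J \<Longrightarrow> presentable C \<mu> (FObj F i)"
  shows "presentable C \<mu> X"
proof (rule presentableI[OF reg])
  note coc = colimit_coconeD[OF c]
  have leg: "c i \<in> hom C (FObj F i) X" if "i \<in> Obj J" for i
    using cocone_legD[OF coc that] .
  have image_less: "|q ` Obj J| <o \<mu>" "|q' ` Arr J| <o \<mu>" for q :: "_ \<Rightarrow> 'v" and q' :: "_ \<Rightarrow> 'v"
    using O R card_of_image ordLeq_ordLess_trans by blast+
  show "X \<in> Obj C"
    by (rule cocone_objD[OF coc])
  fix I r G L e
  assume dir: "directed_poset \<mu> I r" and G: "is_functor (poset_cat I r) C G"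
    and e: "is_colimit (poset_cat I r) C G L e"
  note rI = directed_posetD(2)[OF dir] and rtr = directed_posetD(4)[OF dir]
  note ecoc = colimit_coconeD[OF e]
  have Gh: "FArr G (i, j) \<in> hom C (FObj G i) (FObj G j)" if "(i, j) \<in> r" for i j
    by (rule poset_functor_arr[OF G that])
  have eh: "e i \<in> hom C (FObj G i) L" if "i \<in> I" for i
    by (rule poset_cocone_leg[OF ecoc that])
  have e_step: "e k \<cdot> (FArr G (j, k) \<cdot> f) = e j \<cdot> f"
    if "(j, k) \<in> r" "f \<in> hom C Y (FObj G j)" for j k f Y
    using Cmp_assoc[OF that(2) Gh[OF that(1)] eh] poset_cocone_comp[OF ecoc that(1)] rI[OF that(1)]
    by simp
  have G_step: "FArr G (j, k) \<cdot> (FArr G (i, j) \<cdot> f) = FArr G (i, k) \<cdot> f"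
    if "(i, j) \<in> r" "(j, k) \<in> r" "f \<in> hom C Y (FObj G i)" for i j k f Y
    using Cmp_assoc[OF that(3) Gh[OF that(1)] Gh[OF that(2)]] poset_functor_comp[OF G dir that(1,2)]
    by simp
  {
    fix f
    assume f: "f \<in> hom C X L"
    have "\<exists>k\<in>I. \<exists>g\<in>hom C (FObj F i) (FObj G k). e k \<cdot> g = f \<cdot> c i" if i: "i \<in> Obj J" for i
      by (rule presentable_factor[OF reg pres[OF i] dir G e Cmp_in_hom[OF leg[OF i] f]]) blast
    then obtain p g where p: "\<And>i. i \<in> Obj J \<Longrightarrow> p i \<in> I"
        and g: "\<And>i. i \<in> Obj J \<Longrightarrow> g i \<in> hom C (FObj F i) (FObj G (p i)) \<and> e (p i) \<cdot> g i = f \<cdot> c i"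
      by metis
    obtain k where k: "k \<in> I" "\<And>i. i \<in> Obj J \<Longrightarrow> (p i, k) \<in> r"
      using directed_posetD(5)[OF dir _ image_less(1)[of p]] p by blast
    define g' where "g' i = FArr G (p i, k) \<cdot> g i" for i
    have g': "g' i \<in> hom C (FObj F i) (FObj G k)" "e k \<cdot> g' i = f \<cdot> c i" if "i \<in> Obj J" for i
      using g[OF that] Gh[OF k(2)[OF that]] e_step[OF k(2)[OF that]] Cmp_in_hom
      by (auto simp: g'_def)
    have FA: "FArr F j \<in> hom C (FObj F (Dom J j)) (FObj F (Cod J j))" if "j \<in> Arr J" for j
      by (rule functor_arrD[OF F that])
    have DC: "Dom J j \<in> Obj J" "Cod J j \<in> Obj J" if "j \<in> Arr J" for j
      using that category.Dom_in_Obj[OF J] category.Cod_in_Obj[OF J] by auto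
    have "\<exists>m. (k, m) \<in> r \<and> FArr G (k, m) \<cdot> (g' (Cod J j) \<cdot> FArr F j) = FArr G (k, m) \<cdot> g' (Dom J j)"
      if j: "j \<in> Arr J" for j
    proof -
      have "e k \<cdot> (g' (Cod J j) \<cdot> FArr F j) = (f \<cdot> c (Cod J j)) \<cdot> FArr F j"
        using Cmp_assoc[OF FA[OF j] g'(1)[OF DC(2)[OF j]] eh[OF k(1)]] g'(2)[OF DC(2)[OF j]] by simp
      also have "\<dots> = e k \<cdot> g' (Dom J j)"
        using Cmp_assoc[OF FA[OF j] leg[OF DC(2)[OF j]] f] cocone_compD[OF coc j]
          g'(2)[OF DC(1)[OF j]] by simp
      finally show ?thesis
        using presentable_merge[OF reg pres[OF DC(1)[OF j]] dir G e k(1)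
            Cmp_in_hom[OF FA[OF j] g'(1)[OF DC(2)[OF j]]] g'(1)[OF DC(1)[OF j]]] by blast
    qed
    then obtain q where q: "\<And>j. j \<in> Arr J \<Longrightarrow> (k, q j) \<in> r"
        "\<And>j. j \<in> Arr J \<Longrightarrow>
          FArr G (k, q j) \<cdot> (g' (Cod J j) \<cdot> FArr F j) = FArr G (k, q j) \<cdot> g' (Dom J j)"
      by metis
    have "q ` Arr J \<subseteq> I"
      using q(1) rI by blast
    then obtain m where m: "m \<in> I" "(k, m) \<in> r" "\<And>a. a \<in> q ` Arr J \<Longrightarrow> (a, m) \<in> r"
      by (rule directed_bound_above[OF reg dir _ image_less(2) k(1)]) blast
    define d where "d i = FArr G (k, m) \<cdot> g' i" for i
    have d: "d i \<in> hom C (FObj F i) (FObj G m)" if "i \<in> Obj J" for i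
      using Cmp_in_hom[OF g'(1)[OF that] Gh[OF m(2)]] by (simp add: d_def)
    have "is_cocone J C F (FObj G m) d"
      unfolding is_cocone_def
    proof (intro conjI ballI)
      show "d (Cod J j) \<cdot> FArr F j = d (Dom J j)" if j: "j \<in> Arr J" for j
      proof -
        have qm: "(q j, m) \<in> r"
          using m(3) j by blast
        have gF: "g' (Cod J j) \<cdot> FArr F j \<in> hom C (FObj F (Dom J j)) (FObj G k)"
          by (rule Cmp_in_hom[OF FA[OF j] g'(1)[OF DC(2)[OF j]]])
        have "d (Cod J j) \<cdot> FArr F j = FArr G (k, m) \<cdot> (g' (Cod J j) \<cdot> FArr F j)"
          unfolding d_def using Cmp_assoc[OF FA[OF j] g'(1)[OF DC(2)[OF j]] Gh[OF m(2)]] by simp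
        also have "\<dots> = FArr G (k, m) \<cdot> g' (Dom J j)"
          using G_step[OF q(1)[OF j] qm gF] G_step[OF q(1)[OF j] qm g'(1)[OF DC(1)[OF j]]]
            q(2)[OF j] by simp
        finally show ?thesis
          by (simp add: d_def)
      qed
    qed (use d functor_objD[OF G, of m] m(1) in auto)
    then obtain u where u: "u \<in> hom C X (FObj G m)" "\<And>i. i \<in> Obj J \<Longrightarrow> u \<cdot> c i = d i"
      using colimit_induced[OF c] by blast
    have "e m \<cdot> u = f"
    proof (rule colimit_jointly_epic[OF J F c Cmp_in_hom[OF u(1) eh[OF m(1)]] f])
      show "e m \<cdot> u \<cdot> c i = f \<cdot> c i" if i: "i \<in> Obj J" for i
        using Cmp_assoc[OF leg[OF i] u(1) eh[OF m(1)]] u(2)[OF i] e_step[OF m(2) g'(1)[OF i]]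
          g'(2)[OF i] by (simp add: d_def)
    qed
    then show "\<exists>i\<in>I. \<exists>g\<in>hom C X (FObj G i). e i \<cdot> g = f"
      using u(1) m(1) by blast
  }
  fix k f g
  assume k: "k \<in> I" and f: "f \<in> hom C X (FObj G k)" and g: "g \<in> hom C X (FObj G k)"
    and eq: "e k \<cdot> f = e k \<cdot> g"
  have "\<exists>m. (k, m) \<in> r \<and> FArr G (k, m) \<cdot> (f \<cdot> c i) = FArr G (k, m) \<cdot> (g \<cdot> c i)"
    if i: "i \<in> Obj J" for i
  proof -
    have "e k \<cdot> (f \<cdot> c i) = e k \<cdot> (g \<cdot> c i)"
      using Cmp_assoc[OF leg[OF i] f eh[OF k]] Cmp_assoc[OF leg[OF i] g eh[OF k]] eq by simp
    then show ?thesis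
      using presentable_merge[OF reg pres[OF i] dir G e k Cmp_in_hom[OF leg[OF i] f]
          Cmp_in_hom[OF leg[OF i] g]] by blast
  qed
  then obtain q where q: "\<And>i. i \<in> Obj J \<Longrightarrow> (k, q i) \<in> r"
      "\<And>i. i \<in> Obj J \<Longrightarrow> FArr G (k, q i) \<cdot> (f \<cdot> c i) = FArr G (k, q i) \<cdot> (g \<cdot> c i)"
    by metis
  have "q ` Obj J \<subseteq> I"
    using q(1) rI by blast
  then obtain m where m: "m \<in> I" "(k, m) \<in> r" "\<And>a. a \<in> q ` Obj J \<Longrightarrow> (a, m) \<in> r"
    by (rule directed_bound_above[OF reg dir _ image_less(1) k]) blast
  have "FArr G (k, m) \<cdot> f = FArr G (k, m) \<cdot> g"
  proof (rule colimit_jointly_epic[OF J F c Cmp_in_hom[OF f Gh[OF m(2)]] Cmp_in_hom[OF g Gh[OF m(2)]]])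
    fix i
    assume i: "i \<in> Obj J"
    have qm: "(q i, m) \<in> r"
      using m(3) i by blast
    show "FArr G (k, m) \<cdot> f \<cdot> c i = FArr G (k, m) \<cdot> g \<cdot> c i"
      using G_step[OF q(1)[OF i] qm Cmp_in_hom[OF leg[OF i] f]]
        G_step[OF q(1)[OF i] qm Cmp_in_hom[OF leg[OF i] g]] q(2)[OF i]
        Cmp_assoc[OF leg[OF i] f Gh[OF m(2)]] Cmp_assoc[OF leg[OF i] g Gh[OF m(2)]] by simp
  qed
  then show "\<exists>j. (k, j) \<in> r \<and> FArr G (k, j) \<cdot> f = FArr G (k, j) \<cdot> g"
    using m(2) by blast
qed

lemma locally_presentable_category: "locally_presentable C \<Longrightarrow> locally_small_category C"
  by (simp add: locally_presentable_def locally_small_category_def locally_small_category_axioms_def)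

text \<open>An object is a colimit of presentable objects over a small diagram, and the bound collects the
  objects and the arrows of this diagram and the initial cardinal of presentability.\<close>

lemma ex_presentability_bound:
  fixes C :: "('v::zfc, 'v) cat"
  assumes lp: "locally_presentable C" and X: "X \<in> Obj C"
  obtains Z :: "'v set" where "small Z"
    and "\<forall>\<mu>. regular_cardinal \<mu> \<longrightarrow> |Z| <o \<mu> \<longrightarrow> presentable C \<mu> X"
proof -
  interpret locally_small_category C
    by (rule locally_presentable_category[OF lp])
  obtain \<kappa> S where \<kappa>: "regular_cardinal \<kappa>" and S: "\<forall>A\<in>S. presentable C \<kappa> A"
    and gen: "\<forall>X\<in>Obj C. \<exists>I r F c. directed_poset \<kappa> I r \<and> is_functor (poset_cat I r) C F \<and>
          (\<forall>i\<in>I. FObj F i \<in> S) \<and> is_colimit (poset_cat I r) C F X c"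
    using lp unfolding locally_presentable_def by blast
  obtain I r F c where d: "directed_poset \<kappa> I r" and F: "is_functor (poset_cat I r) C F"
    and FS: "\<forall>i\<in>I. FObj F i \<in> S" and c: "is_colimit (poset_cat I r) C F X c"
    using gen X by blast
  let ?R = "(\<lambda>(x, y). pack x y) ` r"
  show thesis
  proof (rule that[of "I \<union> ?R \<union> Field \<kappa>"])
    have "small ?R"
    proof (rule small_subset)
      show "small {pack x y | x y. x \<in> I \<and> y \<in> I}"
        using directed_posetD(1)[OF d] by (intro small_pack_image)
      show "?R \<subseteq> {pack x y | x y. x \<in> I \<and> y \<in> I}"
        using directed_posetD(2)[OF d] by auto
    qed
    then show "small (I \<union> ?R \<union> Field \<kappa>)"
      using directed_posetD(1)[OF d] \<kappa> by (intro small_Un) (auto simp: regular_cardinal_def)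
    show "\<forall>\<mu>. regular_cardinal \<mu> \<longrightarrow> |I \<union> ?R \<union> Field \<kappa>| <o \<mu> \<longrightarrow> presentable C \<mu> X"
    proof (intro allI impI)
      fix \<mu> :: "'v rel"
      assume \<mu>: "regular_cardinal \<mu>" and Z: "|I \<union> ?R \<union> Field \<kappa>| <o \<mu>"
      have less: "|Y| <o \<mu>" if "Y \<subseteq> I \<union> ?R \<union> Field \<kappa>" for Y
        using card_of_mono1[OF that] Z by (rule ordLeq_ordLess_trans)
      have "|r| <o \<mu>"
        using ordIso_ordLess_trans[OF ordIso_symmetric[OF card_of_pack[of r]]] less[of ?R] by blast
      moreover have "\<kappa> \<le>o \<mu>"
        using ordIso_ordLess_trans[OF ordIso_symmetric[OF regular_cardinal_Field[OF \<kappa>]]]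
          less[of "Field \<kappa>"] ordLess_imp_ordLeq by blast
      then have "presentable C \<mu> (FObj F i)" if "i \<in> I" for i
        using S FS that presentable_mono by blast
      ultimately show "presentable C \<mu> X"
        using presentable_colimit[OF \<mu> directed_category[OF d] _ _ F c] less[of I] by auto
    qed
  qed
qed


section \<open>Dense sets of objects\<close>

text \<open>Density is expressed without functor categories: a natural transformation between the functors
  \<open>s \<mapsto> hom s X\<close> and \<open>s \<mapsto> hom s M\<close> on \<open>S\<close> is a single function \<open>\<alpha>\<close>, since a morphism determines its
  domain.\<close>

definition dense_objects :: "('v::zfc, 'v) cat \<Rightarrow> 'v set \<Rightarrow> bool" where
  "dense_objects C S \<longleftrightarrow> S \<subseteq> Obj C \<and> small S \<and>
    (\<forall>X\<in>Obj C. \<forall>M\<in>Obj C. \<forall>\<alpha>.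
      (\<forall>s\<in>S. \<forall>\<phi>\<in>hom C s X. \<alpha> \<phi> \<in> hom C s M) \<and>
      (\<forall>s\<in>S. \<forall>t\<in>S. \<forall>e\<in>hom C s t. \<forall>\<phi>\<in>hom C t X. \<alpha> (\<phi> \<cdot>\<^bsub>C\<^esub> e) = \<alpha> \<phi> \<cdot>\<^bsub>C\<^esub> e) \<longrightarrow>
      (\<exists>!a. a \<in> hom C X M \<and> (\<forall>s\<in>S. \<forall>\<phi>\<in>hom C s X. a \<cdot>\<^bsub>C\<^esub> \<phi> = \<alpha> \<phi>)))"

text \<open>A natural family is determined by its values on the legs of a directed diagram in \<open>S\<close> with
  colimit \<open>X\<close>, since every morphism from a presentable object to \<open>X\<close> factors through a leg.\<close>

lemma locally_presentable_dense:
  assumes lp: "locally_presentable C"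
  obtains S where "dense_objects C S"
proof -
  interpret locally_small_category C
    by (rule locally_presentable_category[OF lp])
  obtain \<kappa> S where \<kappa>: "regular_cardinal \<kappa>" and S: "S \<subseteq> Obj C" "small S" "\<forall>A\<in>S. presentable C \<kappa> A"
    and gen: "\<forall>X\<in>Obj C. \<exists>I r F c. directed_poset \<kappa> I r \<and> is_functor (poset_cat I r) C F \<and>
          (\<forall>i\<in>I. FObj F i \<in> S) \<and> is_colimit (poset_cat I r) C F X c"
    using lp unfolding locally_presentable_def by blast
  have "\<exists>!a. a \<in> hom C X M \<and> (\<forall>s\<in>S. \<forall>\<phi>\<in>hom C s X. a \<cdot>\<^bsub>C\<^esub> \<phi> = \<alpha> \<phi>)"
    if X: "X \<in> Obj C" and M: "M \<in> Obj C" and \<alpha>: "\<forall>s\<in>S. \<forall>\<phi>\<in>hom C s X. \<alpha> \<phi> \<in> hom C s M"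
      and nat: "\<forall>s\<in>S. \<forall>t\<in>S. \<forall>e\<in>hom C s t. \<forall>\<phi>\<in>hom C t X. \<alpha> (\<phi> \<cdot>\<^bsub>C\<^esub> e) = \<alpha> \<phi> \<cdot>\<^bsub>C\<^esub> e"
    for X M \<alpha>
  proof -
    obtain I r F c where d: "directed_poset \<kappa> I r" and F: "is_functor (poset_cat I r) C F"
      and FS: "\<forall>i\<in>I. FObj F i \<in> S" and c: "is_colimit (poset_cat I r) C F X c"
      using gen X by blast
    have leg: "c i \<in> hom C (FObj F i) X" if "i \<in> I" for i
      by (rule poset_cocone_leg[OF colimit_coconeD[OF c] that])
    have "is_cocone (poset_cat I r) C F M (\<lambda>i. \<alpha> (c i))"
      unfolding is_cocone_def
    proof (intro conjI ballI)
      fix a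
      assume "a \<in> Arr (poset_cat I r)"
      then obtain i j where ij: "a = (i, j)" "(i, j) \<in> r"
        by (cases a) auto
      have I: "i \<in> I" "j \<in> I"
        using directed_posetD(2)[OF d ij(2)] by auto
      have "\<alpha> (c j) \<cdot>\<^bsub>C\<^esub> FArr F (i, j) = \<alpha> (c j \<cdot>\<^bsub>C\<^esub> FArr F (i, j))"
        using nat FS I leg[OF I(2)] poset_functor_arr[OF F ij(2)] by metis
      also have "\<dots> = \<alpha> (c i)"
        using poset_cocone_comp[OF colimit_coconeD[OF c] ij(2)] by simp
      finally show "\<alpha> (c (Cod (poset_cat I r) a)) \<cdot>\<^bsub>C\<^esub> FArr F a = \<alpha> (c (Dom (poset_cat I r) a))"
        by (simp add: ij(1))
    qed (use M \<alpha> FS leg in auto)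
    then obtain a where a: "a \<in> hom C X M" "\<And>i. i \<in> Obj (poset_cat I r) \<Longrightarrow> a \<cdot>\<^bsub>C\<^esub> c i = \<alpha> (c i)"
      using colimit_induced[OF c] by blast
    show ?thesis
    proof (rule ex1I[of _ a], intro conjI ballI a(1))
      fix s \<phi>
      assume s: "s \<in> S" and \<phi>: "\<phi> \<in> hom C s X"
      have "presentable C \<kappa> s"
        using S(3) s by blast
      then obtain i g where i: "i \<in> I" and g: "g \<in> hom C s (FObj F i)" "c i \<cdot>\<^bsub>C\<^esub> g = \<phi>"
        by (rule presentable_factor[OF \<kappa> _ d F c \<phi>])
      have "a \<cdot>\<^bsub>C\<^esub> \<phi> = \<alpha> (c i) \<cdot>\<^bsub>C\<^esub> g"
        using Cmp_assoc[OF g(1) leg[OF i] a(1)] a(2)[of i] i g(2) by simp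
      also have "\<dots> = \<alpha> (c i \<cdot>\<^bsub>C\<^esub> g)"
        using nat s FS i g(1) leg[OF i] by metis
      finally show "a \<cdot>\<^bsub>C\<^esub> \<phi> = \<alpha> \<phi>"
        using g(2) by simp
    next
      fix b
      assume b: "b \<in> hom C X M \<and> (\<forall>s\<in>S. \<forall>\<phi>\<in>hom C s X. b \<cdot>\<^bsub>C\<^esub> \<phi> = \<alpha> \<phi>)"
      show "b = a"
      proof (rule colimit_jointly_epic[OF directed_category[OF d] F c])
        show "b \<cdot>\<^bsub>C\<^esub> c i = a \<cdot>\<^bsub>C\<^esub> c i" if "i \<in> Obj (poset_cat I r)" for i
          using b a(2)[OF that] bspec[OF FS, of i] leg[of i] that by simp
      qed (use a(1) b in auto)
    qed
  qed
  then have "dense_objects C S"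
    using S(1,2) unfolding dense_objects_def by (simp (no_asm_simp))
  then show thesis
    by (rule that)
qed


section \<open>Coding spans as graphs\<close>

text \<open>A span from \<open>apex\<close> to \<open>target\<close> along \<open>leg\<close> and to \<open>K\<close> along \<open>val\<close>, enriched by a cardinal \<open>ord\<close>
  and a labelling \<open>link\<close> of its points by elements of that cardinal.\<close>

record 'v span_data =
  apex :: 'v
  target :: 'v
  leg :: 'v
  val :: 'v
  ord :: "'v rel"
  link :: "'v \<Rightarrow> 'v"

abbreviation in_apex :: "'v::zfc \<Rightarrow> 'v" where "in_apex \<phi> \<equiv> pack (tag 0) \<phi>"
abbreviation in_target :: "'v::zfc \<Rightarrow> 'v" where "in_target \<phi> \<equiv> pack (tag 1) \<phi>"
abbreviation in_ord :: "'v::zfc \<Rightarrow> 'v" where "in_ord \<xi> \<equiv> pack (tag 2) \<xi>"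

definition points :: "('v::zfc, 'v) cat \<Rightarrow> 'v set \<Rightarrow> 'v span_data \<Rightarrow> 'v set" where
  "points C S P = (\<Union>s\<in>S. in_apex ` hom C s (apex P)) \<union> (\<Union>s\<in>S. in_target ` hom C s (target P))"

definition span_verts :: "('v::zfc, 'v) cat \<Rightarrow> 'v set \<Rightarrow> 'v span_data \<Rightarrow> 'v set" where
  "span_verts C S P = points C S P \<union> in_ord ` Field (ord P)"

text \<open>The label families have the following purposes, in order: tag 0 records the composite with
  \<open>val\<close>, which fixes also the domain of \<open>\<phi>\<close>; tag 1 records the domain of \<open>\<phi>\<close>; tag 2 is the action of
  the morphisms \<open>e\<close> between dense objects on both sides; tag 3 is composition with \<open>leg\<close>; tag 4 links
  points to the cardinal; tag 5 is its strict order; the tags from 6 on enumerate the chosen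
  ladders.\<close>

definition span_edges :: "('v::zfc, 'v) cat \<Rightarrow> 'v set \<Rightarrow> 'v span_data \<Rightarrow> ('v \<times> 'v \<times> 'v) set" where
  "span_edges C S P =
    {(pack (tag 0) (val P \<cdot>\<^bsub>C\<^esub> \<phi>), in_apex \<phi>, in_apex \<phi>) | \<phi>. \<exists>s\<in>S. \<phi> \<in> hom C s (apex P)} \<union>
    {(pack (tag 1) s, in_target \<phi>, in_target \<phi>) | s \<phi>. s \<in> S \<and> \<phi> \<in> hom C s (target P)} \<union>
    {(pack (tag 2) e, in_apex \<phi>, in_apex (\<phi> \<cdot>\<^bsub>C\<^esub> e)) | e \<phi>.
      \<exists>s\<in>S. \<exists>t\<in>S. e \<in> hom C s t \<and> \<phi> \<in> hom C t (apex P)} \<union>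
    {(pack (tag 2) e, in_target \<phi>, in_target (\<phi> \<cdot>\<^bsub>C\<^esub> e)) | e \<phi>.
      \<exists>s\<in>S. \<exists>t\<in>S. e \<in> hom C s t \<and> \<phi> \<in> hom C t (target P)} \<union>
    {(pack (tag 3) (tag 0), in_apex \<phi>, in_target (leg P \<cdot>\<^bsub>C\<^esub> \<phi>)) | \<phi>. \<exists>s\<in>S. \<phi> \<in> hom C s (apex P)} \<union>
    {(pack (tag 4) (tag 0), x, in_ord (link P x)) | x. x \<in> points C S P} \<union>
    {(pack (tag 5) (tag 0), in_ord \<xi>, in_ord \<zeta>) | \<xi> \<zeta>. less_in (ord P) \<xi> \<zeta>} \<union>
    {(pack (tag (6 + n)) (tag 0), in_ord \<delta>, in_ord (ladder (ord P) \<delta> n)) | n \<delta>. has_ladder (ord P) \<delta>}"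

definition span_labels :: "('v::zfc, 'v) cat \<Rightarrow> 'v set \<Rightarrow> 'v \<Rightarrow> 'v set" where
  "span_labels C S K = {pack a b | a b. a \<in> range tag \<and>
    b \<in> {tag 0} \<union> S \<union> (\<Union>s\<in>S. hom C s K) \<union> (\<Union>s\<in>S. \<Union>t\<in>S. hom C s t)}"

definition span_graph :: "('v::zfc, 'v) cat \<Rightarrow> 'v set \<Rightarrow> 'v span_data \<Rightarrow> 'v" where
  "span_graph C S P = graph (span_verts C S P) (span_edges C S P)"

locale span_coding = locally_small_category C
  for C :: "('v::zfc, 'v) cat" (structure) +
  fixes S :: "'v set" and K :: 'v
  assumes dense: "dense_objects C S" and K: "K \<in> Obj C"
begin

(* Keeps tag 1 in the literal form in which the coding mentions it. *)
declare One_nat_def [simp del]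

lemma S_Obj: "s \<in> S \<Longrightarrow> s \<in> Obj C" and small_S: "small S"
  using dense by (auto simp: dense_objects_def)

lemma small_homs: "s \<in> S \<Longrightarrow> X \<in> Obj C \<Longrightarrow> small (hom C s X)"
  using ls S_Obj by (simp add: locally_small_def)

definition valid_span :: "'v span_data \<Rightarrow> bool" where
  "valid_span P \<longleftrightarrow> apex P \<in> Obj C \<and> target P \<in> Obj C \<and>
    leg P \<in> hom C (apex P) (target P) \<and> val P \<in> hom C (apex P) K \<and>
    regular_cardinal (ord P) \<and> natLeq <o ord P \<and>
    inj_on (link P) (points C S P) \<and> link P ` points C S P \<subseteq> Field (ord P)"

lemma small_span_labels: "small (span_labels C S K)"
  unfolding span_labels_def using small_S S_Obj K
  by (intro small_pack_image small_Un small_UN small_range_nat small_homs) (auto intro: small_finite)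

sublocale labels: label_set "span_labels C S K"
  by unfold_locales (rule small_span_labels)

lemma small_points: "apex P \<in> Obj C \<Longrightarrow> target P \<in> Obj C \<Longrightarrow> small (points C S P)"
  unfolding points_def using small_S by (intro small_Un small_UN small_image small_homs)

lemma small_span_verts: "valid_span P \<Longrightarrow> small (span_verts C S P)"
  unfolding span_verts_def valid_span_def regular_cardinal_def
  by (intro small_Un small_points small_image) auto

lemma hom_pointsI:
  "s \<in> S \<Longrightarrow> \<phi> \<in> hom C s (apex P) \<Longrightarrow> in_apex \<phi> \<in> points C S P"
  "s \<in> S \<Longrightarrow> \<phi> \<in> hom C s (target P) \<Longrightarrow> in_target \<phi> \<in> points C S P"
  by (auto simp: points_def)

lemma span_edges_subset:
  assumes P: "valid_span P"
  shows "span_edges C S P \<subseteq> span_labels C S K \<times> span_verts C S P \<times> span_verts C S P"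
proof -
  have h: "leg P \<in> hom C (apex P) (target P)" and g: "val P \<in> hom C (apex P) K"
    and lk: "link P ` points C S P \<subseteq> Field (ord P)"
    using P by (simp_all add: valid_span_def)
  have lab: "pack (tag n) (tag 0) \<in> span_labels C S K"
    "s \<in> S \<Longrightarrow> pack (tag n) s \<in> span_labels C S K"
    "s \<in> S \<Longrightarrow> k \<in> hom C s K \<Longrightarrow> pack (tag n) k \<in> span_labels C S K"
    "s \<in> S \<Longrightarrow> t \<in> S \<Longrightarrow> e \<in> hom C s t \<Longrightarrow> pack (tag n) e \<in> span_labels C S K" for n s t k e
    unfolding span_labels_def by blast+
  have os: "\<xi> \<in> Field (ord P) \<Longrightarrow> in_ord \<xi> \<in> span_verts C S P" for \<xi>
    by (auto simp: span_verts_def)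
  have pt: "x \<in> points C S P \<Longrightarrow> x \<in> span_verts C S P \<and> in_ord (link P x) \<in> span_verts C S P" for x
    using lk by (auto simp: span_verts_def)
  have lad: "\<delta> \<in> Field (ord P) \<and> ladder (ord P) \<delta> n \<in> Field (ord P)" if "has_ladder (ord P) \<delta>" for \<delta> n
    using is_ladder_ladder[OF that] less_in_Field unfolding is_ladder_def by metis
  have A: "in_apex \<phi> \<in> span_verts C S P \<and> in_target (leg P \<cdot> \<phi>) \<in> span_verts C S P \<and>
      pack (tag 0) (val P \<cdot> \<phi>) \<in> span_labels C S K" if "s \<in> S" "\<phi> \<in> hom C s (apex P)" for s \<phi>
    using pt hom_pointsI that lab(3)[OF that(1)] Cmp_in_hom[OF that(2) g] Cmp_in_hom[OF that(2) h] by metis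
  have B: "in_target \<phi> \<in> span_verts C S P" if "s \<in> S" "\<phi> \<in> hom C s (target P)" for s \<phi>
    using pt hom_pointsI(2)[OF that] by blast
  have comp: "in_apex (\<phi> \<cdot> e) \<in> span_verts C S P" "in_apex \<phi> \<in> span_verts C S P"
    if "s \<in> S" "t \<in> S" "e \<in> hom C s t" "\<phi> \<in> hom C t (apex P)" for s t e \<phi>
    using A[OF that(1) Cmp_in_hom[OF that(3,4)]] A[OF that(2,4)] by blast+
  have comp': "in_target (\<phi> \<cdot> e) \<in> span_verts C S P" "in_target \<phi> \<in> span_verts C S P"
    if "s \<in> S" "t \<in> S" "e \<in> hom C s t" "\<phi> \<in> hom C t (target P)" for s t e \<phi>
    using B[OF that(1) Cmp_in_hom[OF that(3,4)]] B[OF that(2,4)] by blast+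
  show ?thesis
    unfolding span_edges_def
    by (intro Un_least subsetI)
      (auto dest: A B pt lad less_in_Field intro: os lab comp comp')
qed

lemma span_graph_sel:
  assumes "valid_span P"
  shows "verts (span_graph C S P) = span_verts C S P" "edges (span_graph C S P) = span_edges C S P"
    "is_graph (span_labels C S K) (span_graph C S P)"
  using small_span_verts[OF assms] small_span_labels span_edges_subset[OF assms]
  by (simp_all add: span_graph_def verts_graph edges_graph labels.is_graph_graph)

text \<open>Each tag occurs in one family of edges only, except for the action of morphisms, where the tag of
  the source vertex separates the two sides.\<close>

lemma span_edge_iff:
  "(pack (tag 0) k, x, y) \<in> span_edges C S P \<longleftrightarrow>
    (\<exists>\<phi> s. s \<in> S \<and> \<phi> \<in> hom C s (apex P) \<and> k = val P \<cdot> \<phi> \<and> x = in_apex \<phi> \<and> y = in_apex \<phi>)"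
  "(pack (tag 1) s, x, y) \<in> span_edges C S P \<longleftrightarrow>
    (\<exists>\<phi>. s \<in> S \<and> \<phi> \<in> hom C s (target P) \<and> x = in_target \<phi> \<and> y = in_target \<phi>)"
  "(pack (tag 2) e, in_apex \<phi>, y) \<in> span_edges C S P \<longleftrightarrow>
    (\<exists>s\<in>S. \<exists>t\<in>S. e \<in> hom C s t \<and> \<phi> \<in> hom C t (apex P) \<and> y = in_apex (\<phi> \<cdot> e))"
  "(pack (tag 2) e, in_target \<phi>, y) \<in> span_edges C S P \<longleftrightarrow>
    (\<exists>s\<in>S. \<exists>t\<in>S. e \<in> hom C s t \<and> \<phi> \<in> hom C t (target P) \<and> y = in_target (\<phi> \<cdot> e))"
  "(pack (tag 3) z, x, y) \<in> span_edges C S P \<longleftrightarrow>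
    z = tag 0 \<and> (\<exists>\<phi> s. s \<in> S \<and> \<phi> \<in> hom C s (apex P) \<and> x = in_apex \<phi> \<and> y = in_target (leg P \<cdot> \<phi>))"
  "(pack (tag 4) z, x, y) \<in> span_edges C S P \<longleftrightarrow>
    z = tag 0 \<and> x \<in> points C S P \<and> y = in_ord (link P x)"
  "(pack (tag 5) z, x, y) \<in> span_edges C S P \<longleftrightarrow>
    z = tag 0 \<and> (\<exists>\<xi> \<zeta>. less_in (ord P) \<xi> \<zeta> \<and> x = in_ord \<xi> \<and> y = in_ord \<zeta>)"
  "(pack (tag (6 + n)) z, x, y) \<in> span_edges C S P \<longleftrightarrow>
    z = tag 0 \<and> (\<exists>\<delta>. has_ladder (ord P) \<delta> \<and> x = in_ord \<delta> \<and> y = in_ord (ladder (ord P) \<delta> n))"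
  unfolding span_edges_def by (simp; blast)+

lemma dense_induced:
  assumes "X \<in> Obj C" "M \<in> Obj C" "\<And>s \<phi>. s \<in> S \<Longrightarrow> \<phi> \<in> hom C s X \<Longrightarrow> \<alpha> \<phi> \<in> hom C s M"
    and "\<And>s t e \<phi>. s \<in> S \<Longrightarrow> t \<in> S \<Longrightarrow> e \<in> hom C s t \<Longrightarrow> \<phi> \<in> hom C t X \<Longrightarrow> \<alpha> (\<phi> \<cdot> e) = \<alpha> \<phi> \<cdot> e"
  obtains a where "a \<in> hom C X M" "\<And>s \<phi>. s \<in> S \<Longrightarrow> \<phi> \<in> hom C s X \<Longrightarrow> a \<cdot> \<phi> = \<alpha> \<phi>"
proof -
  have "(\<forall>s\<in>S. \<forall>\<phi>\<in>hom C s X. \<alpha> \<phi> \<in> hom C s M) \<and>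
      (\<forall>s\<in>S. \<forall>t\<in>S. \<forall>e\<in>hom C s t. \<forall>\<phi>\<in>hom C t X. \<alpha> (\<phi> \<cdot> e) = \<alpha> \<phi> \<cdot> e)"
    using assms(3,4) by blast
  then have "\<exists>!a. a \<in> hom C X M \<and> (\<forall>s\<in>S. \<forall>\<phi>\<in>hom C s X. a \<cdot> \<phi> = \<alpha> \<phi>)"
    using dense assms(1,2) unfolding dense_objects_def by simp
  then show thesis
    using that by blast
qed

lemma dense_jointly_epic:
  assumes u: "u \<in> hom C X M" and v: "v \<in> hom C X M"
    and eq: "\<And>s \<phi>. s \<in> S \<Longrightarrow> \<phi> \<in> hom C s X \<Longrightarrow> u \<cdot> \<phi> = v \<cdot> \<phi>"
  shows "u = v"
proof -
  have "(\<forall>s\<in>S. \<forall>\<phi>\<in>hom C s X. u \<cdot> \<phi> \<in> hom C s M) \<and>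
      (\<forall>s\<in>S. \<forall>t\<in>S. \<forall>e\<in>hom C s t. \<forall>\<phi>\<in>hom C t X. u \<cdot> (\<phi> \<cdot> e) = u \<cdot> \<phi> \<cdot> e)"
    using Cmp_in_hom Cmp_assoc u by blast
  then have "\<exists>!a. a \<in> hom C X M \<and> (\<forall>s\<in>S. \<forall>\<phi>\<in>hom C s X. a \<cdot> \<phi> = u \<cdot> \<phi>)"
    using dense homD[OF u] unfolding dense_objects_def by simp
  moreover have "\<forall>s\<in>S. \<forall>\<phi>\<in>hom C s X. v \<cdot> \<phi> = u \<cdot> \<phi>"
    using eq by simp
  ultimately show ?thesis
    using u v by blast
qed

text \<open>The labels force a graph homomorphism to act on the morphisms \<open>s \<rightarrow> A\<close> and \<open>s \<rightarrow> B\<close> by natural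
  families, which density turns into morphisms \<open>a\<close> and \<open>b\<close>; the two equations hold since they hold
  after composition with every morphism from a dense object.\<close>

lemma span_graph_hom_span:
  assumes P: "valid_span P" and P': "valid_span P'"
    and f: "graph_hom (span_graph C S P) (span_graph C S P') f"
  obtains a b where "a \<in> hom C (apex P) (apex P')" "b \<in> hom C (target P) (target P')"
    "leg P' \<cdot> a = b \<cdot> leg P" "val P' \<cdot> a = val P"
proof -
  have h: "leg P \<in> hom C (apex P) (target P)" and g: "val P \<in> hom C (apex P) K"
    and h': "leg P' \<in> hom C (apex P') (target P')" and g': "val P' \<in> hom C (apex P') K"
    and obj: "apex P \<in> Obj C" "target P \<in> Obj C" "apex P' \<in> Obj C" "target P' \<in> Obj C"
    using P P' by (simp_all add: valid_span_def)
  have edge: "(l, f x, f y) \<in> span_edges C S P'" if "(l, x, y) \<in> span_edges C S P" for l x y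
    using f that span_graph_sel(2)[OF P] span_graph_sel(2)[OF P'] by (simp add: graph_hom_def)
  define \<alpha> where "\<alpha> \<phi> = psnd (f (in_apex \<phi>))" for \<phi>
  define \<beta> where "\<beta> \<phi> = psnd (f (in_target \<phi>))" for \<phi>
  have \<alpha>: "f (in_apex \<phi>) = in_apex (\<alpha> \<phi>) \<and> \<alpha> \<phi> \<in> hom C s (apex P') \<and> val P' \<cdot> \<alpha> \<phi> = val P \<cdot> \<phi>"
    if s: "s \<in> S" and \<phi>: "\<phi> \<in> hom C s (apex P)" for s \<phi>
  proof -
    have "(pack (tag 0) (val P \<cdot> \<phi>), in_apex \<phi>, in_apex \<phi>) \<in> span_edges C S P"
      unfolding span_edge_iff using s \<phi> by blast
    then obtain \<psi> t where \<psi>: "t \<in> S" "\<psi> \<in> hom C t (apex P')" "val P \<cdot> \<phi> = val P' \<cdot> \<psi>"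
        "f (in_apex \<phi>) = in_apex \<psi>"
      using edge span_edge_iff(1) by blast
    \<comment> \<open>A morphism knows its domain, so the value in \<open>K\<close> determines the sort.\<close>
    have "s = t"
      using homD[OF Cmp_in_hom[OF \<phi> g]] homD[OF Cmp_in_hom[OF \<psi>(2) g']] \<psi>(3) by simp
    then show ?thesis
      using \<psi> by (simp add: \<alpha>_def)
  qed
  have \<beta>: "f (in_target \<phi>) = in_target (\<beta> \<phi>) \<and> \<beta> \<phi> \<in> hom C s (target P')"
    if s: "s \<in> S" and \<phi>: "\<phi> \<in> hom C s (target P)" for s \<phi>
  proof -
    have "(pack (tag 1) s, in_target \<phi>, in_target \<phi>) \<in> span_edges C S P"
      unfolding span_edge_iff using s \<phi> by blast
    then obtain \<psi> where "\<psi> \<in> hom C s (target P')" "f (in_target \<phi>) = in_target \<psi>"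
      using edge span_edge_iff(2) by blast
    then show ?thesis
      by (simp add: \<beta>_def)
  qed
  have \<alpha>_nat: "\<alpha> (\<phi> \<cdot> e) = \<alpha> \<phi> \<cdot> e"
    if s: "s \<in> S" and t: "t \<in> S" and e: "e \<in> hom C s t" and \<phi>: "\<phi> \<in> hom C t (apex P)" for s t e \<phi>
  proof -
    have "(pack (tag 2) e, in_apex \<phi>, in_apex (\<phi> \<cdot> e)) \<in> span_edges C S P"
      unfolding span_edge_iff using s t e \<phi> by blast
    from edge[OF this] show ?thesis
      using \<alpha>[OF t \<phi>] \<alpha>[OF s Cmp_in_hom[OF e \<phi>]] by (auto simp: span_edge_iff)
  qed
  have \<beta>_nat: "\<beta> (\<phi> \<cdot> e) = \<beta> \<phi> \<cdot> e"
    if s: "s \<in> S" and t: "t \<in> S" and e: "e \<in> hom C s t" and \<phi>: "\<phi> \<in> hom C t (target P)" for s t e \<phi>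
  proof -
    have "(pack (tag 2) e, in_target \<phi>, in_target (\<phi> \<cdot> e)) \<in> span_edges C S P"
      unfolding span_edge_iff using s t e \<phi> by blast
    from edge[OF this] show ?thesis
      using \<beta>[OF t \<phi>] \<beta>[OF s Cmp_in_hom[OF e \<phi>]] by (auto simp: span_edge_iff)
  qed
  have \<alpha>\<beta>: "\<beta> (leg P \<cdot> \<phi>) = leg P' \<cdot> \<alpha> \<phi>" if s: "s \<in> S" and \<phi>: "\<phi> \<in> hom C s (apex P)" for s \<phi>
  proof -
    have "(pack (tag 3) (tag 0), in_apex \<phi>, in_target (leg P \<cdot> \<phi>)) \<in> span_edges C S P"
      unfolding span_edge_iff using s \<phi> by blast
    from edge[OF this] show ?thesis
      using \<alpha>[OF s \<phi>] \<beta>[OF s Cmp_in_hom[OF \<phi> h]] by (auto simp: span_edge_iff)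
  qed
  obtain a where a: "a \<in> hom C (apex P) (apex P')"
      "\<And>s \<phi>. s \<in> S \<Longrightarrow> \<phi> \<in> hom C s (apex P) \<Longrightarrow> a \<cdot> \<phi> = \<alpha> \<phi>"
    using dense_induced[OF obj(1,3), of \<alpha>] \<alpha> \<alpha>_nat by blast
  obtain b where b: "b \<in> hom C (target P) (target P')"
      "\<And>s \<phi>. s \<in> S \<Longrightarrow> \<phi> \<in> hom C s (target P) \<Longrightarrow> b \<cdot> \<phi> = \<beta> \<phi>"
    using dense_induced[OF obj(2,4), of \<beta>] \<beta> \<beta>_nat by blast
  have "leg P' \<cdot> a = b \<cdot> leg P"
  proof (rule dense_jointly_epic[OF Cmp_in_hom[OF a(1) h'] Cmp_in_hom[OF h b(1)]])
    fix s \<phi>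
    assume s: "s \<in> S" and \<phi>: "\<phi> \<in> hom C s (apex P)"
    show "leg P' \<cdot> a \<cdot> \<phi> = b \<cdot> leg P \<cdot> \<phi>"
      using Cmp_assoc[OF \<phi> a(1) h'] Cmp_assoc[OF \<phi> h b(1)] a(2)[OF s \<phi>]
        b(2)[OF s Cmp_in_hom[OF \<phi> h]] \<alpha>\<beta>[OF s \<phi>] by simp
  qed
  moreover have "val P' \<cdot> a = val P"
  proof (rule dense_jointly_epic[OF Cmp_in_hom[OF a(1) g'] g])
    fix s \<phi>
    assume s: "s \<in> S" and \<phi>: "\<phi> \<in> hom C s (apex P)"
    show "val P' \<cdot> a \<cdot> \<phi> = val P \<cdot> \<phi>"
      using Cmp_assoc[OF \<phi> a(1) g'] a(2)[OF s \<phi>] \<alpha>[OF s \<phi>] by simp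
  qed
  ultimately show thesis
    by (rule that[OF a(1) b(1)])
qed

text \<open>The edges of the order can only be mapped to edges of the order, which keeps the elements of the
  cardinal among themselves.\<close>

lemma span_graph_hom_ord:
  assumes P: "valid_span P" and P': "valid_span P'"
    and f: "graph_hom (span_graph C S P) (span_graph C S P') f"
  obtains \<rho> where "\<forall>\<xi>\<in>Field (ord P). f (in_ord \<xi>) = in_ord (\<rho> \<xi>) \<and> \<rho> \<xi> \<in> Field (ord P')"
    "\<forall>\<xi> \<zeta>. less_in (ord P) \<xi> \<zeta> \<longrightarrow> less_in (ord P') (\<rho> \<xi>) (\<rho> \<zeta>)"
    "\<forall>\<delta>. has_ladder (ord P) \<delta> \<longrightarrow> has_ladder (ord P') (\<rho> \<delta>) \<and>
      (\<forall>n. \<rho> (ladder (ord P) \<delta> n) = ladder (ord P') (\<rho> \<delta>) n)"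
proof -
  have edge: "(l, f x, f y) \<in> span_edges C S P'" if "(l, x, y) \<in> span_edges C S P" for l x y
    using f that span_graph_sel(2)[OF P] span_graph_sel(2)[OF P'] by (simp add: graph_hom_def)
  have C: "Card_order (ord P)" "infinite (Field (ord P))"
    using P by (auto simp: valid_span_def regular_cardinal_def cinfinite_def)
  define \<rho> where "\<rho> \<xi> = psnd (f (in_ord \<xi>))" for \<xi>
  have less: "f (in_ord \<xi>) = in_ord (\<rho> \<xi>) \<and> f (in_ord \<zeta>) = in_ord (\<rho> \<zeta>) \<and>
      less_in (ord P') (\<rho> \<xi>) (\<rho> \<zeta>)" if "less_in (ord P) \<xi> \<zeta>" for \<xi> \<zeta>
  proof -
    have "(pack (tag 5) (tag 0), in_ord \<xi>, in_ord \<zeta>) \<in> span_edges C S P"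
      unfolding span_edge_iff using that by blast
    from edge[OF this] show ?thesis
      by (auto simp: span_edge_iff \<rho>_def)
  qed
  \<comment> \<open>An infinite cardinal has no greatest element, so each of its elements lies on an edge.\<close>
  have \<rho>: "f (in_ord \<xi>) = in_ord (\<rho> \<xi>) \<and> \<rho> \<xi> \<in> Field (ord P')" if \<xi>: "\<xi> \<in> Field (ord P)" for \<xi>
  proof -
    obtain \<zeta> where \<zeta>: "less_in (ord P) \<xi> \<zeta>"
      using infinite_Card_order_limit[OF C \<xi>] unfolding less_in_def by blast
    show ?thesis
      using less[OF \<zeta>] less_in_Field[of "ord P'"] by blast
  qed
  have lad: "has_ladder (ord P') (\<rho> \<delta>) \<and> \<rho> (ladder (ord P) \<delta> n) = ladder (ord P') (\<rho> \<delta>) n"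
    if \<delta>: "has_ladder (ord P) \<delta>" for \<delta> n
  proof -
    have l: "ladder (ord P) \<delta> n \<in> Field (ord P)"
      using is_ladder_ladder[OF \<delta>] less_in_Field unfolding is_ladder_def by metis
    have \<delta>F: "\<delta> \<in> Field (ord P)"
      using \<delta> by (simp add: has_ladder_def)
    have "(pack (tag (6 + n)) (tag 0), in_ord \<delta>, in_ord (ladder (ord P) \<delta> n)) \<in> span_edges C S P"
      unfolding span_edge_iff using \<delta> by blast
    from edge[OF this] show ?thesis
      using \<rho>[OF \<delta>F] \<rho>[OF l] unfolding span_edge_iff by auto
  qed
  show thesis
    by (rule that[of \<rho>]) (simp_all add: \<rho> less lad)
qed

lemma span_graph_hom_ord_le:
  assumes P: "valid_span P" and P': "valid_span P'"
    and f: "graph_hom (span_graph C S P) (span_graph C S P') f"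
  shows "ord P \<le>o ord P'"
proof -
  have reg: "regular_cardinal (ord P)" "regular_cardinal (ord P')"
    using P P' by (simp_all add: valid_span_def)
  have wo: "Well_order (ord P)"
    using regular_cardinal_Card_order[OF reg(1)] by (simp add: card_order_on_def)
  obtain \<rho> where \<rho>: "\<forall>\<xi>\<in>Field (ord P). f (in_ord \<xi>) = in_ord (\<rho> \<xi>) \<and> \<rho> \<xi> \<in> Field (ord P')"
      "\<forall>\<xi> \<zeta>. less_in (ord P) \<xi> \<zeta> \<longrightarrow> less_in (ord P') (\<rho> \<xi>) (\<rho> \<zeta>)"
    by (rule span_graph_hom_ord[OF P P' f])
  have "inj_on \<rho> (Field (ord P))"
  proof (rule inj_onI)
    fix \<xi> \<zeta>
    assume "\<xi> \<in> Field (ord P)" "\<zeta> \<in> Field (ord P)" "\<rho> \<xi> = \<rho> \<zeta>"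
    then show "\<xi> = \<zeta>"
      using \<rho>(2) well_order_cases[OF wo] unfolding less_in_def by metis
  qed
  then have "|Field (ord P)| \<le>o |Field (ord P')|"
    using \<rho>(1) card_of_ordLeqI by blast
  then show ?thesis
    using regular_cardinal_Field[OF reg(1)] regular_cardinal_Field[OF reg(2)]
      ordIso_ordLeq_trans ordIso_symmetric ordLeq_ordIso_trans by metis
qed

text \<open>Elements of the cardinal are fixed by \<open>ladder_rigid\<close>, and a point is determined by the element
  to which it is linked.\<close>

lemma span_graph_rigid:
  assumes P: "valid_span P" and f: "graph_hom (span_graph C S P) (span_graph C S P) f"
    and x: "x \<in> span_verts C S P"
  shows "f x = x"
proof -
  have reg: "Card_order (ord P)" "regularCard (ord P)" "natLeq <o ord P"
    and inj: "inj_on (link P) (points C S P)" and lk: "link P ` points C S P \<subseteq> Field (ord P)"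
    using P by (simp_all add: valid_span_def regular_cardinal_def)
  obtain \<rho> where \<rho>: "\<forall>\<xi>\<in>Field (ord P). f (in_ord \<xi>) = in_ord (\<rho> \<xi>) \<and> \<rho> \<xi> \<in> Field (ord P)"
      "\<forall>\<xi> \<zeta>. less_in (ord P) \<xi> \<zeta> \<longrightarrow> less_in (ord P) (\<rho> \<xi>) (\<rho> \<zeta>)"
      "\<forall>\<delta>. has_ladder (ord P) \<delta> \<longrightarrow> has_ladder (ord P) (\<rho> \<delta>) \<and>
        (\<forall>n. \<rho> (ladder (ord P) \<delta> n) = ladder (ord P) (\<rho> \<delta>) n)"
    by (rule span_graph_hom_ord[OF P P f])
  have fix_ord: "f (in_ord \<xi>) = in_ord \<xi>" if "\<xi> \<in> Field (ord P)" for \<xi>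
    using ladder_rigid[OF reg, of \<rho> \<xi>] \<rho> that by simp
  show ?thesis
  proof (cases "x \<in> points C S P")
    case True
    then have "(pack (tag 4) (tag 0), x, in_ord (link P x)) \<in> edges (span_graph C S P)"
      unfolding span_graph_sel(2)[OF P] span_edge_iff by simp
    then have "(pack (tag 4) (tag 0), f x, in_ord (link P x)) \<in> edges (span_graph C S P)"
      using f fix_ord[of "link P x"] lk True unfolding graph_hom_def by (metis image_subset_iff)
    then have "f x \<in> points C S P" "link P (f x) = link P x"
      unfolding span_graph_sel(2)[OF P] span_edge_iff by simp_all
    then show ?thesis
      using inj True by (metis inj_onD)
  next
    case False
    then show ?thesis
      using x fix_ord by (auto simp: span_verts_def)
  qed
qed

end


section \<open>Pure injectivity under Vopenka's principle\<close>

text \<open>The only use of purity: the square formed by \<open>h\<close> and \<open>h'\<close> has a diagonal \<open>t\<close>, and composing \<open>t\<close>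
  with \<open>g'\<close> extends \<open>g\<close> along \<open>h\<close>.\<close>

lemma (in locally_small_category) pure_extension:
  assumes pure: "pure C \<mu> A' B' h'" and pres: "presentable C \<mu> A" "presentable C \<mu> B"
    and h: "h \<in> hom C A B" and a: "a \<in> hom C A A'" and b: "b \<in> hom C B B'" and sq: "h' \<cdot> a = b \<cdot> h"
    and g': "g' \<in> hom C A' K" and g: "g' \<cdot> a = g"
  shows "\<exists>e\<in>hom C B K. e \<cdot> h = g"
proof -
  obtain t where t: "t \<in> hom C B A'" "t \<cdot> h = a"
    using pure pres h a b sq unfolding pure_def by blast
  then have "(g' \<cdot> t) \<cdot> h = g"
    using Cmp_assoc[OF h t(1) g'] g by simp
  then show ?thesis
    using Cmp_in_hom[OF t(1) g'] by blast
qed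

theorem theorem3p1:
  fixes C :: "('v::zfc, 'v) cat"
  assumes "vopenka_principle TYPE('v)"
    and "locally_presentable C"
  shows "\<forall>K\<in>Obj C. \<exists>\<mu>. regular_cardinal \<mu> \<and> pure_injective C \<mu> K"
proof (rule ballI, rule ccontr)
  fix K
  assume K: "K \<in> Obj C" and no: "\<not> (\<exists>\<mu>. regular_cardinal \<mu> \<and> pure_injective C \<mu> K)"
  interpret locally_small_category C
    by (rule locally_presentable_category[OF assms(2)])
  obtain S where S: "dense_objects C S"
    by (rule locally_presentable_dense[OF assms(2)])
  interpret span_coding C S K
    by unfold_locales (rule S, rule K)
  let ?G = "span_graph C S"
  \<comment> \<open>A span witnessing that \<open>K\<close> is not \<open>\<mu>\<close>-pure injective, enriched by a cardinal so large that
    it exceeds \<open>\<mu>\<close>, labels all points, and bounds the presentability ranks of the two objects.\<close>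
  define bad where "bad \<mu> P \<longleftrightarrow> valid_span P \<and> pure C \<mu> (apex P) (target P) (leg P) \<and>
    \<not> (\<exists>e\<in>hom C (target P) K. e \<cdot>\<^bsub>C\<^esub> leg P = val P) \<and> \<mu> <o ord P \<and>
    (\<forall>\<mu>'. regular_cardinal \<mu>' \<longrightarrow> ord P \<le>o \<mu>' \<longrightarrow>
      presentable C \<mu>' (apex P) \<and> presentable C \<mu>' (target P))" for \<mu> P
  have "\<exists>P. bad \<mu> P" if \<mu>: "regular_cardinal \<mu>" for \<mu>
  proof -
    obtain A B h g where A: "A \<in> Obj C" and B: "B \<in> Obj C" and h: "pure C \<mu> A B h"
      and g: "g \<in> hom C A K" and ne: "\<not> (\<exists>e\<in>hom C B K. e \<cdot>\<^bsub>C\<^esub> h = g)"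
      using no \<mu> K unfolding pure_injective_def by blast
    let ?P = "\<lambda>\<nu> l. \<lparr>apex = A, target = B, leg = h, val = g, ord = \<nu>, link = l\<rparr>"
    let ?X = "points C S (?P {} id)"
    have X: "points C S (?P \<nu> l) = ?X" for \<nu> l
      by (simp add: points_def)
    obtain ZA :: "'v set" where ZA: "small ZA" "\<forall>\<mu>. regular_cardinal \<mu> \<longrightarrow> |ZA| <o \<mu> \<longrightarrow> presentable C \<mu> A"
      by (rule ex_presentability_bound[OF assms(2) A])
    obtain ZB :: "'v set" where ZB: "small ZB" "\<forall>\<mu>. regular_cardinal \<mu> \<longrightarrow> |ZB| <o \<mu> \<longrightarrow> presentable C \<mu> B"
      by (rule ex_presentability_bound[OF assms(2) B])
    have "small (Field \<mu> \<union> ?X \<union> ZA \<union> ZB)"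
      using \<mu> ZA(1) ZB(1) small_points[of "?P {} id"] A B
      by (intro small_Un) (auto simp: regular_cardinal_def)
    then obtain \<nu> :: "'v rel" where \<nu>: "regular_cardinal \<nu>" "natLeq <o \<nu>"
        and Z: "|Field \<mu> \<union> ?X \<union> ZA \<union> ZB| <o \<nu>"
      by (rule ex_regular_cardinal)
    have less: "|Y| <o \<nu>" if "Y \<subseteq> Field \<mu> \<union> ?X \<union> ZA \<union> ZB" for Y
      using card_of_mono1[OF that] Z by (rule ordLeq_ordLess_trans)
    have "|?X| <o \<nu>"
      by (rule less) blast
    then have "|?X| \<le>o |Field \<nu>|"
      using regular_cardinal_Field[OF \<nu>(1)] ordLess_imp_ordLeq ordIso_symmetric ordLeq_ordIso_trans
      by blast
    then obtain l where l: "inj_on l ?X" "l ` ?X \<subseteq> Field \<nu>"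
      by (metis card_of_ordLeq)
    have "valid_span (?P \<nu> l)"
      unfolding valid_span_def X[of \<nu> l] using A B h g \<nu> l by (simp add: pure_def)
    moreover have "\<mu> <o \<nu>"
      using ordIso_ordLess_trans[OF ordIso_symmetric[OF regular_cardinal_Field[OF \<mu>]] less[of "Field \<mu>"]]
      by blast
    moreover have "presentable C \<mu>' A \<and> presentable C \<mu>' B"
      if "regular_cardinal \<mu>'" "\<nu> \<le>o \<mu>'" for \<mu>'
      using ZA(2) ZB(2) that(1) ordLess_ordLeq_trans[OF less[of ZA] that(2)]
        ordLess_ordLeq_trans[OF less[of ZB] that(2)] by blast
    ultimately have "bad \<mu> (?P \<nu> l)"
      unfolding bad_def using h ne by simp
    then show ?thesis
      by blast
  qed
  then obtain P where P: "\<And>\<mu>. regular_cardinal \<mu> \<Longrightarrow> bad \<mu> (P \<mu>)"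
    by metis
  have valid: "valid_span (P \<mu>)" and less_ord: "\<mu> <o ord (P \<mu>)" if "regular_cardinal \<mu>" for \<mu>
    using P[OF that] by (simp_all add: bad_def)
  \<comment> \<open>Of two cardinals in a sparse class, one lies beyond the cardinal that enriches the span of the other.  Zorn's lemma
    replaces the recursion that would enumerate such a class.\<close>
  define sparse where "sparse Q \<longleftrightarrow> (\<forall>\<mu>\<in>Q. regular_cardinal \<mu>) \<and>
    (\<forall>\<mu>\<in>Q. \<forall>\<mu>'\<in>Q. \<mu> \<noteq> \<mu>' \<longrightarrow> ord (P \<mu>) \<le>o \<mu>' \<or> ord (P \<mu>') \<le>o \<mu>)" for Q
  have "\<exists>Q\<in>{Q. sparse Q}. \<forall>Q'\<in>{Q. sparse Q}. Q \<subseteq> Q' \<longrightarrow> Q' = Q"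
  proof (rule subset_Zorn')
    fix \<C>
    assume ch: "subset.chain {Q. sparse Q} \<C>"
    have sp: "sparse Q" if "Q \<in> \<C>" for Q
      using ch that by (auto simp: subset_chain_def)
    have "ord (P \<mu>) \<le>o \<mu>' \<or> ord (P \<mu>') \<le>o \<mu>"
      if "\<mu> \<in> Q" "Q \<in> \<C>" "\<mu>' \<in> Q'" "Q' \<in> \<C>" "\<mu> \<noteq> \<mu>'" for \<mu> \<mu>' Q Q'
    proof -
      have "Q \<subseteq> Q' \<or> Q' \<subseteq> Q"
        using ch that by (auto simp: subset_chain_def)
      then show ?thesis
        using sp[OF that(2)] sp[OF that(4)] that unfolding sparse_def by blast
    qed
    moreover have "regular_cardinal \<mu>" if "\<mu> \<in> Q" "Q \<in> \<C>" for \<mu> Q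
      using sp[OF that(2)] that(1) by (simp add: sparse_def)
    ultimately have "sparse (\<Union>\<C>)"
      unfolding sparse_def by blast
    then show "\<Union>\<C> \<in> {Q. sparse Q}"
      by simp
  qed
  then obtain Q where Q: "sparse Q" and max: "\<And>Q'. sparse Q' \<Longrightarrow> Q \<subseteq> Q' \<Longrightarrow> Q' = Q"
    by blast
  have regQ: "regular_cardinal \<mu>" if "\<mu> \<in> Q" for \<mu>
    using Q that by (simp add: sparse_def)
  let ?L = "span_labels C S K"
  let ?D = "(\<lambda>\<mu>. ?G (P \<mu>)) ` Q"
  have no_hom: False
    if \<mu>: "\<mu> \<in> Q" "\<mu>' \<in> Q" "\<mu> \<noteq> \<mu>'" and f: "graph_hom (?G (P \<mu>)) (?G (P \<mu>')) f" for \<mu> \<mu>' f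
  proof -
    note reg = regQ[OF \<mu>(1)] regQ[OF \<mu>(2)]
    note v = valid[OF reg(1)] valid[OF reg(2)]
    have "ord (P \<mu>) \<le>o \<mu>' \<or> ord (P \<mu>') \<le>o \<mu>"
      using Q \<mu> by (simp add: sparse_def)
    then show False
    proof
      assume le: "ord (P \<mu>) \<le>o \<mu>'"
      obtain a b where ab: "a \<in> hom C (apex (P \<mu>)) (apex (P \<mu>'))" "b \<in> hom C (target (P \<mu>)) (target (P \<mu>'))"
          "leg (P \<mu>') \<cdot>\<^bsub>C\<^esub> a = b \<cdot>\<^bsub>C\<^esub> leg (P \<mu>)" "val (P \<mu>') \<cdot>\<^bsub>C\<^esub> a = val (P \<mu>)"
        by (rule span_graph_hom_span[OF v f])
      have "\<exists>e\<in>hom C (target (P \<mu>)) K. e \<cdot>\<^bsub>C\<^esub> leg (P \<mu>) = val (P \<mu>)"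
      proof (rule pure_extension[OF _ _ _ _ ab(1-3) _ ab(4)])
        show "pure C \<mu>' (apex (P \<mu>')) (target (P \<mu>')) (leg (P \<mu>'))"
          using P[OF reg(2)] by (simp add: bad_def)
        show "presentable C \<mu>' (apex (P \<mu>))" "presentable C \<mu>' (target (P \<mu>))"
          using P[OF reg(1)] reg(2) le by (simp_all add: bad_def)
        show "leg (P \<mu>) \<in> hom C (apex (P \<mu>)) (target (P \<mu>))" "val (P \<mu>') \<in> hom C (apex (P \<mu>')) K"
          using v by (simp_all add: valid_span_def)
      qed
      then show False
        using P[OF reg(1)] by (simp add: bad_def)
    next
      assume "ord (P \<mu>') \<le>o \<mu>"
      then have "ord (P \<mu>') <o ord (P \<mu>)"
        using less_ord[OF reg(1)] by (rule ordLeq_ordLess_trans)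
      then show False
        using span_graph_hom_ord_le[OF v f] not_ordLess_ordLeq by blast
    qed
  qed
  have "discrete (full_subcategory (Gra ?L) ?D)"
    unfolding discrete_def
  proof
    fix m
    assume "m \<in> Arr (full_subcategory (Gra ?L) ?D)"
    then have m: "m \<in> Arr (Gra ?L)" "Dom (Gra ?L) m \<in> ?D" "Cod (Gra ?L) m \<in> ?D"
      by (simp_all add: full_subcategory_def del: Gra_sel)
    then obtain \<mu> \<mu>' where \<mu>: "\<mu> \<in> Q" "\<mu>' \<in> Q" and dc: "Dom (Gra ?L) m = ?G (P \<mu>)" "Cod (Gra ?L) m = ?G (P \<mu>')"
      by blast
    have mh: "m \<in> hom (Gra ?L) (?G (P \<mu>)) (?G (P \<mu>'))"
      using m(1) dc by (simp add: hom_def del: Gra_sel)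
    then have f: "graph_hom (?G (P \<mu>)) (?G (P \<mu>')) (app m)" and m_eq: "m = mor (?G (P \<mu>)) (?G (P \<mu>')) (app m)"
      by (simp_all add: hom_Gra)
    have eq: "\<mu> = \<mu>'"
      using no_hom[OF \<mu> _ f] by blast
    note v = valid[OF regQ[OF \<mu>(1)]]
    have "mor (?G (P \<mu>)) (?G (P \<mu>)) (app m) = mor (?G (P \<mu>)) (?G (P \<mu>)) (\<lambda>x. x)"
      by (rule mor_cong, rule span_graph_rigid[OF v])
        (use f eq span_graph_sel(1)[OF v] in simp_all)
    then have "m = Idt (Gra ?L) (Dom (Gra ?L) m)"
      using m_eq eq dc by simp
    then show "m = Idt (full_subcategory (Gra ?L) ?D) (Dom (full_subcategory (Gra ?L) ?D) m)"
      by (simp add: full_subcategory_def del: Gra_sel)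
  qed
  moreover have "?D \<subseteq> Obj (Gra ?L)"
    using span_graph_sel(3)[OF valid[OF regQ]] by auto
  ultimately have D: "small ?D"
    using assms(1) labels.locally_presentable_Gra unfolding vopenka_principle_def by blast
  \<comment> \<open>A regular cardinal beyond all enriching cardinals extends the class, so it belongs to it by
    maximality; but then it exceeds the cardinal that enriches its own span.\<close>
  have "small (\<Union>G\<in>?D. verts G)"
    by (rule small_UN[OF D small_verts])
  then obtain \<mu> :: "'v rel" where \<mu>: "regular_cardinal \<mu>" and W: "|\<Union>G\<in>?D. verts G| <o \<mu>"
      and "natLeq <o \<mu>"
    by (rule ex_regular_cardinal)
  have ord_less: "ord (P \<mu>') <o \<mu>" if "\<mu>' \<in> Q" for \<mu>'
  proof -
    note reg = regQ[OF that]
    have sub: "in_ord ` Field (ord (P \<mu>')) \<subseteq> (\<Union>G\<in>?D. verts G)"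
      using that span_graph_sel(1)[OF valid[OF reg]] by (auto simp: span_verts_def)
    have "|Field (ord (P \<mu>'))| \<le>o |\<Union>G\<in>?D. verts G|"
      by (rule card_of_ordLeqI[where f = in_ord]) (use sub in \<open>auto simp: inj_on_def\<close>)
    then have "|Field (ord (P \<mu>'))| <o \<mu>"
      using W by (rule ordLeq_ordLess_trans)
    moreover have "regular_cardinal (ord (P \<mu>'))"
      using valid[OF reg] by (simp add: valid_span_def)
    ultimately show ?thesis
      using regular_cardinal_Field ordIso_symmetric ordIso_ordLess_trans by blast
  qed
  then have "sparse (insert \<mu> Q)"
    using Q \<mu> unfolding sparse_def by (auto intro: ordLess_imp_ordLeq)
  then have "\<mu> \<in> Q"
    using max by blast
  then have "\<mu> <o \<mu>"
    using less_ord[OF \<mu>] ord_less ordLess_transitive by blast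
  then show False
    using not_ordLess_ordLeq ordLess_imp_ordLeq by blast
qed

end
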